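(* Let $\theta$ be an irrational number, let $\gamma\in C(\mathbb{T})$ be a non-negative function, and let $Y=\{z\in\mathbb{T}:\gamma(z)=0\}$ be its set of zeros. Let $\Delta$ be a subset of $\mathbb{T}$ which contains exactly one point of each orbit $Orb(\xi)$, $\xi\in\mathbb{T}$. Let $\xi_1,\xi_2,\dots,\xi_r\in\Delta$ and $Y_j=Y\cap Orb(\xi_j)$, $j=1,2,\dots,r$, be such that $Y=\bigcup_{j=1}^rY_j$. Suppose that $Y$ is a finite set. Then $$\dim\left(\mathrm{Tr}(A_{\theta,\gamma})\right)=1+\sum_{j=1}^r(|Y_j|-1),$$ where $|Y_j|$ is the number of elements in $Y_j$.
   Context: $\mathbb{T}$ is the unit circle, $\phi(z)=e^{2\pi i\theta}z$ is the rotation by $\theta$, and $Orb(\xi)=\{\phi^n(\xi):n\in\mathbb{Z}\}$. $A_{\theta,\gamma}=C^*(x,w)$ is the universal unital $C^*$-algebra generated by elements $x,w$ subject to the relations $w^*w=ww^*=1$, $x^*x=\gamma(w)$, $xx^*=\gamma(e^{-2\pi i\theta}w)$, $xw=e^{-2\pi i\theta}wx$ (functions of the unitary $w$ are taken by continuous functional calculus). $\mathrm{Tr}(A_{\theta,\gamma})$ is the space of bounded tracial linear functionals on $A_{\theta,\gamma}$ (those $\psi$ with $\psi(ab)=\psi(ba)$ for all $a,b$).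
   Formalization: The points ξ_1,…,ξ_r are taken pairwise distinct and every Y_j nonempty (r = 0 is allowed when Y is empty); without this the formula fails, e.g. Y empty with r = 1 would give dimension 0 instead of 1. *)

theory Defs
  imports
    "HOL-Analysis.Analysis"
    "HOL-Algebra.Module"
    "HOL-Algebra.Subrings"
    "HOL-Library.Function_Algebras"
    "HOL-Library.FuncSet"
begin

section \<open>Unital C*-algebras on a carrier set\<close>

definition complex_ring :: "complex ring" where
  "complex_ring = \<lparr>carrier = UNIV, monoid.mult = (*), one = 1, zero = 0, add = (+)\<rparr>"

lemma cring_complex_ring: "cring complex_ring"
proof (rule cringI)
  show "abelian_group complex_ring"
  proof (rule abelian_groupI)
    fix z assume "z \<in> carrier complex_ring"
    show "\<exists>y\<in>carrier complex_ring. y \<oplus>\<^bsub>complex_ring\<^esub> z = \<zero>\<^bsub>complex_ring\<^esub>"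
      by (rule bexI[of _ "- z"]) (simp_all add: complex_ring_def)
  qed (simp_all add: complex_ring_def)
  show "comm_monoid complex_ring"
    by (rule comm_monoidI) (auto simp: complex_ring_def)
qed (simp add: complex_ring_def algebra_simps)

record 'a star_alg = "(complex, 'a) module" +
  adj :: "'a \<Rightarrow> 'a"

record 'a normed_star_alg = "'a star_alg" +
  nrm :: "'a \<Rightarrow> real"

text \<open>The locale \<^locale>\<open>ring\<close> is unital; the zero algebra is not excluded.\<close>

locale unital_cstar_algebra =
  ring A + Module.module complex_ring A for A :: "('a, 'm) normed_star_alg_scheme" (structure) +
  assumes smult_mult_left:
      "\<lbrakk>a \<in> carrier A; b \<in> carrier A\<rbrakk> \<Longrightarrow> (c \<odot> a) \<otimes> b = c \<odot> (a \<otimes> b)"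
    and smult_mult_right:
      "\<lbrakk>a \<in> carrier A; b \<in> carrier A\<rbrakk> \<Longrightarrow> a \<otimes> (c \<odot> b) = c \<odot> (a \<otimes> b)"
    and adj_closed: "a \<in> carrier A \<Longrightarrow> adj A a \<in> carrier A"
    and adj_adj: "a \<in> carrier A \<Longrightarrow> adj A (adj A a) = a"
    and adj_add:
      "\<lbrakk>a \<in> carrier A; b \<in> carrier A\<rbrakk> \<Longrightarrow> adj A (a \<oplus> b) = adj A a \<oplus> adj A b"
    and adj_smult: "a \<in> carrier A \<Longrightarrow> adj A (c \<odot> a) = cnj c \<odot> adj A a"
    and adj_mult:
      "\<lbrakk>a \<in> carrier A; b \<in> carrier A\<rbrakk> \<Longrightarrow> adj A (a \<otimes> b) = adj A b \<otimes> adj A a"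
    and nrm_nonneg: "a \<in> carrier A \<Longrightarrow> 0 \<le> nrm A a"
    and nrm_eq_0_iff: "a \<in> carrier A \<Longrightarrow> nrm A a = 0 \<longleftrightarrow> a = \<zero>"
    and nrm_triangle:
      "\<lbrakk>a \<in> carrier A; b \<in> carrier A\<rbrakk> \<Longrightarrow> nrm A (a \<oplus> b) \<le> nrm A a + nrm A b"
    and nrm_smult: "a \<in> carrier A \<Longrightarrow> nrm A (c \<odot> a) = cmod c * nrm A a"
    and nrm_mult:
      "\<lbrakk>a \<in> carrier A; b \<in> carrier A\<rbrakk> \<Longrightarrow> nrm A (a \<otimes> b) \<le> nrm A a * nrm A b"
    and cstar_identity: "a \<in> carrier A \<Longrightarrow> nrm A (adj A a \<otimes> a) = (nrm A a)\<^sup>2"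
    and complete:
      "\<lbrakk>\<And>n::nat. s n \<in> carrier A;
        \<And>e. 0 < e \<Longrightarrow> \<exists>N. \<forall>m\<ge>N. \<forall>n\<ge>N. nrm A (s m \<ominus> s n) < e\<rbrakk>
       \<Longrightarrow> \<exists>a\<in>carrier A. (\<lambda>n. nrm A (s n \<ominus> a)) \<longlonglongrightarrow> 0"

text \<open>Unital *-homomorphisms (\<^const>\<open>ring_hom\<close> includes preservation of the unit).
  Between C*-algebras they are automatically contractive.\<close>

definition star_hom ::
  "('a, 'm) star_alg_scheme \<Rightarrow> ('b, 'n) star_alg_scheme \<Rightarrow> ('a \<Rightarrow> 'b) set" where
  "star_hom A B = {h \<in> ring_hom A B. \<forall>a\<in>carrier A.
     h (adj A a) = adj B (h a) \<and> (\<forall>c. h (c \<odot>\<^bsub>A\<^esub> a) = c \<odot>\<^bsub>B\<^esub> h a)}"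

definition cstar_subalgebra :: "'a set \<Rightarrow> ('a, 'm) normed_star_alg_scheme \<Rightarrow> bool" where
  "cstar_subalgebra S A \<longleftrightarrow> subring S A
     \<and> (\<forall>a\<in>S. adj A a \<in> S \<and> (\<forall>c. c \<odot>\<^bsub>A\<^esub> a \<in> S))
     \<and> (\<forall>s a. (\<forall>n::nat. s n \<in> S) \<and> a \<in> carrier A \<and>
              (\<lambda>n. nrm A (s n \<ominus>\<^bsub>A\<^esub> a)) \<longlonglongrightarrow> 0 \<longrightarrow> a \<in> S)"

definition cstar_generated :: "('a, 'm) normed_star_alg_scheme \<Rightarrow> 'a set \<Rightarrow> bool" where
  "cstar_generated A G \<longleftrightarrow> G \<subseteq> carrier A \<and>
     (\<forall>S. cstar_subalgebra S A \<and> G \<subseteq> S \<longrightarrow> S = carrier A)"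


section \<open>Continuous functional calculus\<close>

definition cspectrum :: "('a, 'm) star_alg_scheme \<Rightarrow> 'a \<Rightarrow> complex set" where
  "cspectrum A a = {c. c \<odot>\<^bsub>A\<^esub> \<one>\<^bsub>A\<^esub> \<ominus>\<^bsub>A\<^esub> a \<notin> Units A}"

text \<open>The *-algebra \<open>C(K)\<close>; its elements are kept extensional so that equality in it is
  equality on \<open>K\<close>.\<close>

definition C_alg :: "complex set \<Rightarrow> (complex \<Rightarrow> complex) star_alg" where
  "C_alg K = \<lparr>carrier = {f \<in> extensional K. continuous_on K f},
     monoid.mult = (\<lambda>f g. \<lambda>z\<in>K. f z * g z),
     one = (\<lambda>z\<in>K. 1),
     zero = (\<lambda>z\<in>K. 0),
     add = (\<lambda>f g. \<lambda>z\<in>K. f z + g z),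
     smult = (\<lambda>c f. \<lambda>z\<in>K. c * f z),
     adj = (\<lambda>f. \<lambda>z\<in>K. cnj (f z))\<rparr>"

text \<open>\<open>has_cfc A u f a\<close> means \<open>f(u) = a\<close>: the functional calculus of a normal element \<open>u\<close> is the
  (unique) unital *-homomorphism from \<open>C(\<sigma>(u))\<close> to \<open>A\<close> that maps the coordinate function to
  \<open>u\<close>, and \<open>f\<close> is applied after restriction to the spectrum of \<open>u\<close>.\<close>

definition has_cfc ::
  "('a, 'm) star_alg_scheme \<Rightarrow> 'a \<Rightarrow> (complex \<Rightarrow> complex) \<Rightarrow> 'a \<Rightarrow> bool" where
  "has_cfc A u f a \<longleftrightarrow> (\<exists>\<Phi> \<in> star_hom (C_alg (cspectrum A u)) A.
     \<Phi> (\<lambda>z\<in>cspectrum A u. z) = u \<and> \<Phi> (restrict f (cspectrum A u)) = a)"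


section \<open>The universal C*-algebra of a rotation and a weight\<close>

definition rot_unit :: "real \<Rightarrow> complex" where
  "rot_unit \<theta> = exp (2 * of_real pi * \<i> * of_real \<theta>)"

definition Orb :: "real \<Rightarrow> complex \<Rightarrow> complex set" where
  "Orb \<theta> \<xi> = {rot_unit \<theta> powi n * \<xi> | n::int. True}"

definition A_relations ::
  "real \<Rightarrow> (complex \<Rightarrow> real) \<Rightarrow> ('a, 'm) star_alg_scheme \<Rightarrow> 'a \<Rightarrow> 'a \<Rightarrow> bool" where
  "A_relations \<theta> \<gamma> A x w \<longleftrightarrow> x \<in> carrier A \<and> w \<in> carrier A \<and>
     adj A w \<otimes>\<^bsub>A\<^esub> w = \<one>\<^bsub>A\<^esub> \<and> w \<otimes>\<^bsub>A\<^esub> adj A w = \<one>\<^bsub>A\<^esub> \<and>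
     has_cfc A w (\<lambda>z. of_real (\<gamma> z)) (adj A x \<otimes>\<^bsub>A\<^esub> x) \<and>
     has_cfc A (inverse (rot_unit \<theta>) \<odot>\<^bsub>A\<^esub> w) (\<lambda>z. of_real (\<gamma> z)) (x \<otimes>\<^bsub>A\<^esub> adj A x) \<and>
     x \<otimes>\<^bsub>A\<^esub> w = inverse (rot_unit \<theta>) \<odot>\<^bsub>A\<^esub> (w \<otimes>\<^bsub>A\<^esub> x)"

text \<open>The algebras \<open>B\<close> against which universality is tested have carriers in one fixed type, since
  HOL cannot quantify over types. This is no restriction: elements \<open>x'\<close>, \<open>w'\<close> of an arbitrary unital
  C*-algebra that satisfy the relations also satisfy them in the separable C*-algebra which they
  generate (the functional calculus does not change), and that algebra has at most continuum many
  elements, hence an isomorphic copy on a subset of the type below. The type is chosen so that it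
  also contains the bounded operators on square-summable two-sided sequences as they stand.
  Uniqueness of \<open>h\<close> follows from \<open>cstar_generated\<close>.\<close>

type_synonym test_elem = "(int \<Rightarrow> complex) \<Rightarrow> (int \<Rightarrow> complex)"

definition is_A ::
  "real \<Rightarrow> (complex \<Rightarrow> real) \<Rightarrow> 'a normed_star_alg \<Rightarrow> 'a \<Rightarrow> 'a \<Rightarrow> bool" where
  "is_A \<theta> \<gamma> A x w \<longleftrightarrow> unital_cstar_algebra A \<and> A_relations \<theta> \<gamma> A x w \<and> cstar_generated A {x, w} \<and>
     (\<forall>(B :: test_elem normed_star_alg) x' w'.
        unital_cstar_algebra B \<and> A_relations \<theta> \<gamma> B x' w' \<longrightarrow>
        (\<exists>h \<in> star_hom A B. h x = x' \<and> h w = w'))"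


section \<open>Bounded tracial functionals\<close>

text \<open>Functionals are extended by \<open>0\<close> outside the carrier, so that \<open>Tr A\<close> is a linear subspace of
  \<^typ>\<open>'a \<Rightarrow> complex\<close> with the pointwise operations.\<close>

definition Tr :: "('a, 'm) normed_star_alg_scheme \<Rightarrow> ('a \<Rightarrow> complex) set" where
  "Tr A = {\<psi>.
     (\<forall>a. a \<notin> carrier A \<longrightarrow> \<psi> a = 0) \<and>
     (\<forall>a\<in>carrier A. \<forall>b\<in>carrier A. \<psi> (a \<oplus>\<^bsub>A\<^esub> b) = \<psi> a + \<psi> b) \<and>
     (\<forall>c. \<forall>a\<in>carrier A. \<psi> (c \<odot>\<^bsub>A\<^esub> a) = c * \<psi> a) \<and>
     (\<exists>K. \<forall>a\<in>carrier A. cmod (\<psi> a) \<le> K * nrm A a) \<and>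
     (\<forall>a\<in>carrier A. \<forall>b\<in>carrier A. \<psi> (a \<otimes>\<^bsub>A\<^esub> b) = \<psi> (b \<otimes>\<^bsub>A\<^esub> a))}"

text \<open>\<open>cfun.dim\<close> is the dimension over the complex numbers; it is \<open>0\<close> for infinite-dimensional
  spaces, so a positive value entails finite dimension.\<close>

global_interpretation cfun: vector_space "\<lambda>(c::complex) (f::'a \<Rightarrow> complex) a. c * f a"
  by unfold_locales (auto simp: fun_eq_iff algebra_simps)

lemma subspace_Tr:
  assumes "unital_cstar_algebra A"
  shows "cfun.subspace (Tr A)"
proof -
  interpret unital_cstar_algebra A by fact
  show ?thesis
  proof (rule cfun.subspaceI)
    show "0 \<in> Tr A"
      by (auto simp: Tr_def intro!: exI[of _ 0])
  next
    fix f g assume f: "f \<in> Tr A" and g: "g \<in> Tr A"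
    from f obtain K where K: "\<forall>a\<in>carrier A. cmod (f a) \<le> K * nrm A a" by (auto simp: Tr_def)
    from g obtain L where L: "\<forall>a\<in>carrier A. cmod (g a) \<le> L * nrm A a" by (auto simp: Tr_def)
    have "\<forall>a\<in>carrier A. cmod (f a + g a) \<le> (K + L) * nrm A a"
      using K L by (auto simp: distrib_right intro: order_trans[OF norm_triangle_ineq add_mono])
    then have "\<exists>M. \<forall>a\<in>carrier A. cmod (f a + g a) \<le> M * nrm A a" by blast
    then show "f + g \<in> Tr A"
      using f g unfolding Tr_def by (auto simp: algebra_simps)
  next
    fix c f assume f: "f \<in> Tr A"
    from f obtain K where K: "\<forall>a\<in>carrier A. cmod (f a) \<le> K * nrm A a" by (auto simp: Tr_def)
    have "\<forall>a\<in>carrier A. cmod (c * f a) \<le> (cmod c * K) * nrm A a"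
      using K by (auto simp: norm_mult mult.assoc intro: mult_left_mono)
    then have "\<exists>M. \<forall>a\<in>carrier A. cmod (c * f a) \<le> M * nrm A a" by blast
    then show "(\<lambda>a. c * f a) \<in> Tr A"
      using f unfolding Tr_def by (auto simp: algebra_simps)
  qed
qed

end

theory Submission
  imports Defs
begin

text \<open>
  Since \<open>\<theta>\<close> is irrational, commuting with \<open>w\<close> shows that a bounded trace vanishes on all monomials
  \<open>f(w) x\<^sup>n\<close> and \<open>f(w) x\<^sup>*\<^sup>n\<close> with \<open>n > 0\<close>. It is therefore determined by the functional
  \<open>L(f) = \<psi>(f(w))\<close> on \<open>C(\<T>)\<close>. Conversely, \<open>L\<close> extends to a trace, by composition with the conditional
  expectation onto \<open>C\<^sup>*(w)\<close>, precisely when the coboundary \<open>f \<mapsto> L(f \<circ> \<phi>\<^sup>-\<^sup>1) - L(f)\<close> annihilates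
  \<open>\<gamma> C(\<T>)\<close>, that is, when it is a combination \<open>\<Sum> c\<^sub>y \<delta>\<^sub>y\<close> of point masses at the zeros of \<open>\<gamma>\<close>.
  The functionals with zero coboundary are the multiples of the Haar measure, and
  \<open>\<Sum> c\<^sub>y \<delta>\<^sub>y\<close> is a coboundary iff the coefficients add up to zero on every orbit.

  The expectation is read off from the diagonal matrix coefficients of the representations by weighted
  shifts, one for each point of the circle.
\<close>

section \<open>Functions on the circle\<close>

text \<open>Universality can be invoked only for algebras carried by one fixed type, so the
  operators on the sequence space have to be transported injectively into that type. Homomorphisms
  come without a norm bound; contractivity is won from invertibility by Neumann series, and only
  then do diagonal matrix coefficients give bounded maps on the whole algebra. Their continuity in
  the point of the circle is not built into the choice of the representations and is derived from
  the density of the monomials.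

  Measures on the circle appear throughout as bounded functionals on continuous functions. The
  coboundary of an admissible functional is a finite combination of point masses because the uniform
  closure of the multiples of \<gamma> consists of all functions that vanish on Y, and Y is finite.

  The count: an orbit that meets Y in k > 0 points carries k - 1 independent differences of point
  masses, each taken against one base point of that orbit, and the Haar measure contributes the
  remaining 1.\<close>

abbreviation circle :: "complex set" where
  "circle \<equiv> sphere 0 1"

abbreviation ccont :: "(complex \<Rightarrow> 'b::topological_space) \<Rightarrow> bool" where
  "ccont f \<equiv> continuous_on circle f"

text \<open>The Stone-Weierstrass theorem as an induction rule: a real polynomial function on the
  plane is a polynomial in z and its conjugate, and polynomial functions are uniformly dense on the
  compact circle.\<close>

lemma circle_induct [consumes 1, case_names const id cnj add mult limit]:
  fixes f :: "complex \<Rightarrow> complex"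
  assumes "ccont f"
    and const: "\<And>c. P (\<lambda>z. c)"
    and id: "P (\<lambda>z. z)"
    and cnj: "P cnj"
    and add: "\<And>f g. ccont f \<Longrightarrow> ccont g \<Longrightarrow> P f \<Longrightarrow> P g \<Longrightarrow> P (\<lambda>z. f z + g z)"
    and mult: "\<And>f g. ccont f \<Longrightarrow> ccont g \<Longrightarrow> P f \<Longrightarrow> P g \<Longrightarrow> P (\<lambda>z. f z * g z)"
    and limit: "\<And>f. ccont f \<Longrightarrow>
      (\<And>e. 0 < e \<Longrightarrow> \<exists>g. ccont g \<and> P g \<and> (\<forall>z\<in>circle. cmod (f z - g z) < e)) \<Longrightarrow> P f"
  shows "P f"
proof -
  have real: "P (\<lambda>z. of_real (p z)) \<and> ccont (\<lambda>z. complex_of_real (p z))"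
    if "real_polynomial_function p" for p
    using that
  proof induction
    case (linear p)
    then interpret bounded_linear p .
    \<comment> \<open>A real-linear p satisfies p(z) = Re z p(1) + Im z p(\<i>); substituting Re z =
      (z + cnj z)/2 and Im z = -\<i> (z - cnj z)/2 gives these coefficients.\<close>
    define a b where "a = complex_of_real (p 1 / 2)" and "b = complex_of_real (p \<i> / 2)"
    have "complex_of_real (p z) = (a + - \<i> * b) * z + (a + \<i> * b) * cnj z" for z
    proof -
      have "z = Re z *\<^sub>R 1 + Im z *\<^sub>R \<i>" by (simp add: complex_eq_iff)
      then have "p z = Re z * p 1 + Im z * p \<i>" by (metis add scaleR real_scaleR_def)
      then show ?thesis by (simp add: a_def b_def complex_eq_iff algebra_simps)
    qed
    moreover have "ccont (\<lambda>z. (a + - \<i> * b) * z + (a + \<i> * b) * cnj z)"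
      by (intro continuous_intros)
    moreover have "P (\<lambda>z. (a + - \<i> * b) * z + (a + \<i> * b) * cnj z)"
      by (intro assms(2-6) continuous_intros)
    ultimately show ?case by simp
  next
    case (const c) then show ?case by (auto intro: assms(2))
  next
    case (add f g)
    then show ?case using assms(5)[of "\<lambda>z. of_real (f z)" "\<lambda>z. of_real (g z)"]
      by (auto intro: continuous_intros)
  next
    case (mult f g)
    then show ?case using assms(6)[of "\<lambda>z. of_real (f z)" "\<lambda>z. of_real (g z)"]
      by (auto intro: continuous_intros)
  qed
  show ?thesis
  proof (rule limit[OF assms(1)])
    fix e :: real assume "0 < e"
    then obtain g where g: "polynomial_function g" "\<forall>z\<in>circle. norm (f z - g z) < e"
      using Stone_Weierstrass_polynomial_function[of circle f e] assms(1) by auto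
    have re: "real_polynomial_function (Re \<circ> g)" and im: "real_polynomial_function (Im \<circ> g)"
      using g(1) bounded_linear_Re bounded_linear_Im unfolding polynomial_function_def by blast+
    have "P (\<lambda>z. of_real ((Re \<circ> g) z) + \<i> * of_real ((Im \<circ> g) z))"
    proof (rule add)
      show "P (\<lambda>z. \<i> * of_real ((Im \<circ> g) z))"
        using real[OF im] by (intro mult[of "\<lambda>z. \<i>"] const continuous_on_const) auto
      show "ccont (\<lambda>z. \<i> * complex_of_real ((Im \<circ> g) z))"
        using real[OF im] by (intro continuous_on_mult continuous_on_const) auto
    qed (use real[OF re] in auto)
    moreover have "(\<lambda>z. of_real ((Re \<circ> g) z) + \<i> * of_real ((Im \<circ> g) z)) = g"
      by (simp add: complex_eq_iff fun_eq_iff)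
    moreover have "ccont g"
      using g(1) continuous_on_polymonial_function by blast
    ultimately show "\<exists>g. ccont g \<and> P g \<and> (\<forall>z\<in>circle. cmod (f z - g z) < e)"
      using g(2) by auto
  qed
qed

lemma circle_bounded:
  fixes f :: "complex \<Rightarrow> complex"
  assumes "ccont f"
  obtains M where "0 < M" "\<forall>z\<in>circle. cmod (f z) \<le> M"
proof -
  have "bounded (f ` circle)"
    using assms by (simp add: compact_continuous_image compact_imp_bounded)
  then show ?thesis
    using that unfolding bounded_pos by auto
qed

section \<open>Elementary theory of unital C*-algebras\<close>

context unital_cstar_algebra
begin

lemma ring_A: "ring A"
  by unfold_locales

lemmas ring_simps = ring.ring_simprules[OF ring_A]

lemmas pow_0 [simp] = monoid.nat_pow_0[OF ring.is_monoid[OF ring_A]]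
lemmas pow_Suc = monoid.nat_pow_Suc[OF ring.is_monoid[OF ring_A]]
lemmas pow_closed [simp] = monoid.nat_pow_closed[OF ring.is_monoid[OF ring_A]]

lemma add_diff_cancel: "a = b \<oplus> c \<Longrightarrow> b \<in> carrier A \<Longrightarrow> c \<in> carrier A \<Longrightarrow> a \<ominus> c = b"
  by (simp add: ring_simps)

lemma sc_closed [simp]: "a \<in> carrier A \<Longrightarrow> c \<odot> a \<in> carrier A"
  using smult_closed[of c a] by (simp add: complex_ring_def)

lemma sc_one [simp]: "a \<in> carrier A \<Longrightarrow> 1 \<odot> a = a"
  using smult_one[of a] by (simp add: complex_ring_def)

lemma sc_assoc: "a \<in> carrier A \<Longrightarrow> (c * d) \<odot> a = c \<odot> (d \<odot> a)"
  using smult_assoc1[of c d a] by (simp add: complex_ring_def)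

lemma sc_add_left: "a \<in> carrier A \<Longrightarrow> (c + d) \<odot> a = c \<odot> a \<oplus> d \<odot> a"
  using smult_l_distr[of c d a] by (simp add: complex_ring_def)

lemma sc_add_right: "a \<in> carrier A \<Longrightarrow> b \<in> carrier A \<Longrightarrow> c \<odot> (a \<oplus> b) = c \<odot> a \<oplus> c \<odot> b"
  using smult_r_distr[of c a b] by (simp add: complex_ring_def)

lemma sc_zero_left [simp]: "a \<in> carrier A \<Longrightarrow> 0 \<odot> a = \<zero>"
  using smult_l_null[of a] by (simp add: complex_ring_def)

lemma sc_minus_one: "a \<in> carrier A \<Longrightarrow> (-1) \<odot> a = \<ominus> a"
  using sc_add_left[of a "-1" 1] abelian_group.minus_equality[OF ring.is_abelian_group[OF ring_A], of "(-1) \<odot> a" a] by simp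

lemma sc_minus: "a \<in> carrier A \<Longrightarrow> c \<odot> (\<ominus> a) = \<ominus> (c \<odot> a)"
  by (metis sc_assoc sc_minus_one mult.commute sc_closed)

lemma sc_diff: "a \<in> carrier A \<Longrightarrow> b \<in> carrier A \<Longrightarrow> c \<odot> (a \<ominus> b) = c \<odot> a \<ominus> c \<odot> b"
  by (simp add: a_minus_def sc_add_right sc_minus)

lemma nrm_zero [simp]: "nrm A \<zero> = 0"
  by (simp add: nrm_eq_0_iff)

lemma nrm_neg [simp]: "a \<in> carrier A \<Longrightarrow> nrm A (\<ominus> a) = nrm A a"
  using nrm_smult[of a "-1"] by (simp add: sc_minus_one)

lemma nrm_diff_commute: "a \<in> carrier A \<Longrightarrow> b \<in> carrier A \<Longrightarrow> nrm A (a \<ominus> b) = nrm A (b \<ominus> a)"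
proof -
  assume "a \<in> carrier A" "b \<in> carrier A"
  then have "b \<ominus> a = \<ominus> (a \<ominus> b)" by (simp add: ring_simps)
  then show ?thesis using \<open>a \<in> carrier A\<close> \<open>b \<in> carrier A\<close> by simp
qed

lemma diff_split:
  "a \<in> carrier A \<Longrightarrow> b \<in> carrier A \<Longrightarrow> c \<in> carrier A \<Longrightarrow> a \<ominus> c = (a \<ominus> b) \<oplus> (b \<ominus> c)"
  by (simp add: ring_simps)

lemma nrm_diff_triangle:
  "a \<in> carrier A \<Longrightarrow> b \<in> carrier A \<Longrightarrow> c \<in> carrier A \<Longrightarrow>
    nrm A (a \<ominus> c) \<le> nrm A (a \<ominus> b) + nrm A (b \<ominus> c)"
  using nrm_triangle[of "a \<ominus> b" "b \<ominus> c"] diff_split[of a b c] by simp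

lemma add_diff_add:
  "a \<in> carrier A \<Longrightarrow> b \<in> carrier A \<Longrightarrow> c \<in> carrier A \<Longrightarrow> d \<in> carrier A \<Longrightarrow>
    (a \<oplus> b) \<ominus> (c \<oplus> d) = (a \<ominus> c) \<oplus> (b \<ominus> d)"
  by (simp add: ring_simps)

lemma diff_distrib_left:
  "a \<in> carrier A \<Longrightarrow> b \<in> carrier A \<Longrightarrow> c \<in> carrier A \<Longrightarrow> a \<otimes> (b \<ominus> c) = a \<otimes> b \<ominus> a \<otimes> c"
  by (simp add: ring_simps)

lemma diff_distrib_right:
  "a \<in> carrier A \<Longrightarrow> b \<in> carrier A \<Longrightarrow> c \<in> carrier A \<Longrightarrow> (b \<ominus> c) \<otimes> a = b \<otimes> a \<ominus> c \<otimes> a"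
  by (simp add: ring_simps)

lemma adj_one [simp]: "adj A \<one> = \<one>"
  using adj_mult[of "adj A \<one>" \<one>] by (simp add: adj_adj adj_closed)

lemma adj_neg: "a \<in> carrier A \<Longrightarrow> adj A (\<ominus> a) = \<ominus> (adj A a)"
  using adj_smult[of a "-1"] by (simp add: sc_minus_one adj_closed)

lemma adj_diff: "a \<in> carrier A \<Longrightarrow> b \<in> carrier A \<Longrightarrow> adj A (a \<ominus> b) = adj A a \<ominus> adj A b"
  by (simp add: a_minus_def adj_add adj_neg)

text \<open>Only an inequality, since the unit of the zero algebra has norm 0; the C*-identity makes
  the norm of the unit equal to its own square.\<close>

lemma nrm_one_le: "nrm A \<one> \<le> 1"
proof -
  have "nrm A \<one> = (nrm A \<one>)\<^sup>2" using cstar_identity[of \<one>] by simp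
  then show ?thesis by (auto simp: power2_eq_square)
qed

lemma nrm_adj [simp]:
  assumes "a \<in> carrier A" shows "nrm A (adj A a) = nrm A a"
proof -
  have *: "nrm A b \<le> nrm A (adj A b)" if "b \<in> carrier A" for b
  proof (cases "nrm A b = 0")
    case True then show ?thesis using nrm_nonneg[OF adj_closed[OF that]] by simp
  next
    case False
    have "nrm A b * nrm A b \<le> nrm A (adj A b) * nrm A b"
      using cstar_identity[OF that] nrm_mult[OF adj_closed[OF that] that]
      by (simp add: power2_eq_square)
    moreover have "0 < nrm A b" using False nrm_nonneg[OF that] by simp
    ultimately show ?thesis by simp
  qed
  show ?thesis using *[OF assms] *[OF adj_closed[OF assms]] assms by (simp add: adj_adj)
qed

lemma nrm_unitary_le:
  assumes "u \<in> carrier A" "adj A u \<otimes> u = \<one>" shows "nrm A u \<le> 1"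
proof -
  have "(nrm A u)\<^sup>2 \<le> 1" using cstar_identity[OF assms(1)] assms(2) nrm_one_le by simp
  then show ?thesis by (simp add: power2_le_iff_abs_le nrm_nonneg[OF assms(1)] abs_le_square_iff[symmetric] power_le_one_iff)
qed

lemma eq_if_close:
  assumes "a \<in> carrier A" "b \<in> carrier A" "\<And>e. 0 < e \<Longrightarrow> nrm A (a \<ominus> b) \<le> e"
  shows "a = b"
proof -
  have "nrm A (a \<ominus> b) \<le> 0" using assms(3) by (rule field_le_epsilon) simp
  then have "a \<ominus> b = \<zero>" using nrm_eq_0_iff[of "a \<ominus> b"] nrm_nonneg[of "a \<ominus> b"] assms by simp
  then show ?thesis using assms by (simp add: r_right_minus_eq)
qed

section \<open>Neumann series, invertibility and spectra\<close>

lemma neumann: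
  assumes a: "a \<in> carrier A" and "nrm A a < 1"
  shows "\<one> \<ominus> a \<in> Units A"
proof -
  \<comment> \<open>The partial sums of the geometric series, by recursion, so that neither powers
    nor finite sums in the algebra are required.\<close>
  define s where "s = rec_nat \<zero> (\<lambda>_ t. \<one> \<oplus> a \<otimes> t)"
  define q where "q = nrm A a"
  have s_Suc: "s (Suc n) = \<one> \<oplus> a \<otimes> s n" and s_0: "s 0 = \<zero>" for n by (simp_all add: s_def)
  have q: "0 \<le> q" "q < 1" using assms nrm_nonneg by (auto simp: q_def)
  have s [simp]: "s n \<in> carrier A" for n by (induction n) (auto simp: s_0 s_Suc a)
  have bound: "nrm A (s n) \<le> 1 / (1 - q)" for n
  proof (induction n)
    case (Suc n)
    have "nrm A (s (Suc n)) \<le> nrm A \<one> + nrm A (a \<otimes> s n)"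
      by (simp add: s_Suc a nrm_triangle)
    also have "nrm A (a \<otimes> s n) \<le> q * nrm A (s n)" by (simp add: q_def a nrm_mult)
    also have "\<dots> \<le> q * (1 / (1 - q))" using Suc q by (intro mult_left_mono) auto
    also have "nrm A \<one> + q * (1 / (1 - q)) \<le> 1 + q * (1 / (1 - q))" using nrm_one_le by simp
    also have "\<dots> = 1 / (1 - q)" using q by (simp add: field_simps)
    finally show ?case by simp
  qed (use q in \<open>simp add: s_0\<close>)
  have comm: "s n \<otimes> a = a \<otimes> s n" for n
  proof (induction n)
    case (Suc n)
    then show ?case by (simp add: s_Suc a ring_simps)
  qed (simp add: s_0 a)
  have diff: "nrm A (s (n + k) \<ominus> s n) \<le> q ^ n * (1 / (1 - q))" for n k
  proof (induction n)
    case 0 then show ?case using bound[of k] by (simp add: s_0 a_minus_def)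
  next
    case (Suc n)
    have "s (Suc n + k) \<ominus> s (Suc n) = a \<otimes> (s (n + k) \<ominus> s n)"
      by (simp add: s_Suc a add_diff_add diff_distrib_left) (simp add: ring_simps a)?
    then have "nrm A (s (Suc n + k) \<ominus> s (Suc n)) \<le> q * nrm A (s (n + k) \<ominus> s n)"
      by (simp add: q_def a nrm_mult)
    also have "\<dots> \<le> q * (q ^ n * (1 / (1 - q)))" using Suc q by (intro mult_left_mono) auto
    finally show ?case by simp
  qed
  have lim0: "(\<lambda>n. q ^ n * (1 / (1 - q))) \<longlonglongrightarrow> 0"
    using q by (intro tendsto_mult_left_zero LIMSEQ_realpow_zero) auto
  have "\<exists>t\<in>carrier A. (\<lambda>n. nrm A (s n \<ominus> t)) \<longlonglongrightarrow> 0"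
  proof (rule complete)
    fix e :: real assume "0 < e"
    then obtain N where N: "\<And>n. n \<ge> N \<Longrightarrow> q ^ n * (1 / (1 - q)) < e"
      using order_tendstoD(2)[OF lim0] by (auto simp: eventually_sequentially)
    have *: "nrm A (s m \<ominus> s n) < e" if "n \<ge> N" "m \<ge> n" for m n
      using diff[of n "m - n"] N[of n] that by simp
    show "\<exists>N. \<forall>m\<ge>N. \<forall>n\<ge>N. nrm A (s m \<ominus> s n) < e"
    proof (intro exI[of _ N] allI impI)
      fix m n assume "m \<ge> N" "n \<ge> N"
      then show "nrm A (s m \<ominus> s n) < e"
        using *[of n m] *[of m n] nrm_diff_commute[of "s m" "s n"] by (cases "m \<ge> n") auto
    qed
  qed simp
  then obtain t where t: "t \<in> carrier A" and lim: "(\<lambda>n. nrm A (s n \<ominus> t)) \<longlonglongrightarrow> 0" by blast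
  \<comment> \<open>One limit argument for both one-sided equations t = 1 + a t and t = 1 + t a: the
    shifted partial sums converge to t and also to 1 + y.\<close>
  have fixp: "t = \<one> \<oplus> y" if y: "y \<in> carrier A"
    and le: "\<And>n. nrm A (s (Suc n) \<ominus> (\<one> \<oplus> y)) \<le> q * nrm A (s n \<ominus> t)" for y
  proof (rule eq_if_close)
    fix e :: real assume e: "0 < e"
    have "(\<lambda>n. nrm A (s (Suc n) \<ominus> t) + q * nrm A (s n \<ominus> t)) \<longlonglongrightarrow> 0 + q * 0"
      by (intro tendsto_intros lim) (use LIMSEQ_Suc[OF lim] in simp)
    then obtain n where n: "nrm A (s (Suc n) \<ominus> t) + q * nrm A (s n \<ominus> t) < e"
      using order_tendstoD(2)[of _ 0 sequentially e] e by (auto simp: eventually_sequentially)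
    have "nrm A (t \<ominus> (\<one> \<oplus> y)) \<le> nrm A (t \<ominus> s (Suc n)) + nrm A (s (Suc n) \<ominus> (\<one> \<oplus> y))"
      using t y by (intro nrm_diff_triangle) auto
    then show "nrm A (t \<ominus> (\<one> \<oplus> y)) \<le> e"
      using n le[of n] nrm_diff_commute[of t "s (Suc n)"] t by simp
  qed (use t y in auto)
  have e1: "t = \<one> \<oplus> a \<otimes> t"
  proof (rule fixp)
    fix n
    have "s (Suc n) \<ominus> (\<one> \<oplus> a \<otimes> t) = a \<otimes> (s n \<ominus> t)"
      by (simp add: s_Suc a t add_diff_add diff_distrib_left) (simp add: ring_simps a t)?
    then show "nrm A (s (Suc n) \<ominus> (\<one> \<oplus> a \<otimes> t)) \<le> q * nrm A (s n \<ominus> t)"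
      by (simp add: q_def a t nrm_mult)
  qed (use a t in auto)
  have e2: "t = \<one> \<oplus> t \<otimes> a"
  proof (rule fixp)
    fix n
    have "s (Suc n) \<ominus> (\<one> \<oplus> t \<otimes> a) = (s n \<ominus> t) \<otimes> a"
      by (simp add: s_Suc a t add_diff_add diff_distrib_right comm) (simp add: ring_simps a t)?
    then show "nrm A (s (Suc n) \<ominus> (\<one> \<oplus> t \<otimes> a)) \<le> q * nrm A (s n \<ominus> t)"
      using nrm_mult[of "s n \<ominus> t" a] by (simp add: q_def a t mult.commute)
  qed (use a t in auto)
  have "(\<one> \<ominus> a) \<otimes> t = \<one>" "t \<otimes> (\<one> \<ominus> a) = \<one>"
    using a t add_diff_cancel[OF e1] add_diff_cancel[OF e2]
    by (simp_all add: diff_distrib_left diff_distrib_right)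
  then show ?thesis using a t by (auto simp: Units_def)
qed

lemma sc_Units:
  assumes "u \<in> Units A" "c \<noteq> 0" shows "c \<odot> u \<in> Units A"
proof -
  obtain v where v: "v \<in> carrier A" "u \<otimes> v = \<one>" "v \<otimes> u = \<one>" and u: "u \<in> carrier A"
    using assms(1) by (auto simp: Units_def)
  have "(c \<odot> u) \<otimes> (inverse c \<odot> v) = \<one>" "(inverse c \<odot> v) \<otimes> (c \<odot> u) = \<one>"
    using u v assms(2) by (simp_all add: smult_mult_left smult_mult_right sc_assoc[symmetric])
  then show ?thesis using u v by (auto simp: Units_def)
qed

lemma sc_diff_Units:
  assumes a: "a \<in> carrier A" and "nrm A a < cmod c"
  shows "c \<odot> \<one> \<ominus> a \<in> Units A"
proof -
  have c: "c \<noteq> 0" using assms nrm_nonneg[OF a] by auto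
  have "nrm A (inverse c \<odot> a) < 1"
    using assms c by (simp add: nrm_smult norm_inverse inverse_eq_divide[symmetric] pos_divide_less_eq
        divide_inverse_commute[symmetric])
  then have "c \<odot> (\<one> \<ominus> inverse c \<odot> a) \<in> Units A"
    using a c by (intro sc_Units neumann) auto
  then show ?thesis using a c by (simp add: sc_diff sc_assoc[symmetric])
qed

lemma cspectrum_unitary:
  assumes u: "u \<in> carrier A" and uu: "adj A u \<otimes> u = \<one>" "u \<otimes> adj A u = \<one>"
  shows "cspectrum A u \<subseteq> circle"
proof
  fix c assume "c \<in> cspectrum A u"
  then have c: "c \<odot> \<one> \<ominus> u \<notin> Units A" by (simp add: cspectrum_def)
  have u': "adj A u \<in> carrier A" using u by (rule adj_closed)
  have n: "nrm A u \<le> 1" "nrm A (adj A u) \<le> 1" using nrm_unitary_le[OF u uu(1)] u by auto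
  have "\<not> 1 < cmod c" using sc_diff_Units[OF u, of c] c n by auto
  moreover have "\<not> cmod c < 1"
  proof
    assume "cmod c < 1"
    then have "nrm A (c \<odot> adj A u) < 1"
      using n u' nrm_nonneg[OF u'] by (simp add: nrm_smult) (smt (verit) mult_left_le norm_ge_zero)
    then have "\<one> \<ominus> c \<odot> adj A u \<in> Units A" using u' by (intro neumann) auto
    moreover have "u \<in> Units A" using u u' uu by (auto simp: Units_def)
    ultimately have "(-1) \<odot> (u \<otimes> (\<one> \<ominus> c \<odot> adj A u)) \<in> Units A"
      by (intro sc_Units) auto
    moreover have "(-1) \<odot> (u \<otimes> (\<one> \<ominus> c \<odot> adj A u)) = c \<odot> \<one> \<ominus> u"
      using u u' uu by (simp add: diff_distrib_left smult_mult_right sc_minus_one)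
        (simp add: ring_simps)
    ultimately show False using c by simp
  qed
  ultimately show "c \<in> circle" by simp
qed

text \<open>If v inverts c - a, then d - a = (c - a)(1 - (c - d) v) is invertible as soon as |c - d|
  times the norm of v is below 1. The 1 added in the denominator of the radius covers v of norm
  0.\<close>

lemma closed_cspectrum:
  assumes a: "a \<in> carrier A"
  shows "closed (cspectrum A a)"
proof -
  have "\<exists>e>0. \<forall>d. dist d c < e \<longrightarrow> d \<in> - cspectrum A a" if "c \<in> - cspectrum A a" for c
  proof -
    from that have "c \<odot> \<one> \<ominus> a \<in> Units A" by (simp add: cspectrum_def)
    then obtain v where v: "v \<in> carrier A" "(c \<odot> \<one> \<ominus> a) \<otimes> v = \<one>"
      by (auto simp: Units_def)
    show ?thesis
    proof (intro exI[of _ "1 / (nrm A v + 1)"] conjI allI impI)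
      show "0 < 1 / (nrm A v + 1)" using nrm_nonneg[OF v(1)] by simp
      fix d assume d: "dist d c < 1 / (nrm A v + 1)"
      have "cmod (c - d) * (nrm A v + 1) < 1"
        using d nrm_nonneg[OF v(1)] by (simp add: dist_norm norm_minus_commute field_simps)
      then have "nrm A ((c - d) \<odot> v) < 1"
        using nrm_nonneg[OF v(1)] v by (simp add: nrm_smult distrib_left) (smt (verit) norm_ge_zero)
      then have "(c \<odot> \<one> \<ominus> a) \<otimes> (\<one> \<ominus> (c - d) \<odot> v) \<in> Units A"
        using v \<open>c \<odot> \<one> \<ominus> a \<in> Units A\<close>
        by (intro monoid.Units_m_closed[OF ring.is_monoid[OF ring_A]] neumann) auto
      moreover have "(c \<odot> \<one> \<ominus> a) \<otimes> (\<one> \<ominus> (c - d) \<odot> v) = (c \<odot> \<one> \<ominus> a) \<ominus> (c - d) \<odot> \<one>"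
        using v a by (subst diff_distrib_left) (auto simp: smult_mult_right)
      moreover have "\<dots> = d \<odot> \<one> \<ominus> a"
      proof -
        have "c \<odot> \<one> = d \<odot> \<one> \<oplus> (c - d) \<odot> \<one>" using sc_add_left[of \<one> d "c - d"] by simp
        then show ?thesis using a by (simp add: ring_simps)
      qed
      ultimately show "d \<in> - cspectrum A a" by (simp add: cspectrum_def)
    qed
  qed
  then have "open (- cspectrum A a)" by (simp add: open_dist)
  then show ?thesis by (simp add: closed_def)
qed

end

section \<open>The Hilbert space of two-sided square-summable sequences\<close>

typedef ell2 = "{f :: int \<Rightarrow> complex. (\<lambda>n. (cmod (f n))\<^sup>2) summable_on UNIV}"
  morphisms coord Abs_ell2
  by (rule exI[of _ "\<lambda>_. 0"]) simp

setup_lifting type_definition_ell2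

lemma coord_summable: "(\<lambda>n. (cmod (coord v n))\<^sup>2) summable_on UNIV"
  using coord[of v] by simp

lemma inner_summable:
  assumes "(\<lambda>n. (cmod (f n))\<^sup>2) summable_on UNIV" "(\<lambda>n. (cmod (g n))\<^sup>2) summable_on UNIV"
  shows "(\<lambda>n::int. f n \<bullet> g n) summable_on UNIV"
proof -
  have "(\<lambda>n. (cmod (f n))\<^sup>2 + (cmod (g n))\<^sup>2) summable_on UNIV"
    using assms by (rule summable_on_add)
  moreover have "norm (f n \<bullet> g n) \<le> (cmod (f n))\<^sup>2 + (cmod (g n))\<^sup>2" for n
  proof -
    have "norm (f n \<bullet> g n) \<le> cmod (f n) * cmod (g n)" by (simp add: Cauchy_Schwarz_ineq2)
    also have "\<dots> \<le> (cmod (f n))\<^sup>2 + (cmod (g n))\<^sup>2"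
      using sum_squares_bound[of "cmod (f n)" "cmod (g n)"] mult_nonneg_nonneg[OF norm_ge_zero[of "f n"] norm_ge_zero[of "g n"]]
      by linarith
    finally show ?thesis .
  qed
  ultimately have "(\<lambda>n. norm (f n \<bullet> g n)) summable_on UNIV"
    by (rule Infinite_Sum.abs_summable_on_comparison_test')
  then show ?thesis by (rule abs_summable_summable)
qed

lemma square_summable_add:
  assumes "(\<lambda>n. (cmod (f n))\<^sup>2) summable_on UNIV" "(\<lambda>n. (cmod (g n))\<^sup>2) summable_on UNIV"
  shows "(\<lambda>n::int. (cmod (f n + g n))\<^sup>2) summable_on UNIV"
proof -
  have "(\<lambda>n. (cmod (f n))\<^sup>2 + 2 * (f n \<bullet> g n) + (cmod (g n))\<^sup>2) summable_on UNIV"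
    by (intro summable_on_add summable_on_cmult_right inner_summable assms)
  moreover have "(cmod (f n + g n))\<^sup>2 = (cmod (f n))\<^sup>2 + 2 * (f n \<bullet> g n) + (cmod (g n))\<^sup>2" for n
    by (simp add: power2_norm_eq_inner inner_add inner_commute)
  ultimately show ?thesis by simp
qed

instantiation ell2 :: real_inner
begin

lift_definition zero_ell2 :: ell2 is "\<lambda>_. 0" by simp

lift_definition plus_ell2 :: "ell2 \<Rightarrow> ell2 \<Rightarrow> ell2" is "\<lambda>f g n. f n + g n"
  by (rule square_summable_add)

lift_definition uminus_ell2 :: "ell2 \<Rightarrow> ell2" is "\<lambda>f n. - f n" by simp

lift_definition minus_ell2 :: "ell2 \<Rightarrow> ell2 \<Rightarrow> ell2" is "\<lambda>f g n. f n - g n"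
  subgoal for f g using square_summable_add[of f "\<lambda>n. - g n"] by simp
  done

lift_definition scaleR_ell2 :: "real \<Rightarrow> ell2 \<Rightarrow> ell2" is "\<lambda>r f n. r *\<^sub>R f n"
  by (simp add: power_mult_distrib summable_on_cmult_right)

definition inner_ell2 :: "ell2 \<Rightarrow> ell2 \<Rightarrow> real" where
  "inner_ell2 v u = (\<Sum>\<^sub>\<infinity>n. coord v n \<bullet> coord u n)"

definition norm_ell2 :: "ell2 \<Rightarrow> real" where
  "norm_ell2 v = sqrt (v \<bullet> v)"

definition sgn_ell2 :: "ell2 \<Rightarrow> ell2" where
  "sgn_ell2 v = scaleR (inverse (norm v)) v"

definition dist_ell2 :: "ell2 \<Rightarrow> ell2 \<Rightarrow> real" where
  "dist_ell2 v u = norm (v - u)"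

definition uniformity_ell2 :: "(ell2 \<times> ell2) filter" where
  "uniformity_ell2 = (INF e\<in>{0<..}. principal {(x, y). dist x y < e})"

definition open_ell2 :: "ell2 set \<Rightarrow> bool" where
  "open_ell2 U \<longleftrightarrow> (\<forall>x\<in>U. eventually (\<lambda>(x', y). x' = x \<longrightarrow> y \<in> U) uniformity)"

instance
proof
  fix a b c :: ell2 and r s :: real
  show "a + b + c = a + (b + c)" by transfer (simp add: add.assoc)
  show "a + b = b + a" by transfer (simp add: add.commute)
  show "0 + a = a" by transfer simp
  show "- a + a = 0" by transfer simp
  show "a - b = a + - b" by transfer simp
  show "r *\<^sub>R (a + b) = r *\<^sub>R a + r *\<^sub>R b" by transfer (simp add: scaleR_add_right)
  show "(r + s) *\<^sub>R a = r *\<^sub>R a + s *\<^sub>R a" by transfer (simp add: scaleR_add_left)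
  show "r *\<^sub>R s *\<^sub>R a = (r * s) *\<^sub>R a" by transfer simp
  show "1 *\<^sub>R a = a" by transfer simp
  show "dist a b = norm (a - b)" by (rule dist_ell2_def)
  show "sgn a = inverse (norm a) *\<^sub>R a" by (rule sgn_ell2_def)
  show "(uniformity :: (ell2 \<times> ell2) filter) = (INF e\<in>{0<..}. principal {(x, y). dist x y < e})"
    by (rule uniformity_ell2_def)
  show "open U \<longleftrightarrow> (\<forall>x\<in>U. eventually (\<lambda>(x', y). x' = x \<longrightarrow> y \<in> U) uniformity)" for U :: "ell2 set"
    by (rule open_ell2_def)
  show "a \<bullet> b = b \<bullet> a" by (simp add: inner_ell2_def inner_commute)
  have inn: "(\<lambda>n. coord u n \<bullet> coord v n) summable_on UNIV" for u v
    by (intro inner_summable coord_summable)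
  show "(a + b) \<bullet> c = a \<bullet> c + b \<bullet> c"
    by (simp add: inner_ell2_def plus_ell2.rep_eq inner_add_left infsum_add inn)
  show "(r *\<^sub>R a) \<bullet> b = r * (a \<bullet> b)"
    by (simp add: inner_ell2_def scaleR_ell2.rep_eq infsum_cmult_right')
  show "0 \<le> a \<bullet> a" by (simp add: inner_ell2_def infsum_nonneg)
  show "a \<bullet> a = 0 \<longleftrightarrow> a = 0"
  proof
    assume "a \<bullet> a = 0"
    then have "coord a n \<bullet> coord a n = 0" for n
      unfolding inner_ell2_def using inn[of a a] by (intro nonneg_infsum_le_0D[of _ UNIV]) auto
    then show "a = 0" by (simp add: coord_inject[symmetric] zero_ell2.rep_eq fun_eq_iff)
  qed (simp add: inner_ell2_def zero_ell2.rep_eq)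
  show "norm a = sqrt (a \<bullet> a)" by (rule norm_ell2_def)
qed

end

lemma norm_ell2_sq: "(norm v)\<^sup>2 = (\<Sum>\<^sub>\<infinity>n. (cmod (coord v n))\<^sup>2)"
  by (simp add: power2_norm_eq_inner inner_ell2_def)

lemma norm_ell2_sum_le: "finite F \<Longrightarrow> (\<Sum>n\<in>F. (cmod (coord v n))\<^sup>2) \<le> (norm v)\<^sup>2"
  unfolding norm_ell2_sq by (rule finite_sum_le_infsum) (auto intro: coord_summable)

lemma norm_coord_le: "cmod (coord v n) \<le> norm v"
  using norm_ell2_sum_le[of "{n}" v] by (simp add: abs_le_square_iff[symmetric])

lemma square_summable_bound:
  assumes "\<And>F. finite F \<Longrightarrow> (\<Sum>n\<in>F. (cmod (f n))\<^sup>2) \<le> K"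
  shows "(\<lambda>n::int. (cmod (f n))\<^sup>2) summable_on UNIV"
  using assms by (intro nonneg_bdd_above_summable_on) (auto intro!: bdd_aboveI[of _ K])

lemma norm_ell2_le:
  assumes "\<And>F. finite F \<Longrightarrow> (\<Sum>n\<in>F. (cmod (coord v n))\<^sup>2) \<le> K\<^sup>2" "0 \<le> K"
  shows "norm v \<le> K"
proof -
  have "(norm v)\<^sup>2 \<le> K\<^sup>2"
    unfolding norm_ell2_sq using assms(1) by (intro infsum_le_finite_sums coord_summable) auto
  then show ?thesis using assms(2) by (simp add: power2_le_iff_abs_le)
qed

text \<open>Coordinatewise limits exist. The Cauchy estimate over a finite set of indices survives
  the limit with a bound that does not depend on the set, which yields both square summability of
  the limit and convergence in norm.\<close>

instance ell2 :: complete_space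
proof
  fix X :: "nat \<Rightarrow> ell2" assume X: "Cauchy X"
  have "Cauchy (\<lambda>k. coord (X k) n)" for n
  proof (rule metric_CauchyI)
    fix e :: real assume "0 < e"
    then obtain N where N: "\<forall>m\<ge>N. \<forall>k\<ge>N. dist (X m) (X k) < e" using X by (metis metric_CauchyD)
    have "dist (coord (X m) n) (coord (X k) n) \<le> dist (X m) (X k)" for m k
      using norm_coord_le[of "X m - X k" n] by (simp add: dist_norm minus_ell2.rep_eq)
    then show "\<exists>N. \<forall>m\<ge>N. \<forall>k\<ge>N. dist (coord (X m) n) (coord (X k) n) < e"
      using N by (meson le_less_trans)
  qed
  then have "\<exists>l. (\<lambda>k. coord (X k) n) \<longlonglongrightarrow> l" for n
    using Cauchy_convergent convergent_def by blast
  then obtain l where l: "\<And>n. (\<lambda>k. coord (X k) n) \<longlonglongrightarrow> l n" by metis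
  have close: "\<exists>N. \<forall>m\<ge>N. \<forall>F. finite F \<longrightarrow> (\<Sum>n\<in>F. (cmod (coord (X m) n - l n))\<^sup>2) \<le> e\<^sup>2"
    if e: "0 < e" for e :: real
  proof -
    obtain N where N: "\<forall>m\<ge>N. \<forall>k\<ge>N. dist (X m) (X k) < e" using X e by (metis metric_CauchyD)
    have "(\<Sum>n\<in>F. (cmod (coord (X m) n - l n))\<^sup>2) \<le> e\<^sup>2" if "m \<ge> N" "finite F" for m F
    proof (rule tendsto_upperbound)
      show "(\<lambda>k. \<Sum>n\<in>F. (cmod (coord (X m) n - coord (X k) n))\<^sup>2) \<longlonglongrightarrow> (\<Sum>n\<in>F. (cmod (coord (X m) n - l n))\<^sup>2)"
        by (intro tendsto_intros l)
      have "(\<Sum>n\<in>F. (cmod (coord (X m) n - coord (X k) n))\<^sup>2) \<le> e\<^sup>2" if "k \<ge> N" for k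
      proof -
        have "(\<Sum>n\<in>F. (cmod (coord (X m) n - coord (X k) n))\<^sup>2) \<le> (norm (X m - X k))\<^sup>2"
          using norm_ell2_sum_le[OF \<open>finite F\<close>, of "X m - X k"] by (simp add: minus_ell2.rep_eq)
        also have "\<dots> \<le> e\<^sup>2"
          using N \<open>m \<ge> N\<close> that by (intro power_mono) (auto simp: dist_norm less_imp_le)
        finally show ?thesis .
      qed
      then show "\<forall>\<^sub>F k in sequentially. (\<Sum>n\<in>F. (cmod (coord (X m) n - coord (X k) n))\<^sup>2) \<le> e\<^sup>2"
        by (auto simp: eventually_sequentially)
    qed simp
    then show ?thesis by blast
  qed
  obtain N where N: "\<forall>m\<ge>N. \<forall>F. finite F \<longrightarrow> (\<Sum>n\<in>F. (cmod (coord (X m) n - l n))\<^sup>2) \<le> 1\<^sup>2"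
    using close[of 1] by auto
  have "(\<lambda>n. (cmod (coord (X N) n - l n))\<^sup>2) summable_on UNIV"
    using N by (intro square_summable_bound[of _ 1]) auto
  then have "(\<lambda>n. (cmod (coord (X N) n + - (coord (X N) n - l n)))\<^sup>2) summable_on UNIV"
    by (intro square_summable_add coord_summable) (simp only: norm_minus_cancel)
  then have "l \<in> {f. (\<lambda>n. (cmod (f n))\<^sup>2) summable_on UNIV}" by simp
  then obtain L where L: "coord L = l" using Abs_ell2_inverse by blast
  have "X \<longlonglongrightarrow> L"
  proof (rule metric_LIMSEQ_I)
    fix e :: real assume e: "0 < e"
    then obtain N where N: "\<forall>m\<ge>N. \<forall>F. finite F \<longrightarrow> (\<Sum>n\<in>F. (cmod (coord (X m) n - l n))\<^sup>2) \<le> (e/2)\<^sup>2"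
      using close[of "e/2"] by auto
    have "dist (X m) L < e" if "m \<ge> N" for m
    proof -
      have "norm (X m - L) \<le> e/2"
        using N that e by (intro norm_ell2_le) (auto simp: minus_ell2.rep_eq L)
      then show ?thesis using e by (simp add: dist_norm)
    qed
    then show "\<exists>N. \<forall>m\<ge>N. dist (X m) L < e" by blast
  qed
  then show "convergent X" by (auto simp: convergent_def)
qed

instance ell2 :: banach ..

section \<open>Weighted shifts\<close>

lemma weighted_shift_bound:
  assumes "\<And>n. cmod (d n) \<le> K" "finite F"
  shows "(\<Sum>n\<in>F. (cmod (d n * coord v (n - k)))\<^sup>2) \<le> (K * norm v)\<^sup>2"
proof -
  have "0 \<le> K" using assms(1) norm_ge_zero order_trans by blast
  have "(\<Sum>n\<in>F. (cmod (d n * coord v (n - k)))\<^sup>2) \<le> (\<Sum>n\<in>F. K\<^sup>2 * (cmod (coord v (n - k)))\<^sup>2)"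
    using assms(1) by (intro sum_mono) (simp add: norm_mult power_mult_distrib power_mono mult_right_mono)
  also have "\<dots> = K\<^sup>2 * (\<Sum>n\<in>(\<lambda>n. n - k) ` F. (cmod (coord v n))\<^sup>2)"
    by (subst sum.reindex) (auto simp: inj_on_def sum_distrib_left)
  also have "\<dots> \<le> K\<^sup>2 * (norm v)\<^sup>2"
    using assms(2) by (intro mult_left_mono norm_ell2_sum_le) auto
  finally show ?thesis by (simp add: power_mult_distrib)
qed

text \<open>\<open>wshift d k\<close> sends the basis vector \<open>e\<^sub>n\<close> to \<open>d (n + k) e\<^sub>n\<^sub>+\<^sub>k\<close>; it is zero for
  unbounded \<open>d\<close>.\<close>

definition wshift :: "(int \<Rightarrow> complex) \<Rightarrow> int \<Rightarrow> ell2 \<Rightarrow>\<^sub>L ell2" where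
  "wshift d k = Blinfun (\<lambda>v. Abs_ell2 (\<lambda>n. if bounded (range d) then d n * coord v (n - k) else 0))"

lemma coord_wshift:
  assumes "bounded (range d)"
  shows "coord (wshift d k v) n = d n * coord v (n - k)"
proof -
  obtain K where K: "\<And>n. cmod (d n) \<le> K" using assms by (auto simp: bounded_iff)
  then have K0: "0 \<le> K" using norm_ge_zero order_trans by blast
  define T where "T v = Abs_ell2 (\<lambda>n. d n * coord v (n - k))" for v
  have co: "coord (T v) = (\<lambda>n. d n * coord v (n - k))" for v
    unfolding T_def using square_summable_bound[OF weighted_shift_bound[OF K]]
    by (intro Abs_ell2_inverse) simp
  have "bounded_linear T"
  proof (rule bounded_linear_intro)
    show "T (u + v) = T u + T v" for u v
      by (simp add: coord_inject[symmetric] co plus_ell2.rep_eq fun_eq_iff distrib_left)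
    show "T (r *\<^sub>R u) = r *\<^sub>R T u" for r u
      by (simp add: coord_inject[symmetric] co scaleR_ell2.rep_eq fun_eq_iff)
    show "norm (T u) \<le> norm u * K" for u
      using weighted_shift_bound[where d = d and K = K and v = u and k = k, OF K] K0
      by (intro norm_ell2_le) (auto simp: co mult.commute)
  qed
  moreover have "wshift d k = Blinfun T" using assms by (simp add: wshift_def T_def[abs_def])
  ultimately show ?thesis by (simp add: bounded_linear_Blinfun_apply co)
qed

lemma ell2_eqI: "(\<And>n. coord u n = coord v n) \<Longrightarrow> u = v"
  by (simp add: coord_inject[symmetric] fun_eq_iff)

lemma wshift_eqI:
  fixes T :: "ell2 \<Rightarrow>\<^sub>L ell2"
  assumes "\<And>v n. coord (T v) n = d n * coord v (n - k)" "bounded (range d)"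
  shows "T = wshift d k"
  by (intro blinfun_eqI ell2_eqI) (simp add: assms coord_wshift)

lemma bounded_range_mult:
  fixes d e :: "int \<Rightarrow> complex"
  assumes "bounded (range d)" "bounded (range e)"
  shows "bounded (range (\<lambda>n. d n * e (n - k)))"
proof -
  obtain K L where "\<And>n. cmod (d n) \<le> K" "\<And>n. cmod (e n) \<le> L"
    using assms by (auto simp: bounded_iff)
  then have "cmod (d n * e (n - k)) \<le> K * L" for n
    unfolding norm_mult by (intro mult_mono) (auto intro: order_trans[OF norm_ge_zero])
  then show ?thesis by (auto simp: bounded_iff)
qed

lemma wshift_compose:
  assumes "bounded (range d)" "bounded (range e)"
  shows "wshift d k o\<^sub>L wshift e l = wshift (\<lambda>n. d n * e (n - k)) (k + l)"
  using assms by (intro wshift_eqI bounded_range_mult)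
    (simp_all add: coord_wshift mult.assoc algebra_simps)

lemma wshift_add:
  assumes "bounded (range d)" "bounded (range e)"
  shows "wshift d k + wshift e k = wshift (\<lambda>n. d n + e n) k"
  using assms by (intro wshift_eqI bounded_plus_comp)
    (simp_all add: coord_wshift blinfun.add_left plus_ell2.rep_eq distrib_right)

lemma wshift_one: "wshift (\<lambda>_. 1) 0 = id_blinfun"
  by (rule wshift_eqI[symmetric]) simp_all

section \<open>Composition, adjoints and complex-linear operators\<close>

interpretation compose: bounded_bilinear "(o\<^sub>L) :: (ell2 \<Rightarrow>\<^sub>L ell2) \<Rightarrow> (ell2 \<Rightarrow>\<^sub>L ell2) \<Rightarrow> _"
  by (rule bounded_bilinear_blinfun_compose)

lemma blinfun_assoc: "(R o\<^sub>L S) o\<^sub>L T = R o\<^sub>L (S o\<^sub>L T)"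
  by (rule blinfun_eqI) simp

text \<open>The adjoint for the real inner product. For complex-linear operators it agrees with the
  Hermitian adjoint, since a Hermitian product is determined by its real part.\<close>

definition adjoint_of :: "(ell2 \<Rightarrow>\<^sub>L ell2) \<Rightarrow> (ell2 \<Rightarrow>\<^sub>L ell2) \<Rightarrow> bool" where
  "adjoint_of T S \<longleftrightarrow> (\<forall>u v. T u \<bullet> v = u \<bullet> S v)"

lemma adjoint_of_wshift:
  assumes d: "bounded (range d)"
  shows "adjoint_of (wshift d k) (wshift (\<lambda>n. cnj (d (n + k))) (- k))"
proof -
  have d': "bounded (range (\<lambda>n. cnj (d (n + k))))"
    using d by (auto simp: bounded_iff)
  have "(\<Sum>\<^sub>\<infinity>n. (d n * coord u (n - k)) \<bullet> coord v n)
      = (\<Sum>\<^sub>\<infinity>n. coord u n \<bullet> (cnj (d (n + k)) * coord v (n + k)))" for u v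
  proof -
    have "bij_betw (\<lambda>n. n + k) UNIV UNIV"
      by (rule bij_betwI[of _ _ _ "\<lambda>n. n - k"]) auto
    then have "(\<Sum>\<^sub>\<infinity>n. (d n * coord u (n - k)) \<bullet> coord v n)
        = (\<Sum>\<^sub>\<infinity>n. (d (n + k) * coord u n) \<bullet> coord v (n + k))"
      by (subst infsum_reindex_bij_betw[symmetric, where g = "\<lambda>n. n + k"]) auto
    then show ?thesis by (simp add: inner_complex_def algebra_simps)
  qed
  then show ?thesis
    by (simp add: adjoint_of_def inner_ell2_def coord_wshift d d')
qed

lemma adjoint_of_unique: "adjoint_of T S \<Longrightarrow> adjoint_of T S' \<Longrightarrow> S = S'"
proof (rule blinfun_eqI)
  fix v assume "adjoint_of T S" "adjoint_of T S'"
  then have "\<forall>u. u \<bullet> S v = u \<bullet> S' v" unfolding adjoint_of_def by metis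
  then show "S v = S' v" by (simp add: vector_eq_ldot)
qed

lemma adjoint_of_sym: "adjoint_of T S \<Longrightarrow> adjoint_of S T"
  by (simp add: adjoint_of_def inner_commute)

lemma adjoint_of_add: "adjoint_of T S \<Longrightarrow> adjoint_of T' S' \<Longrightarrow> adjoint_of (T + T') (S + S')"
  by (simp add: adjoint_of_def blinfun.add_left inner_add_left inner_add_right)

lemma adjoint_of_compose: "adjoint_of T S \<Longrightarrow> adjoint_of T' S' \<Longrightarrow> adjoint_of (T o\<^sub>L T') (S' o\<^sub>L S)"
  by (simp add: adjoint_of_def)

lemma adjoint_of_diff: "adjoint_of T S \<Longrightarrow> adjoint_of T' S' \<Longrightarrow> adjoint_of (T - T') (S - S')"
  by (simp add: adjoint_of_def blinfun.diff_left inner_diff_left inner_diff_right)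

lemma norm_adjoint_of:
  assumes "adjoint_of T S" shows "norm S \<le> norm T"
proof (rule norm_blinfun_bound)
  fix v
  have "norm (S v) * norm (S v) = T (S v) \<bullet> v"
    using assms by (simp add: adjoint_of_def dot_square_norm power2_eq_square[symmetric])
  also have "\<dots> \<le> norm (T (S v)) * norm v" by (rule norm_cauchy_schwarz)
  also have "\<dots> \<le> (norm T * norm (S v)) * norm v" by (intro mult_right_mono norm_blinfun) simp
  finally show "norm (S v) \<le> norm T * norm v"
    by (cases "norm (S v) = 0") (simp_all add: mult.assoc mult.left_commute)
qed simp

text \<open>The C*-identity for operators: the norm of T v squared is the inner product of v with S
  T v, and Cauchy-Schwarz applies.\<close>

lemma norm_adjoint_compose:
  assumes "adjoint_of T S" shows "norm (S o\<^sub>L T) = (norm T)\<^sup>2"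
proof (rule antisym)
  have "norm (S o\<^sub>L T) \<le> norm S * norm T" by (rule norm_blinfun_compose)
  also have "\<dots> \<le> norm T * norm T" using norm_adjoint_of[OF assms] by (intro mult_right_mono) auto
  finally show "norm (S o\<^sub>L T) \<le> (norm T)\<^sup>2" by (simp add: power2_eq_square)
  have "norm T \<le> sqrt (norm (S o\<^sub>L T))"
  proof (rule norm_blinfun_bound)
    fix v
    have "(norm (T v))\<^sup>2 = v \<bullet> (S o\<^sub>L T) v"
      using assms by (simp add: adjoint_of_def power2_norm_eq_inner)
    also have "\<dots> \<le> norm v * norm ((S o\<^sub>L T) v)" by (rule norm_cauchy_schwarz)
    also have "\<dots> \<le> norm v * (norm (S o\<^sub>L T) * norm v)" by (intro mult_left_mono norm_blinfun) simp
    also have "\<dots> = (sqrt (norm (S o\<^sub>L T)) * norm v)\<^sup>2"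
      by (simp add: power_mult_distrib power2_eq_square)
    finally show "norm (T v) \<le> sqrt (norm (S o\<^sub>L T)) * norm v"
      by (rule power2_le_imp_le) simp
  qed simp
  then show "(norm T)\<^sup>2 \<le> norm (S o\<^sub>L T)" 
    by (metis norm_ge_zero power_mono real_sqrt_pow2)
qed

text \<open>Multiplication by a complex scalar, as an operator; commuting with all of these is
  complex linearity.\<close>

abbreviation cscale :: "complex \<Rightarrow> ell2 \<Rightarrow>\<^sub>L ell2" where
  "cscale c \<equiv> wshift (\<lambda>_. c) 0"

lemma norm_cscale_apply: "norm (cscale c v) = cmod c * norm v"
proof -
  have "(norm (cscale c v))\<^sup>2 = (cmod c * norm v)\<^sup>2"
    by (simp add: norm_ell2_sq power_mult_distrib coord_wshift norm_mult infsum_cmult_right')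
  then show ?thesis by (metis norm_ge_zero mult_nonneg_nonneg power2_eq_iff_nonneg)
qed

text \<open>Demanding an adjoint makes the Riesz representation theorem unnecessary.\<close>

definition operators :: "(ell2 \<Rightarrow>\<^sub>L ell2) set" where
  "operators = {T. (\<forall>c. T o\<^sub>L cscale c = cscale c o\<^sub>L T) \<and> (\<exists>S. adjoint_of T S)}"

lemma wshift_operators: "bounded (range d) \<Longrightarrow> wshift d k \<in> operators"
  using adjoint_of_wshift[of d k] by (auto simp: operators_def wshift_compose mult.commute)

definition op_adjoint :: "(ell2 \<Rightarrow>\<^sub>L ell2) \<Rightarrow> ell2 \<Rightarrow>\<^sub>L ell2" where
  "op_adjoint T = (SOME S. adjoint_of T S)"

lemma adjoint_of_adjoint: "T \<in> operators \<Longrightarrow> adjoint_of T (op_adjoint T)"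
  unfolding op_adjoint_def operators_def by (auto intro: someI_ex)

lemma adjoint_eq: "adjoint_of T S \<Longrightarrow> op_adjoint T = S"
  unfolding op_adjoint_def by (rule some_equality) (auto intro: adjoint_of_unique)

lemma operators_add: "T \<in> operators \<Longrightarrow> S \<in> operators \<Longrightarrow> T + S \<in> operators"
  unfolding operators_def
  by (auto simp: compose.add_left compose.add_right intro: adjoint_of_add)

lemma operators_diff: "T \<in> operators \<Longrightarrow> S \<in> operators \<Longrightarrow> T - S \<in> operators"
  unfolding operators_def
  by (auto simp: compose.diff_left compose.diff_right intro: adjoint_of_diff)

lemma operators_compose: "T \<in> operators \<Longrightarrow> S \<in> operators \<Longrightarrow> T o\<^sub>L S \<in> operators"
proof -
  assume T: "T \<in> operators" and S: "S \<in> operators"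
  then have "(T o\<^sub>L S) o\<^sub>L cscale c = cscale c o\<^sub>L (T o\<^sub>L S)" for c
    by (simp add: operators_def blinfun_assoc) (simp add: blinfun_assoc[symmetric])
  then show ?thesis using S T unfolding operators_def by (auto intro: adjoint_of_compose)
qed

lemma adjoint_of_cscale: "adjoint_of (cscale c) (cscale (cnj c))"
  using adjoint_of_wshift[of "\<lambda>_. c" 0] by simp

text \<open>Complex linearity of the adjoint follows from uniqueness of adjoints: both
  \<open>op_adjoint T o\<^sub>L cscale c\<close> and \<open>cscale c o\<^sub>L op_adjoint T\<close>
  are adjoint to T followed by the conjugate scalar.\<close>

lemma operators_adjoint:
  assumes "T \<in> operators" shows "op_adjoint T \<in> operators"
proof -
  have "op_adjoint T o\<^sub>L cscale c = cscale c o\<^sub>L op_adjoint T" for c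
  proof (rule adjoint_of_unique)
    have "adjoint_of (cscale (cnj c) o\<^sub>L T) (op_adjoint T o\<^sub>L cscale c)"
      using adjoint_of_compose[OF adjoint_of_cscale[of "cnj c"] adjoint_of_adjoint[OF assms]] by simp
    then show "adjoint_of (cscale (cnj c) o\<^sub>L T) (op_adjoint T o\<^sub>L cscale c)" .
    have "adjoint_of (T o\<^sub>L cscale (cnj c)) (cscale c o\<^sub>L op_adjoint T)"
      using adjoint_of_compose[OF adjoint_of_adjoint[OF assms] adjoint_of_cscale[of "cnj c"]] by simp
    then show "adjoint_of (cscale (cnj c) o\<^sub>L T) (cscale c o\<^sub>L op_adjoint T)"
      using assms by (simp add: operators_def)
  qed
  then show ?thesis
    using adjoint_of_sym[OF adjoint_of_adjoint[OF assms]] by (auto simp: operators_def)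
qed

text \<open>Taking adjoints does not increase norms of differences, so the adjoints converge as
  well, and their limit is an adjoint of the limit.\<close>

lemma operators_complete:
  assumes T: "\<And>n. T n \<in> operators" and "Cauchy T"
  obtains L where "L \<in> operators" "T \<longlonglongrightarrow> L"
proof -
  obtain L where L: "T \<longlonglongrightarrow> L" using Cauchy_convergent[OF assms(2)] by (auto simp: convergent_def)
  have "Cauchy (\<lambda>n. op_adjoint (T n))"
  proof (rule metric_CauchyI)
    fix e :: real assume "0 < e"
    then obtain N where "\<forall>m\<ge>N. \<forall>n\<ge>N. dist (T m) (T n) < e" using metric_CauchyD[OF assms(2)] by blast
    moreover have "dist (op_adjoint (T m)) (op_adjoint (T n)) \<le> dist (T m) (T n)" for m n
      unfolding dist_norm by (intro norm_adjoint_of adjoint_of_diff adjoint_of_adjoint T)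
    ultimately show "\<exists>N. \<forall>m\<ge>N. \<forall>n\<ge>N. dist (op_adjoint (T m)) (op_adjoint (T n)) < e"
      using le_less_trans by blast
  qed
  from Cauchy_convergent[OF this] obtain S where S: "(\<lambda>n. op_adjoint (T n)) \<longlonglongrightarrow> S"
    by (auto simp: convergent_def)
  have "L u \<bullet> v = u \<bullet> S v" for u v
  proof (rule LIMSEQ_unique)
    show "(\<lambda>n. T n u \<bullet> v) \<longlonglongrightarrow> (L u \<bullet> v)" by (intro tendsto_intros L)
    have "(\<lambda>n. u \<bullet> op_adjoint (T n) v) \<longlonglongrightarrow> (u \<bullet> S v)" by (intro tendsto_intros S)
    then show "(\<lambda>n. T n u \<bullet> v) \<longlonglongrightarrow> (u \<bullet> S v)"
      using adjoint_of_adjoint[OF T] by (simp add: adjoint_of_def)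
  qed
  moreover have "L o\<^sub>L cscale c = cscale c o\<^sub>L L" for c
  proof (rule LIMSEQ_unique)
    show "(\<lambda>n. T n o\<^sub>L cscale c) \<longlonglongrightarrow> (L o\<^sub>L cscale c)" by (intro compose.tendsto L tendsto_const)
    have "(\<lambda>n. cscale c o\<^sub>L T n) \<longlonglongrightarrow> (cscale c o\<^sub>L L)" by (intro compose.tendsto L tendsto_const)
    then show "(\<lambda>n. T n o\<^sub>L cscale c) \<longlonglongrightarrow> (cscale c o\<^sub>L L)"
      using T by (simp add: operators_def)
  qed
  ultimately have "L \<in> operators" by (auto simp: operators_def adjoint_of_def)
  then show ?thesis using L that by blast
qed

text \<open>Transports operators to the type over which \<open>is_A\<close> quantifies. What happens
  on sequences that are not square-summable is immaterial: the square-summable ones already separate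
  operators.\<close>

definition emb :: "(ell2 \<Rightarrow>\<^sub>L ell2) \<Rightarrow> test_elem" where
  "emb T = (\<lambda>f. coord (T (Abs_ell2 f)))"

lemma inj_emb: "inj emb"
proof (rule injI)
  fix T S assume "emb T = emb S"
  then have "coord (T (Abs_ell2 (coord v))) = coord (S (Abs_ell2 (coord v)))" for v
    unfolding emb_def by (rule fun_cong)
  then show "T = S" by (intro blinfun_eqI) (simp add: coord_inverse coord_inject)
qed

definition prj :: "test_elem \<Rightarrow> ell2 \<Rightarrow>\<^sub>L ell2" where
  "prj = inv_into UNIV emb"

lemma prj_emb [simp]: "prj (emb T) = T"
  by (simp add: prj_def inj_emb)

definition BH :: "test_elem normed_star_alg" where
  "BH = \<lparr>carrier = emb ` operators,
     monoid.mult = (\<lambda>a b. emb (prj a o\<^sub>L prj b)), one = emb id_blinfun,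
     zero = emb 0, add = (\<lambda>a b. emb (prj a + prj b)),
     smult = (\<lambda>c a. emb (cscale c o\<^sub>L prj a)),
     adj = (\<lambda>a. emb (op_adjoint (prj a))), nrm = (\<lambda>a. norm (prj a))\<rparr>"

lemma BH_simps [simp]:
  "carrier BH = emb ` operators"
  "emb T \<otimes>\<^bsub>BH\<^esub> emb S = emb (T o\<^sub>L S)" "\<one>\<^bsub>BH\<^esub> = emb id_blinfun"
  "\<zero>\<^bsub>BH\<^esub> = emb 0" "emb T \<oplus>\<^bsub>BH\<^esub> emb S = emb (T + S)"
  "c \<odot>\<^bsub>BH\<^esub> emb T = emb (cscale c o\<^sub>L T)"
  "adj BH (emb T) = emb (op_adjoint T)" "nrm BH (emb T) = norm T"
  by (simp_all add: BH_def)

lemma operators_id: "id_blinfun \<in> operators"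
  using wshift_operators[of "\<lambda>_. 1" 0] by (simp add: wshift_one)

lemma operators_zero: "0 \<in> operators"
  using operators_diff[OF operators_id operators_id] by simp

lemma operators_neg: "T \<in> operators \<Longrightarrow> - T \<in> operators"
  using operators_diff[OF operators_zero] by simp

lemma id_compose [simp]: "id_blinfun o\<^sub>L T = T" "T o\<^sub>L id_blinfun = T"
  for T :: "ell2 \<Rightarrow>\<^sub>L ell2"
  by (simp_all add: blinfun_eqI)

lemma ring_BH: "ring BH"
proof (rule ringI)
  show "abelian_group BH"
  proof (rule abelian_groupI)
    fix x assume "x \<in> carrier BH"
    then obtain T where "x = emb T" "T \<in> operators" by auto
    then show "\<exists>y\<in>carrier BH. y \<oplus>\<^bsub>BH\<^esub> x = \<zero>\<^bsub>BH\<^esub>"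
      using operators_neg by (intro bexI[of _ "emb (- T)"]) auto
  qed (auto simp: operators_add operators_zero ac_simps)
  show "Group.monoid BH"
    by (rule monoidI) (auto simp: operators_compose operators_id blinfun_assoc)
qed (auto simp: compose.add_left compose.add_right)

lemma module_BH: "Module.module complex_ring BH"
proof (rule moduleI)
  show "cring complex_ring" by (rule cring_complex_ring)
  show "abelian_group BH" using ring_BH by (rule ring.is_abelian_group)
qed (auto simp: complex_ring_def operators_compose wshift_operators compose.add_left
    compose.add_right blinfun_assoc[symmetric] wshift_compose wshift_add[symmetric] wshift_one id_compose)

lemma BH_minus:
  assumes "T \<in> operators" "S \<in> operators"
  shows "emb T \<ominus>\<^bsub>BH\<^esub> emb S = emb (T - S)"
proof -
  have "\<ominus>\<^bsub>BH\<^esub> emb S = emb (- S)"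
    using assms by (intro abelian_group.minus_equality[OF ring.is_abelian_group[OF ring_BH]])
      (auto simp: operators_neg)
  then show ?thesis by (simp add: a_minus_def)
qed

lemma cstar_BH: "unital_cstar_algebra BH"
proof (intro unital_cstar_algebra.intro ring_BH module_BH unital_cstar_algebra_axioms.intro)
  fix a b :: test_elem and c :: complex
  assume a: "a \<in> carrier BH"
  then obtain T where T: "a = emb T" "T \<in> operators" by auto
  show "adj BH a \<in> carrier BH" using T by (simp add: operators_adjoint)
  show "adj BH (adj BH a) = a"
    using T by (simp add: adjoint_eq[OF adjoint_of_sym[OF adjoint_of_adjoint]])
  show "adj BH (c \<odot>\<^bsub>BH\<^esub> a) = cnj c \<odot>\<^bsub>BH\<^esub> adj BH a"
  proof -
    have "op_adjoint (cscale c o\<^sub>L T) = op_adjoint T o\<^sub>L cscale (cnj c)"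
      using T by (intro adjoint_eq adjoint_of_compose adjoint_of_cscale adjoint_of_adjoint)
    then show ?thesis using T operators_adjoint[OF T(2)] by (simp add: operators_def)
  qed
  show "0 \<le> nrm BH a" using T by simp
  show "nrm BH a = 0 \<longleftrightarrow> a = \<zero>\<^bsub>BH\<^esub>" using T by (simp add: inj_eq[OF inj_emb])
  show "nrm BH (c \<odot>\<^bsub>BH\<^esub> a) = cmod c * nrm BH a"
  proof -
    have le: "norm (cscale c o\<^sub>L T) \<le> cmod c * norm T" for c T
    proof (rule norm_blinfun_bound)
      fix v
      have "norm ((cscale c o\<^sub>L T) v) = cmod c * norm (T v)" by (simp add: norm_cscale_apply)
      also have "\<dots> \<le> cmod c * (norm T * norm v)" by (intro mult_left_mono norm_blinfun) simp
      finally show "norm ((cscale c o\<^sub>L T) v) \<le> cmod c * norm T * norm v" by (simp add: mult.assoc)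
    qed simp
    \<comment> \<open>The reverse estimate is the upper one applied to
      \<open>inverse c\<close>.\<close>
    have "cmod c * norm T \<le> norm (cscale c o\<^sub>L T)"
    proof (cases "c = 0")
      case False
      have "T = cscale (inverse c) o\<^sub>L (cscale c o\<^sub>L T)"
        using False by (simp add: blinfun_assoc[symmetric] wshift_compose wshift_one)
      then have "norm T \<le> cmod (inverse c) * norm (cscale c o\<^sub>L T)" using le by metis
      then have "norm T \<le> norm (cscale c o\<^sub>L T) / cmod c"
        by (simp add: norm_inverse divide_inverse mult.commute)
      then show ?thesis using False by (simp add: pos_le_divide_eq mult.commute)
    qed simp
    then show ?thesis using T le[of c T] by simp
  qed
  show "nrm BH (adj BH a \<otimes>\<^bsub>BH\<^esub> a) = (nrm BH a)\<^sup>2"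
    using T by (simp add: norm_adjoint_compose adjoint_of_adjoint)
  assume "b \<in> carrier BH"
  then obtain S where S: "b = emb S" "S \<in> operators" by auto
  show "(c \<odot>\<^bsub>BH\<^esub> a) \<otimes>\<^bsub>BH\<^esub> b = c \<odot>\<^bsub>BH\<^esub> (a \<otimes>\<^bsub>BH\<^esub> b)"
    using S T by (simp add: blinfun_assoc)
  have "T o\<^sub>L (cscale c o\<^sub>L S) = cscale c o\<^sub>L (T o\<^sub>L S)"
    using T by (simp add: operators_def blinfun_assoc[symmetric])
  then show "a \<otimes>\<^bsub>BH\<^esub> (c \<odot>\<^bsub>BH\<^esub> b) = c \<odot>\<^bsub>BH\<^esub> (a \<otimes>\<^bsub>BH\<^esub> b)" using S T by simp
  show "adj BH (a \<oplus>\<^bsub>BH\<^esub> b) = adj BH a \<oplus>\<^bsub>BH\<^esub> adj BH b"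
    using S T by (simp add: adjoint_eq[OF adjoint_of_add[OF adjoint_of_adjoint adjoint_of_adjoint]])
  show "adj BH (a \<otimes>\<^bsub>BH\<^esub> b) = adj BH b \<otimes>\<^bsub>BH\<^esub> adj BH a"
    using S T by (simp add: adjoint_eq[OF adjoint_of_compose[OF adjoint_of_adjoint adjoint_of_adjoint]])
  show "nrm BH (a \<oplus>\<^bsub>BH\<^esub> b) \<le> nrm BH a + nrm BH b" using S T by (simp add: norm_triangle_ineq)
  show "nrm BH (a \<otimes>\<^bsub>BH\<^esub> b) \<le> nrm BH a * nrm BH b" using S T by (simp add: norm_blinfun_compose)
next
  fix s :: "nat \<Rightarrow> test_elem"
  assume s: "\<And>n. s n \<in> carrier BH"
    and cau: "\<And>e. 0 < e \<Longrightarrow> \<exists>N. \<forall>m\<ge>N. \<forall>n\<ge>N. nrm BH (s m \<ominus>\<^bsub>BH\<^esub> s n) < e"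
  define T where "T n = prj (s n)" for n
  have T: "s n = emb (T n)" "T n \<in> operators" for n
    using s[of n] by (auto simp: T_def)
  have "Cauchy T"
    using cau by (intro metric_CauchyI) (simp add: T BH_minus operators_diff dist_norm)
  then obtain L where "L \<in> operators" "T \<longlonglongrightarrow> L" using operators_complete[of T, OF T(2)] by blast
  then show "\<exists>a\<in>carrier BH. (\<lambda>n. nrm BH (s n \<ominus>\<^bsub>BH\<^esub> a)) \<longlonglongrightarrow> 0"
    using T by (intro bexI[of _ "emb L"]) (auto simp: BH_minus tendsto_norm_zero_iff LIM_zero_iff)
qed

section \<open>Continuous functional calculus on the circle\<close>

text \<open>A unital *-homomorphism on the continuous functions of the circle, taken on total
  functions; \<open>cong\<close> says that only values on the circle count. A norm bound is not
  assumed but derived in \<open>contractive\<close>.\<close>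

locale circle_calculus = unital_cstar_algebra +
  fixes F :: "(complex \<Rightarrow> complex) \<Rightarrow> 'a"
  assumes closed: "ccont f \<Longrightarrow> F f \<in> carrier A"
    and cong: "\<lbrakk>ccont f; ccont g; \<And>z. z \<in> circle \<Longrightarrow> f z = g z\<rbrakk> \<Longrightarrow> F f = F g"
    and one: "F (\<lambda>z. 1) = \<one>"
    and add: "\<lbrakk>ccont f; ccont g\<rbrakk> \<Longrightarrow> F (\<lambda>z. f z + g z) = F f \<oplus> F g"
    and mult: "\<lbrakk>ccont f; ccont g\<rbrakk> \<Longrightarrow> F (\<lambda>z. f z * g z) = F f \<otimes> F g"
    and scale: "ccont f \<Longrightarrow> F (\<lambda>z. c * f z) = c \<odot> F f"
    and cnj: "ccont f \<Longrightarrow> F (\<lambda>z. cnj (f z)) = adj A (F f)"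
begin

lemma const: "F (\<lambda>z. c) = c \<odot> \<one>"
  using scale[of "\<lambda>z. 1" c] by (simp add: one)

lemma diff:
  "\<lbrakk>ccont f; ccont g\<rbrakk> \<Longrightarrow> F (\<lambda>z. f z - g z) = F f \<ominus> F g"
  using add[of f "\<lambda>z. (-1) * g z"] scale[of g "-1"]
  by (simp add: closed sc_minus_one a_minus_def continuous_intros)

lemma norm_unitary_le:
  assumes "ccont u" "\<And>z. z \<in> circle \<Longrightarrow> cmod (u z) = 1"
  shows "nrm A (F u) \<le> 1"
proof (rule nrm_unitary_le)
  show "F u \<in> carrier A" using assms by (intro closed)
  have "adj A (F u) \<otimes> F u = F (\<lambda>z. cnj (u z) * u z)"
    using assms by (simp add: mult cnj continuous_intros)
  also have "\<dots> = F (\<lambda>z. 1)"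
    using assms by (intro cong continuous_intros) (simp_all add: mult.commute[of "cnj _"] complex_norm_square[symmetric])
  finally show "adj A (F u) \<otimes> F u = \<one>" by (simp add: one)
qed

text \<open>A real function with values in \<open>[-1, 1]\<close> is the average of the two unitary functions
  \<open>h \<plusminus> i\<surd>(1 - h\<^sup>2)\<close>.\<close>

lemma norm_real_le:
  assumes h: "ccont h" "\<And>z. z \<in> circle \<Longrightarrow> \<bar>h z\<bar> \<le> 1"
  shows "nrm A (F (\<lambda>z. of_real (h z))) \<le> 1"
proof -
  define u where "u = (\<lambda>z. Complex (h z) (sqrt (1 - (h z)\<^sup>2)))"
  have u: "ccont u"
    unfolding u_def Complex_eq using h by (intro continuous_intros)
  have "cmod (u z) = 1" if "z \<in> circle" for z
    using h(2)[OF that] by (simp add: u_def cmod_def abs_square_le_1)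
  then have n: "nrm A (F u) \<le> 1" using u by (rule norm_unitary_le[rotated])
  have "F (\<lambda>z. of_real (h z)) = F (\<lambda>z. (1/2) * (u z + cnj (u z)))"
    using h u by (intro cong continuous_intros) (auto simp: u_def complex_eq_iff)
  also have "\<dots> = (1/2) \<odot> (F u \<oplus> adj A (F u))"
    using scale[of "\<lambda>z. u z + cnj (u z)" "1/2"] add[of u "\<lambda>z. cnj (u z)"] cnj[OF u] u
    by (simp add: continuous_intros)
  finally have "nrm A (F (\<lambda>z. of_real (h z))) = 1/2 * nrm A (F u \<oplus> adj A (F u))"
    using closed[OF u] by (simp add: nrm_smult adj_closed)
  also have "\<dots> \<le> 1/2 * (nrm A (F u) + nrm A (F u))"
    using nrm_triangle[OF closed[OF u] adj_closed[OF closed[OF u]]] closed[OF u] by simp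
  finally show ?thesis using n by simp
qed

lemma contractive:
  assumes f: "ccont f" and B: "\<And>z. z \<in> circle \<Longrightarrow> cmod (f z) \<le> B"
  shows "nrm A (F f) \<le> B"
proof -
  have B0: "0 \<le> B" using order_trans[OF norm_ge_zero B[of 1]] by simp
  have *: "nrm A (F g) \<le> 1" if g: "ccont g" "\<And>z. z \<in> circle \<Longrightarrow> cmod (g z) \<le> 1" for g
  proof -
    have "adj A (F g) \<otimes> F g = F (\<lambda>z. cnj (g z) * g z)"
      using g by (simp add: mult cnj continuous_intros)
    also have "\<dots> = F (\<lambda>z. of_real ((cmod (g z))\<^sup>2))"
      by (intro cong continuous_intros g(1)) (metis complex_norm_square mult.commute)
    finally have "(nrm A (F g))\<^sup>2 = nrm A (F (\<lambda>z. of_real ((cmod (g z))\<^sup>2)))"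
      using cstar_identity[OF closed[OF g(1)]] by simp
    also have "\<dots> \<le> 1"
      using g(2) by (intro norm_real_le continuous_intros g(1)) (simp add: power_le_one)
    finally show ?thesis
      using nrm_nonneg[OF closed[OF g(1)]] by (simp add: power_le_one_iff)
  qed
  show ?thesis
  proof (cases "B = 0")
    case True
    then have "F f = F (\<lambda>z. 0)" using f B by (intro cong) auto
    then show ?thesis using True by (simp add: const)
  next
    case False
    then have "nrm A (F (\<lambda>z. of_real (1/B) * f z)) \<le> 1"
      using B B0 by (intro * continuous_intros f) (simp add: norm_divide norm_mult divide_le_eq_1)
    moreover have "F (\<lambda>z. of_real (1/B) * f z) = of_real (1/B) \<odot> F f" using f by (rule scale)
    ultimately have "cmod (of_real (1/B)) * nrm A (F f) \<le> 1"
      using nrm_smult[OF closed[OF f], of "of_real (1/B)"] by simp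
    then show ?thesis using False B0 by (simp add: norm_divide field_simps)
  qed
qed

lemma rotate:
  assumes c: "cmod c = 1"
  shows "circle_calculus A (\<lambda>f. F (\<lambda>z. f (c * z)))"
proof -
  have *: "ccont (\<lambda>z. f (c * z))" if "ccont f" for f :: "complex \<Rightarrow> complex"
    using c by (intro continuous_on_compose2[OF that, of circle "\<lambda>z. c * z"])
      (auto simp: norm_mult intro!: continuous_intros)
  show ?thesis
  proof
    fix f g :: "complex \<Rightarrow> complex" assume "ccont f" "ccont g"
      "\<And>z. z \<in> circle \<Longrightarrow> f z = g z"
    then show "F (\<lambda>z. f (c * z)) = F (\<lambda>z. g (c * z))"
      using c by (intro cong *) (simp_all add: norm_mult)
  next
    fix f :: "complex \<Rightarrow> complex" and d assume "ccont f"
    then show "F (\<lambda>z. d * f (c * z)) = d \<odot> F (\<lambda>z. f (c * z))" by (intro scale *)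
  qed (rule one | (rule closed add mult cnj; rule *; assumption))+
qed

lemma unitary_identity:
  "F (\<lambda>z. z) \<otimes> F cnj = \<one>" "F cnj \<otimes> F (\<lambda>z. z) = \<one>"
proof -
  have c: "ccont cnj" "ccont (\<lambda>z. z)" by (intro continuous_intros)+
  have e: "z * cnj z = 1" if "z \<in> circle" for z
    using that by (simp add: complex_norm_square[symmetric])
  have "F (\<lambda>z. z * cnj z) = F (\<lambda>z. 1)" "F (\<lambda>z. cnj z * z) = F (\<lambda>z. 1)"
    using e by (intro cong continuous_intros; simp add: mult.commute)+
  then show "F (\<lambda>z. z) \<otimes> F cnj = \<one>" "F cnj \<otimes> F (\<lambda>z. z) = \<one>"
    using mult[OF c] mult[OF c(2,1)] by (simp_all add: one)
qed

end

lemma star_hom_circle_calculus: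
  assumes A: "unital_cstar_algebra A" and \<Phi>: "\<Phi> \<in> star_hom (C_alg circle) A"
  shows "circle_calculus A (\<lambda>f. \<Phi> (restrict f circle))"
proof -
  interpret unital_cstar_algebra A by fact
  let ?r = "\<lambda>f::complex \<Rightarrow> complex. restrict f circle"
  have r: "?r f \<in> carrier (C_alg circle)" if "ccont f" for f
  proof -
    have "ccont (?r f) \<longleftrightarrow> ccont f" by (rule continuous_on_cong) auto
    then show ?thesis using that by (simp add: C_alg_def)
  qed
  have hom: "\<Phi> \<in> ring_hom (C_alg circle) A" and
    star: "\<And>a. a \<in> carrier (C_alg circle) \<Longrightarrow> \<Phi> (adj (C_alg circle) a) = adj A (\<Phi> a)"
    "\<And>a c. a \<in> carrier (C_alg circle) \<Longrightarrow> \<Phi> (c \<odot>\<^bsub>C_alg circle\<^esub> a) = c \<odot>\<^bsub>A\<^esub> \<Phi> a"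
    using \<Phi> by (auto simp: star_hom_def)
  show ?thesis
  proof
    fix f g :: "complex \<Rightarrow> complex" and c assume f: "ccont f"
    show "\<Phi> (?r f) \<in> carrier A" using ring_hom_closed[OF hom r[OF f]] .
    have "?r (\<lambda>z. c * f z) = c \<odot>\<^bsub>C_alg circle\<^esub> ?r f" by (simp add: C_alg_def restrict_def fun_eq_iff)
    then show "\<Phi> (?r (\<lambda>z. c * f z)) = c \<odot>\<^bsub>A\<^esub> \<Phi> (?r f)" using star(2)[OF r[OF f]] by simp
    have "?r (\<lambda>z. cnj (f z)) = adj (C_alg circle) (?r f)" by (simp add: C_alg_def restrict_def fun_eq_iff)
    then show "\<Phi> (?r (\<lambda>z. cnj (f z))) = adj A (\<Phi> (?r f))" using star(1)[OF r[OF f]] by simp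
    assume g: "ccont g"
    have "?r (\<lambda>z. f z + g z) = ?r f \<oplus>\<^bsub>C_alg circle\<^esub> ?r g" by (simp add: C_alg_def restrict_def fun_eq_iff)
    then show "\<Phi> (?r (\<lambda>z. f z + g z)) = \<Phi> (?r f) \<oplus>\<^bsub>A\<^esub> \<Phi> (?r g)"
      using ring_hom_add[OF hom r[OF f] r[OF g]] by simp
    have "?r (\<lambda>z. f z * g z) = ?r f \<otimes>\<^bsub>C_alg circle\<^esub> ?r g" by (simp add: C_alg_def restrict_def fun_eq_iff)
    then show "\<Phi> (?r (\<lambda>z. f z * g z)) = \<Phi> (?r f) \<otimes>\<^bsub>A\<^esub> \<Phi> (?r g)"
      using ring_hom_mult[OF hom r[OF f] r[OF g]] by simp
    assume "\<And>z. z \<in> circle \<Longrightarrow> f z = g z"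
    then have "?r f = ?r g" by auto
    then show "\<Phi> (?r f) = \<Phi> (?r g)" by (rule arg_cong)
  next
    have "?r (\<lambda>z. 1) = \<one>\<^bsub>C_alg circle\<^esub>" by (simp add: C_alg_def)
    then show "\<Phi> (?r (\<lambda>z. 1)) = \<one>\<^bsub>A\<^esub>" using ring_hom_one[OF hom] by simp
  qed
qed

lemma circle_calculus_hom:
  assumes "circle_calculus A F" and B: "unital_cstar_algebra B" and h: "h \<in> star_hom A B"
  shows "circle_calculus B (\<lambda>f. h (F f))"
proof -
  interpret F: circle_calculus A F by fact
  interpret B: unital_cstar_algebra B by fact
  have hom: "h \<in> ring_hom A B" and
    star: "\<And>a. a \<in> carrier A \<Longrightarrow> h (adj A a) = adj B (h a)"
    "\<And>a c. a \<in> carrier A \<Longrightarrow> h (c \<odot>\<^bsub>A\<^esub> a) = c \<odot>\<^bsub>B\<^esub> h a"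
    using h by (auto simp: star_hom_def)
  show ?thesis
  proof
    fix f g :: "complex \<Rightarrow> complex" assume "ccont f" "ccont g"
      "\<And>z. z \<in> circle \<Longrightarrow> f z = g z"
    then show "h (F f) = h (F g)" using F.cong[of f g] by simp
  next
    fix f :: "complex \<Rightarrow> complex" and c assume "ccont f"
    then show "h (F (\<lambda>z. c * f z)) = c \<odot>\<^bsub>B\<^esub> h (F f)" by (simp only: F.scale star F.closed)
  qed (simp_all add: F.closed ring_hom_closed[OF hom] F.one ring_hom_one[OF hom] F.add F.mult
      ring_hom_add[OF hom] ring_hom_mult[OF hom] F.cnj star)
qed

text \<open>By Stone-Weierstrass the coordinate function decides everything. Its conjugate is
  covered because both images of the coordinate are unitary, with inverses \<open>F cnj\<close> and
  \<open>G cnj\<close>, so the intertwining relation can be multiplied by these inverses from both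
  sides.\<close>

lemma calculus_intertwine:
  fixes A (structure)
  assumes "circle_calculus A F" "circle_calculus A G" and x: "x \<in> carrier A"
    and id: "x \<otimes> F (\<lambda>z. z) = G (\<lambda>z. z) \<otimes> x"
    and f: "ccont f"
  shows "x \<otimes> F f = G f \<otimes> x"
proof -
  interpret F: circle_calculus A F by fact
  interpret G: circle_calculus A G by fact
  note S = F.ring_simps
  have c: "ccont cnj" "ccont (\<lambda>z::complex. z)" by (intro continuous_intros)+
  show ?thesis
    using f
  proof (induction rule: circle_induct)
    case (const c)
    show ?case using x by (simp add: F.const G.const F.smult_mult_left F.smult_mult_right S)
  next
    case id show ?case by (rule assms(4))
  next
    case cnj
    note m = F.closed[OF c(1)] F.closed[OF c(2)] G.closed[OF c(1)] G.closed[OF c(2)] x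
    have "G cnj \<otimes> x = G cnj \<otimes> (x \<otimes> (F (\<lambda>z. z) \<otimes> F cnj))"
      using m by (simp add: F.unitary_identity)
    also have "\<dots> = G cnj \<otimes> ((x \<otimes> F (\<lambda>z. z)) \<otimes> F cnj)" using m by (simp add: S)
    also have "\<dots> = (G cnj \<otimes> G (\<lambda>z. z)) \<otimes> (x \<otimes> F cnj)"
      unfolding assms(4) using m by (simp add: S)
    finally show ?case using m by (simp add: G.unitary_identity)
  next
    case (add f g)
    then show ?case using x by (simp add: F.add G.add F.closed G.closed S)
  next
    case (mult f g)
    then have m: "F f \<in> carrier A" "F g \<in> carrier A" "G f \<in> carrier A" "G g \<in> carrier A"
      by (simp_all add: F.closed G.closed)
    have "x \<otimes> (F f \<otimes> F g) = (x \<otimes> F f) \<otimes> F g" using m x by (simp add: S)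
    also have "\<dots> = G f \<otimes> (x \<otimes> F g)" unfolding mult(3) using m x by (simp add: S)
    also have "\<dots> = (G f \<otimes> G g) \<otimes> x" unfolding mult(4) using m x by (simp add: S)
    finally show ?case using mult by (simp add: F.mult G.mult)
  next
    case (limit f)
    have Ff: "F f \<in> carrier A" and Gf: "G f \<in> carrier A" using limit by (simp_all add: F.closed G.closed)
    show ?case
    proof (rule F.eq_if_close)
      fix e :: real assume e: "0 < e"
      \<comment> \<open>Replacing f by g costs at most d times the norm of x on either side; the
        extra 1 keeps the denominator positive.\<close>
      define d where "d = e / (2 * nrm A x + 1)"
      have n: "0 \<le> nrm A x" using x by (rule F.nrm_nonneg)
      then have d: "0 < d" using e by (simp add: d_def)
      then obtain g where g: "ccont g" "x \<otimes> F g = G g \<otimes> x"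
        "\<forall>z\<in>circle. cmod (f z - g z) < d"
        using limit(2)[OF d] by blast
      have Fg: "F g \<in> carrier A" and Gg: "G g \<in> carrier A" using g by (simp_all add: F.closed G.closed)
      have D1: "F f \<ominus> F g \<in> carrier A" and D2: "G g \<ominus> G f \<in> carrier A"
        using Ff Fg Gf Gg by simp_all
      have "nrm A (F f \<ominus> F g) \<le> d"
        using F.contractive[of "\<lambda>z. f z - g z" d] F.diff[OF limit(1) g(1)] limit(1) g
        by (simp add: continuous_on_diff less_imp_le)
      then have 1: "nrm A (x \<otimes> F f \<ominus> x \<otimes> F g) \<le> nrm A x * d"
        using F.nrm_mult[OF x D1] mult_left_mono[OF _ n, of "nrm A (F f \<ominus> F g)" d]
        unfolding F.diff_distrib_left[OF x Ff Fg, symmetric] by linarith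
      have "nrm A (G g \<ominus> G f) \<le> d"
        using G.contractive[of "\<lambda>z. g z - f z" d] G.diff[OF g(1) limit(1)] limit(1) g
        by (simp add: continuous_on_diff less_imp_le norm_minus_commute)
      then have 2: "nrm A (G g \<otimes> x \<ominus> G f \<otimes> x) \<le> d * nrm A x"
        using F.nrm_mult[OF D2 x] mult_right_mono[OF _ n, of "nrm A (G g \<ominus> G f)" d]
        unfolding F.diff_distrib_right[OF x Gg Gf, symmetric] by linarith
      have "nrm A (x \<otimes> F f \<ominus> G f \<otimes> x) \<le> nrm A x * d + d * nrm A x"
        using F.nrm_diff_triangle[of "x \<otimes> F f" "x \<otimes> F g" "G f \<otimes> x"] 1 2 g(2) x Ff Gf Fg Gg
        by (simp add: mult.commute)
      also have "nrm A x * d + d * nrm A x = e - d"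
      proof -
        have "d * (2 * nrm A x + 1) = e" using n by (simp add: d_def)
        then show ?thesis by (simp add: algebra_simps)
      qed
      also have "e - d \<le> e" using d by simp
      finally show "nrm A (x \<otimes> F f \<ominus> G f \<otimes> x) \<le> e" .
    qed (use x Ff Gf in simp_all)
  qed
qed

text \<open>The intertwining lemma with the unit as intertwiner.\<close>

lemma calculus_unique:
  fixes A (structure)
  assumes "circle_calculus A F" "circle_calculus A G" "F (\<lambda>z. z) = G (\<lambda>z. z)" "ccont f"
  shows "F f = G f"
proof -
  interpret F: circle_calculus A F by fact
  interpret G: circle_calculus A G by fact
  have "ccont (\<lambda>z::complex. z)" by (intro continuous_intros)
  then have "\<one> \<otimes> F f = G f \<otimes> \<one>"
    by (intro calculus_intertwine[OF assms(1,2) _ _ assms(4)]) (simp_all add: assms(3) G.closed)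
  then show ?thesis using assms by (simp add: F.closed G.closed)
qed

section \<open>Representations on the sequence space\<close>

lemma star_hom_diff:
  assumes "unital_cstar_algebra A" "unital_cstar_algebra B" "h \<in> star_hom A B"
    and a: "a \<in> carrier A" and b: "b \<in> carrier A"
  shows "h (a \<ominus>\<^bsub>A\<^esub> b) = h a \<ominus>\<^bsub>B\<^esub> h b"
proof -
  interpret A: unital_cstar_algebra A by fact
  interpret B: unital_cstar_algebra B by fact
  have hom: "h \<in> ring_hom A B" using assms(3) by (simp add: star_hom_def)
  have "a = (a \<ominus>\<^bsub>A\<^esub> b) \<oplus>\<^bsub>A\<^esub> b" using a b by (simp add: A.ring_simps)
  then have "h a = h (a \<ominus>\<^bsub>A\<^esub> b) \<oplus>\<^bsub>B\<^esub> h b"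
    using ring_hom_add[OF hom, of "a \<ominus>\<^bsub>A\<^esub> b" b] a b by simp
  then show ?thesis
    using B.add_diff_cancel[of "h a" "h (a \<ominus>\<^bsub>A\<^esub> b)" "h b"] a b by (simp add: ring_hom_closed[OF hom])
qed

lemma star_hom_Units:
  assumes "h \<in> star_hom A B" "u \<in> Units A" shows "h u \<in> Units B"
proof -
  have hom: "h \<in> ring_hom A B" using assms(1) by (simp add: star_hom_def)
  obtain v where v: "u \<in> carrier A" "v \<in> carrier A" "v \<otimes>\<^bsub>A\<^esub> u = \<one>\<^bsub>A\<^esub>" "u \<otimes>\<^bsub>A\<^esub> v = \<one>\<^bsub>A\<^esub>"
    using assms(2) by (auto simp: Units_def)
  then have "h v \<otimes>\<^bsub>B\<^esub> h u = \<one>\<^bsub>B\<^esub>" "h u \<otimes>\<^bsub>B\<^esub> h v = \<one>\<^bsub>B\<^esub>"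
    by (simp_all add: ring_hom_mult[OF hom, symmetric] ring_hom_one[OF hom])
  then show ?thesis using v by (auto simp: Units_def ring_hom_closed[OF hom])
qed

text \<open>Homomorphisms preserve invertibility, hence can only shrink spectra. This is used both
  to bound norms of images and to bound the spectrum of \<open>w\<close> from below.\<close>

lemma star_hom_spectral:
  assumes "unital_cstar_algebra A" "unital_cstar_algebra B" "h \<in> star_hom A B"
    and a: "a \<in> carrier A" and u: "c \<odot>\<^bsub>A\<^esub> \<one>\<^bsub>A\<^esub> \<ominus>\<^bsub>A\<^esub> a \<in> Units A"
  shows "c \<odot>\<^bsub>B\<^esub> \<one>\<^bsub>B\<^esub> \<ominus>\<^bsub>B\<^esub> h a \<in> Units B"
proof -
  interpret A: unital_cstar_algebra A by fact
  have "h (c \<odot>\<^bsub>A\<^esub> \<one>\<^bsub>A\<^esub> \<ominus>\<^bsub>A\<^esub> a) = h (c \<odot>\<^bsub>A\<^esub> \<one>\<^bsub>A\<^esub>) \<ominus>\<^bsub>B\<^esub> h a"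
    using a by (intro star_hom_diff assms) simp
  also have "h (c \<odot>\<^bsub>A\<^esub> \<one>\<^bsub>A\<^esub>) = c \<odot>\<^bsub>B\<^esub> \<one>\<^bsub>B\<^esub>"
    using assms(3) ring_hom_one[of h A B] by (simp add: star_hom_def)
  finally show ?thesis using star_hom_Units[OF assms(3) u] by simp
qed

lemma BH_Units:
  assumes "emb T \<in> Units BH"
  obtains R where "R \<in> operators" "R o\<^sub>L T = id_blinfun"
  using assms by (auto simp: Units_def inj_eq[OF inj_emb])

lemma cscale_of_real: "cscale (of_real r) v = r *\<^sub>R v"
  by (rule ell2_eqI) (simp add: coord_wshift scaleR_ell2.rep_eq scaleR_conv_of_real)

text \<open>If \<open>M = \<parallel>h a\<parallel> > \<parallel>a\<parallel>\<close>, then \<open>M\<^sup>2 - a\<^sup>* a\<close> is invertible, whereas vectors at which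
  \<open>h a\<close> almost attains its norm are approximate eigenvectors of \<open>(h a)\<^sup>* h a\<close> for \<open>M\<^sup>2\<close>.\<close>

lemma rep_contractive:
  assumes A: "unital_cstar_algebra A" and h: "h \<in> star_hom A BH" and a: "a \<in> carrier A"
  shows "norm (prj (h a)) \<le> nrm A a"
proof (rule ccontr)
  interpret A: unital_cstar_algebra A by fact
  have hom: "h \<in> ring_hom A BH" using h by (simp add: star_hom_def)
  obtain T where T: "h a = emb T" "T \<in> operators" using ring_hom_closed[OF hom a] by auto
  define S where "S = op_adjoint T"
  have S: "adjoint_of T S" "S \<in> operators"
    using T by (simp_all add: S_def adjoint_of_adjoint operators_adjoint)
  define M where "M = norm T"
  assume "\<not> norm (prj (h a)) \<le> nrm A a"
  then have M: "nrm A a < M" by (simp add: T M_def)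
  then have M0: "0 < M" using A.nrm_nonneg[OF a] by simp
  let ?b = "adj A a \<otimes>\<^bsub>A\<^esub> a"
  have b: "?b \<in> carrier A" using a by (simp add: A.adj_closed)
  have hb: "h ?b = emb (S o\<^sub>L T)"
    using ring_hom_mult[OF hom A.adj_closed[OF a] a] h a by (simp add: star_hom_def T S_def)
  have "nrm A ?b < cmod (of_real (M\<^sup>2))"
    using M A.nrm_nonneg[OF a] a by (simp add: A.cstar_identity norm_power power_strict_mono)
  then have "of_real (M\<^sup>2) \<odot>\<^bsub>BH\<^esub> \<one>\<^bsub>BH\<^esub> \<ominus>\<^bsub>BH\<^esub> h ?b \<in> Units BH"
    by (intro star_hom_spectral[OF A cstar_BH h b] A.sc_diff_Units b)
  then have "emb (cscale (of_real (M\<^sup>2)) - (S o\<^sub>L T)) \<in> Units BH"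
    using S T by (simp add: hb BH_minus wshift_operators operators_compose)
  then obtain R where R: "R o\<^sub>L (cscale (of_real (M\<^sup>2)) - (S o\<^sub>L T)) = id_blinfun"
    using BH_Units by metis
  \<comment> \<open>With D as below, the left inverse R gives |v|^2 \<le> |R|^2 |y|^2 \<le> |R|^2
    M^2 D. The added 1 makes K positive, so that the resulting |v|^2 \<le> K D can be divided by
    K.\<close>
  define K where "K = (norm R)\<^sup>2 * M\<^sup>2 + 1"
  have K: "0 < K" by (simp add: K_def add_nonneg_pos)
  define q where "q = M\<^sup>2 - 1 / K"
  have bound: "(norm (T v))\<^sup>2 \<le> q * (norm v)\<^sup>2" for v
  proof -
    define y where "y = M\<^sup>2 *\<^sub>R v - S (T v)"
    define D where "D = M\<^sup>2 * (norm v)\<^sup>2 - (norm (T v))\<^sup>2"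
    have Tv: "norm (T v) \<le> M * norm v" unfolding M_def by (rule norm_blinfun)
    have D: "0 \<le> D" using power_mono[OF Tv, of 2] by (simp add: D_def power_mult_distrib)
    have "R y = (R o\<^sub>L (cscale (of_real (M\<^sup>2)) - (S o\<^sub>L T))) v"
      by (simp add: y_def blinfun.diff_left cscale_of_real del: of_real_power)
    then have "v = R y" by (simp only: R blinfun_apply_id_blinfun)
    then have 1: "(norm v)\<^sup>2 \<le> (norm R)\<^sup>2 * (norm y)\<^sup>2"
      using power_mono[OF norm_blinfun[of R y], of 2] by (simp add: power_mult_distrib)
    have "norm (S (T v)) \<le> M * norm (T v)"
      using norm_blinfun[of S "T v"] norm_adjoint_of[OF S(1)] mult_right_mono[of "norm S" M "norm (T v)"]
      by (simp add: M_def)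
    then have 2: "(norm (S (T v)))\<^sup>2 \<le> M\<^sup>2 * (norm (T v))\<^sup>2"
      using power_mono[of _ _ 2] by (fastforce simp: power_mult_distrib)
    have "v \<bullet> S (T v) = (norm (T v))\<^sup>2"
      using S(1) by (simp add: adjoint_of_def power2_norm_eq_inner)
    then have "(norm y)\<^sup>2 = (M\<^sup>2)\<^sup>2 * (norm v)\<^sup>2 - 2 * M\<^sup>2 * (norm (T v))\<^sup>2 + (norm (S (T v)))\<^sup>2"
      unfolding y_def power2_norm_eq_inner
      by (simp add: inner_diff_left inner_diff_right inner_commute algebra_simps power2_eq_square)
    then have "(norm y)\<^sup>2 \<le> M\<^sup>2 * D" using 2 by (simp add: D_def algebra_simps power2_eq_square)
    then have "(norm R)\<^sup>2 * (norm y)\<^sup>2 \<le> (norm R)\<^sup>2 * (M\<^sup>2 * D)" by (intro mult_left_mono) auto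
    then have "(norm v)\<^sup>2 \<le> K * D" using 1 D by (simp add: K_def algebra_simps)
    then have "(norm v)\<^sup>2 / K \<le> D" using K by (simp add: pos_divide_le_eq mult.commute)
    then show ?thesis by (simp add: q_def D_def left_diff_distrib)
  qed
  have "M \<le> sqrt (max 0 q)"
    unfolding M_def
  proof (rule norm_blinfun_bound)
    fix v :: ell2
    have "q * (norm v)\<^sup>2 \<le> max 0 q * (norm v)\<^sup>2" by (intro mult_right_mono) auto
    then have "(norm (T v))\<^sup>2 \<le> (sqrt (max 0 q) * norm v)\<^sup>2"
      using bound[of v] by (simp add: power_mult_distrib)
    then show "norm (T v) \<le> sqrt (max 0 q) * norm v" by (rule power2_le_imp_le) simp
  qed simp
  then have "M\<^sup>2 \<le> max 0 q" using M0 by (metis less_imp_le max.cobounded1 power_mono real_sqrt_pow2)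
  moreover have "q < M\<^sup>2" using K by (simp add: q_def)
  ultimately show False using M0 by (simp add: max_def split: if_splits)
qed

lift_definition ket :: "int \<Rightarrow> ell2" is "\<lambda>n m. if m = n then 1 else 0"
proof -
  fix n :: int
  have "(\<lambda>m. (cmod (if m = n then 1 else 0))\<^sup>2) summable_on {n}" by simp
  then show "(\<lambda>m. (cmod (if m = n then 1 else 0))\<^sup>2) summable_on UNIV"
    by (rule summable_on_cong_neutral[THEN iffD1, rotated -1]) auto
qed

lemma norm_ket [simp]: "norm (ket n) = 1"
proof -
  have "(norm (ket n))\<^sup>2 = (\<Sum>\<^sub>\<infinity>m\<in>{n}. (cmod (coord (ket n) m))\<^sup>2)"
    unfolding norm_ell2_sq by (rule infsum_cong_neutral) (auto simp: ket.rep_eq)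
  then show ?thesis by (simp add: ket.rep_eq power2_eq_1_iff) (smt (verit) norm_ge_zero)
qed

lemma norm_coord_apply_le:
  fixes T :: "ell2 \<Rightarrow>\<^sub>L ell2"
  shows "cmod (coord (T (ket k)) n) \<le> norm T"
  using norm_coord_le[of "T (ket k)" n] norm_blinfun[of T "ket k"] by simp

text \<open>The basis vector \<open>ket n\<close> is an eigenvector for \<open>d n\<close>, so the
  difference has no left inverse.\<close>

lemma cspectrum_diagonal:
  assumes "bounded (range d)"
  shows "d n \<in> cspectrum BH (emb (wshift d 0))"
proof (rule ccontr)
  assume "d n \<notin> cspectrum BH (emb (wshift d 0))"
  then have "emb (cscale (d n) - wshift d 0) \<in> Units BH"
    by (simp add: cspectrum_def BH_minus wshift_operators wshift_operators assms)
  then obtain R where "R o\<^sub>L (cscale (d n) - wshift d 0) = id_blinfun" using BH_Units by metis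
  then have "R ((cscale (d n) - wshift d 0) (ket n)) = ket n"
    by (metis blinfun_apply_blinfun_compose blinfun_apply_id_blinfun)
  moreover have "(cscale (d n) - wshift d 0) (ket n) = 0"
    by (rule ell2_eqI)
      (simp add: blinfun.diff_left minus_ell2.rep_eq coord_wshift assms ket.rep_eq zero_ell2.rep_eq)
  ultimately have "ket n = 0" by simp
  then show False using norm_ket[of n] by simp
qed

lemma diagonal_star_hom:
  assumes K: "compact K" and d: "range d \<subseteq> K"
  shows "(\<lambda>f. emb (wshift (\<lambda>n. f (d n)) 0)) \<in> star_hom (C_alg K) BH"
proof -
  have b: "bounded (range (\<lambda>n. f (d n)))" if "continuous_on K f" for f :: "complex \<Rightarrow> complex"
  proof -
    have "bounded (f ` K)" using K that by (simp add: compact_continuous_image compact_imp_bounded)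
    then show ?thesis by (rule bounded_subset) (use d in auto)
  qed
  have dK: "d n \<in> K" for n using d by auto
  have adj: "op_adjoint (wshift (\<lambda>n. f (d n)) 0) = wshift (\<lambda>n. cnj (f (d n))) 0"
    if "continuous_on K f" for f :: "complex \<Rightarrow> complex"
    using adjoint_of_wshift[OF b[OF that], of 0] by (intro adjoint_eq) simp
  show ?thesis
    unfolding star_hom_def
    by (auto simp: ring_hom_def C_alg_def dK wshift_operators b wshift_compose wshift_add wshift_one adj)
qed

text \<open>\<open>has_cfc\<close> asks for a calculus on the actual spectrum. That set is closed
  inside the circle, hence compact, which keeps the diagonals bounded, and it contains every
  \<open>d n\<close>, so restricting f to it leaves the diagonal entries unchanged.\<close>

lemma diagonal_cfc:
  assumes d: "\<And>n. d n \<in> circle" and f: "ccont f"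
  shows "has_cfc BH (emb (wshift d 0)) f (emb (wshift (\<lambda>n. f (d n)) 0))"
proof -
  interpret BH: unital_cstar_algebra BH by (rule cstar_BH)
  let ?u = "emb (wshift d 0)" and ?K = "cspectrum BH (emb (wshift d 0))"
  have b: "bounded (range d)" using d by (auto simp: bounded_iff intro!: exI[of _ 1])
  have b': "bounded (range (\<lambda>n. cnj (d n)))" using b by (auto simp: bounded_iff)
  have u: "?u \<in> carrier BH" by (simp add: wshift_operators b)
  have "op_adjoint (wshift d 0) = wshift (\<lambda>n. cnj (d n)) 0"
    using adjoint_of_wshift[OF b, of 0] by (intro adjoint_eq) simp
  moreover have "d n * cnj (d n) = 1" for n
    using d[of n] by (simp add: complex_norm_square[symmetric])
  ultimately have "?K \<subseteq> circle"
    using b b' by (intro BH.cspectrum_unitary u) (simp_all add: wshift_compose wshift_one mult.commute)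
  moreover have "closed ?K" using u by (rule BH.closed_cspectrum)
  ultimately have K: "compact ?K" using closed_Int_compact[of ?K circle] by (simp add: Int_absorb2)
  have dK: "d n \<in> ?K" for n using b by (rule cspectrum_diagonal)
  have "(\<lambda>f. emb (wshift (\<lambda>n. f (d n)) 0)) \<in> star_hom (C_alg ?K) BH"
    using dK by (intro diagonal_star_hom K) auto
  then show ?thesis
    unfolding has_cfc_def by (rule bexI[rotated]) (simp add: dK)
qed

section \<open>The algebra of an irrational rotation\<close>

lemma rot_unit_norm [simp]: "cmod (rot_unit \<theta>) = 1"
  by (simp add: rot_unit_def mult.commute[of _ \<i>] mult.assoc)

lemma rot_unit_powi_eq_1:
  assumes "\<theta> \<notin> \<rat>"
  shows "rot_unit \<theta> powi n = 1 \<longleftrightarrow> n = 0"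
proof
  assume "rot_unit \<theta> powi n = 1"
  then have "exp (of_int n * (2 * of_real pi * \<i> * of_real \<theta>)) = 1"
    by (simp add: rot_unit_def exp_power_int)
  then obtain k :: int where "real_of_int n * (2 * pi * \<theta>) = of_int (2 * k) * pi"
    by (auto simp: exp_eq_1 algebra_simps)
  then have k: "real_of_int n * \<theta> = of_int k" by simp
  show "n = 0"
  proof (rule ccontr)
    assume "n \<noteq> 0"
    then have "\<theta> = of_int k / of_int n" using k by (simp add: field_simps)
    then show False using assms by simp
  qed
qed simp

locale rotation_algebra =
  fixes \<theta> :: real and \<gamma> :: "complex \<Rightarrow> real" and A :: "'a normed_star_alg" (structure) and x w :: 'a
  assumes irrational: "\<theta> \<notin> \<rat>"
    and cont_\<gamma>: "ccont \<gamma>"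
    and \<gamma>_nonneg: "\<And>z. z \<in> circle \<Longrightarrow> 0 \<le> \<gamma> z"
    and is_A: "is_A \<theta> \<gamma> A x w"

sublocale rotation_algebra \<subseteq> unital_cstar_algebra A
  using is_A by (simp add: is_A_def)

context rotation_algebra
begin

abbreviation lam :: complex where "lam \<equiv> rot_unit \<theta>"

definition rot :: "int \<Rightarrow> (complex \<Rightarrow> complex) \<Rightarrow> complex \<Rightarrow> complex" where
  "rot n f z = f (lam powi n * z)"

lemma lam_nonzero [simp]: "lam \<noteq> 0"
  using rot_unit_norm[of \<theta>] by (metis norm_zero zero_neq_one)

lemma norm_lam_powi [simp]: "cmod (lam powi n) = 1"
  by (simp add: norm_power_int)

lemma rot_rot: "rot m (rot n f) = rot (n + m) f"
  by (simp add: fun_eq_iff rot_def power_int_add mult.assoc)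

lemma rot_0 [simp]: "rot 0 f = f"
  by (simp add: fun_eq_iff rot_def)

lemma continuous_rot: "ccont f \<Longrightarrow> ccont (rot n f)"
  unfolding rot_def[abs_def] by (rule continuous_on_compose2[of circle f]) (auto simp: norm_mult intro!: continuous_intros)

lemma relations: "A_relations \<theta> \<gamma> A x w"
  using is_A by (simp add: is_A_def)

lemma x_closed [simp]: "x \<in> carrier A" and w_closed [simp]: "w \<in> carrier A"
  and unitary_w: "adj A w \<otimes> w = \<one>" "w \<otimes> adj A w = \<one>"
  and xw: "x \<otimes> w = inverse lam \<odot> (w \<otimes> x)"
  using relations by (simp_all add: A_relations_def)

lemma adj_x_closed [simp]: "adj A x \<in> carrier A"
  by (simp add: adj_closed)

abbreviation weight :: "complex \<Rightarrow> complex" where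
  "weight \<equiv> (\<lambda>z. of_real (\<gamma> z))"

lemma continuous_weight: "ccont weight"
  using cont_\<gamma> by (intro continuous_intros)

subsection \<open>Concrete representations\<close>

definition W_rep :: "complex \<Rightarrow> ell2 \<Rightarrow>\<^sub>L ell2" where
  "W_rep z = wshift (\<lambda>n. z * lam powi n) 0"

text \<open>The basis vector with index n goes to the one with index n + 1 with weight the root of
  \<gamma> at \<open>z * lam powi n\<close>. The n - 1 appears because \<open>wshift\<close> indexes
  its weights by the target.\<close>

definition X_rep :: "complex \<Rightarrow> ell2 \<Rightarrow>\<^sub>L ell2" where
  "X_rep z = wshift (\<lambda>n. of_real (sqrt (\<gamma> (z * lam powi (n - 1))))) 1"

lemma orbit_circle: "z \<in> circle \<Longrightarrow> z * lam powi n \<in> circle"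
  by (simp add: norm_mult)

lemma bounded_orbit: "z \<in> circle \<Longrightarrow> bounded (range (\<lambda>n. z * lam powi n))"
  by (auto simp: bounded_iff norm_mult intro!: exI[of _ 1])

lemma bounded_orbit_values:
  fixes f :: "complex \<Rightarrow> complex"
  assumes z: "z \<in> circle" and f: "ccont f"
  shows "bounded (range (\<lambda>n. f (z * lam powi n)))"
proof -
  obtain M where "\<forall>z\<in>circle. cmod (f z) \<le> M" using circle_bounded[OF f] by metis
  then show ?thesis using orbit_circle[OF z] unfolding bounded_iff by blast
qed

lemma bounded_weight:
  assumes "z \<in> circle"
  shows "bounded (range (\<lambda>n. complex_of_real (sqrt (\<gamma> (z * lam powi (n - 1))))))"
proof -
  have "ccont (\<lambda>z. complex_of_real (sqrt (\<gamma> z)))" using cont_\<gamma> by (intro continuous_intros)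
  from bounded_orbit_values[OF assms this] show ?thesis by (rule bounded_subset) blast
qed

text \<open>Both products of the shift with its adjoint are diagonal: one carries \<gamma> along the
  orbit of z, the other the same values displaced by one step, which is \<gamma> applied to the
  diagonal of \<open>inverse lam\<close> times \<open>w\<close>.\<close>

lemma relations_rep:
  assumes z: "z \<in> circle"
  shows "A_relations \<theta> \<gamma> BH (emb (X_rep z)) (emb (W_rep z))"
proof -
  let ?s = "\<lambda>n. complex_of_real (sqrt (\<gamma> (z * lam powi (n - 1))))"
  have b: "bounded (range ?s)" and bw: "bounded (range (\<lambda>n. z * lam powi n))"
    using bounded_weight[OF z] bounded_orbit[OF z] .
  have b': "bounded (range (\<lambda>n. ?s (n + 1)))" by (rule bounded_subset[OF b]) blast
  have bw': "bounded (range (\<lambda>n. cnj (z * lam powi n)))" using bw by (auto simp: bounded_iff simp del: complex_cnj_mult)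
  have adjX: "op_adjoint (X_rep z) = wshift (\<lambda>n. ?s (n + 1)) (-1)"
    using adjoint_of_wshift[OF b, of 1] by (intro adjoint_eq) (simp add: X_rep_def)
  have adjW: "op_adjoint (W_rep z) = wshift (\<lambda>n. cnj (z * lam powi n)) 0"
    using adjoint_of_wshift[OF bw, of 0] by (intro adjoint_eq) (simp add: W_rep_def)
  have sq: "?s n * ?s n = of_real (\<gamma> (z * lam powi (n - 1)))" for n
    using \<gamma>_nonneg[OF orbit_circle[OF z]] by (simp flip: of_real_mult)
  have u: "(z * lam powi n) * cnj (z * lam powi n) = 1" for n
    using orbit_circle[OF z, of n] by (simp add: complex_norm_square[symmetric] del: complex_cnj_mult)
  have 1: "has_cfc BH (emb (W_rep z)) weight (emb (op_adjoint (X_rep z) o\<^sub>L X_rep z))"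
  proof -
    have "op_adjoint (X_rep z) o\<^sub>L X_rep z = wshift (\<lambda>n. of_real (\<gamma> (z * lam powi n))) 0"
      unfolding adjX unfolding X_rep_def using b b' sq[of "_ + 1"] by (simp add: wshift_compose)
    then show ?thesis
      using diagonal_cfc[OF orbit_circle[OF z] continuous_weight] by (simp add: W_rep_def)
  qed
  have 2: "has_cfc BH (emb (cscale (inverse lam) o\<^sub>L W_rep z)) weight (emb (X_rep z o\<^sub>L op_adjoint (X_rep z)))"
  proof -
    have e: "inverse lam * (z * lam powi n) = z * lam powi (n - 1)" for n
      by (simp add: power_int_diff field_simps)
    have "X_rep z o\<^sub>L op_adjoint (X_rep z) = wshift (\<lambda>n. of_real (\<gamma> (z * lam powi (n - 1)))) 0"
      unfolding adjX unfolding X_rep_def using b b' sq by (simp add: wshift_compose)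
    moreover have "cscale (inverse lam) o\<^sub>L W_rep z = wshift (\<lambda>n. z * lam powi (n - 1)) 0"
      unfolding W_rep_def using bw by (simp add: wshift_compose e)
    ultimately show ?thesis
      using diagonal_cfc[OF orbit_circle[OF z, of "_ - 1"] continuous_weight] by simp
  qed
  have 3: "X_rep z o\<^sub>L W_rep z = cscale (inverse lam) o\<^sub>L (W_rep z o\<^sub>L X_rep z)"
    unfolding W_rep_def X_rep_def using b bw bounded_range_mult[OF bw b, of 0]
    by (simp add: wshift_compose power_int_diff field_simps)
  have 4: "op_adjoint (W_rep z) o\<^sub>L W_rep z = id_blinfun" "W_rep z o\<^sub>L op_adjoint (W_rep z) = id_blinfun"
    unfolding adjW unfolding W_rep_def using bw bw' u
    by (simp_all add: wshift_compose wshift_one mult.commute[of "cnj _"] del: complex_cnj_mult)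
  show ?thesis
    unfolding A_relations_def using 1 2 3 4 b bw
    by (simp add: wshift_operators) (simp add: X_rep_def W_rep_def wshift_operators)
qed

definition rep :: "complex \<Rightarrow> 'a \<Rightarrow> test_elem" where
  "rep z = (SOME h. h \<in> star_hom A BH \<and> h x = emb (X_rep z) \<and> h w = emb (W_rep z))"

lemma rep:
  assumes "z \<in> circle"
  shows "rep z \<in> star_hom A BH" "rep z x = emb (X_rep z)" "rep z w = emb (W_rep z)"
proof -
  have "\<exists>h. h \<in> star_hom A BH \<and> h x = emb (X_rep z) \<and> h w = emb (W_rep z)"
    using is_A relations_rep[OF assms] cstar_BH unfolding is_A_def by blast
  then have "rep z \<in> star_hom A BH \<and> rep z x = emb (X_rep z) \<and> rep z w = emb (W_rep z)"
    unfolding rep_def by (rule someI_ex)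
  then show "rep z \<in> star_hom A BH" "rep z x = emb (X_rep z)" "rep z w = emb (W_rep z)" by auto
qed

text \<open>Each z on the circle is an eigenvalue of the image of \<open>w\<close> in
  \<open>rep z\<close>, at the basis vector with index 0. So the functional calculus of
  \<open>w\<close> lives on the full circle.\<close>

lemma cspectrum_w: "cspectrum A w = circle"
proof
  show "cspectrum A w \<subseteq> circle" using unitary_w by (intro cspectrum_unitary) auto
  show "circle \<subseteq> cspectrum A w"
  proof (rule subsetI, rule ccontr)
    fix z assume z: "z \<in> circle" and "z \<notin> cspectrum A w"
    then have "z \<odot> \<one> \<ominus> w \<in> Units A" by (simp add: cspectrum_def)
    then have "z \<odot>\<^bsub>BH\<^esub> \<one>\<^bsub>BH\<^esub> \<ominus>\<^bsub>BH\<^esub> rep z w \<in> Units BH"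
      by (intro star_hom_spectral[OF unital_cstar_algebra_axioms cstar_BH rep(1)[OF z]]) auto
    then have "z \<notin> cspectrum BH (emb (wshift (\<lambda>n. z * lam powi n) 0))"
      by (simp add: cspectrum_def rep(3)[OF z] W_rep_def del: BH_simps)
    then show False using cspectrum_diagonal[OF bounded_orbit[OF z], of 0] by simp
  qed
qed

lemma cspectrum_rotated_w: "cspectrum A (inverse lam \<odot> w) = circle"
proof -
  have "c \<odot> \<one> \<ominus> inverse lam \<odot> w \<in> Units A \<longleftrightarrow> (lam * c) \<odot> \<one> \<ominus> w \<in> Units A" for c
  proof -
    have 1: "c \<odot> \<one> \<ominus> inverse lam \<odot> w = inverse lam \<odot> ((lam * c) \<odot> \<one> \<ominus> w)"
      by (simp add: sc_diff sc_assoc[symmetric] mult.assoc[symmetric])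
    have 2: "(lam * c) \<odot> \<one> \<ominus> w = lam \<odot> (c \<odot> \<one> \<ominus> inverse lam \<odot> w)"
      by (simp add: sc_diff sc_assoc[symmetric])
    show ?thesis using sc_Units[of "(lam * c) \<odot> \<one> \<ominus> w" "inverse lam"]
        sc_Units[of "c \<odot> \<one> \<ominus> inverse lam \<odot> w" lam]
      unfolding 1[symmetric] 2[symmetric] by auto
  qed
  then have "c \<in> cspectrum A (inverse lam \<odot> w) \<longleftrightarrow> lam * c \<in> cspectrum A w" for c
    by (simp add: cspectrum_def)
  then have "c \<in> cspectrum A (inverse lam \<odot> w) \<longleftrightarrow> c \<in> circle" for c
    unfolding cspectrum_w by (simp add: norm_mult)
  then show ?thesis by blast
qed

subsection \<open>Functional calculus for \<open>w\<close>\<close>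

text \<open>A calculus witnessing the relation for x*x. Recording its value at \<open>weight\<close>
  in the choice carries that relation along.\<close>

definition F :: "(complex \<Rightarrow> complex) \<Rightarrow> 'a" where
  "F = (SOME F. circle_calculus A F \<and> F (\<lambda>z. z) = w \<and> F weight = adj A x \<otimes> x)"

lemma F: "circle_calculus A F" and F_id: "F (\<lambda>z. z) = w" and F_weight: "F weight = adj A x \<otimes> x"
proof -
  obtain \<Phi> where \<Phi>: "\<Phi> \<in> star_hom (C_alg circle) A" "\<Phi> (\<lambda>z\<in>circle. z) = w"
    "\<Phi> (restrict weight circle) = adj A x \<otimes> x"
    using relations by (auto simp: A_relations_def has_cfc_def cspectrum_w)
  have "\<exists>F. circle_calculus A F \<and> F (\<lambda>z. z) = w \<and> F weight = adj A x \<otimes> x"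
    using star_hom_circle_calculus[OF unital_cstar_algebra_axioms \<Phi>(1)] \<Phi>(2,3) by blast
  then have "circle_calculus A F \<and> F (\<lambda>z. z) = w \<and> F weight = adj A x \<otimes> x"
    unfolding F_def by (rule someI_ex)
  then show "circle_calculus A F" "F (\<lambda>z. z) = w" "F weight = adj A x \<otimes> x" by auto
qed

sublocale F: circle_calculus A F by (rule F)

lemma F_rot: "circle_calculus A (\<lambda>f. F (rot n f))"
  using F.rotate[of "lam powi n"] by (simp add: rot_def[abs_def])

lemma F_unrot_id: "F (rot (-1) (\<lambda>z. z)) = inverse lam \<odot> w"
proof -
  have "rot (-1) (\<lambda>z. z) = (\<lambda>z. inverse lam * z)"
    by (simp add: fun_eq_iff rot_def power_int_minus)
  then show ?thesis using F.scale[of "\<lambda>z. z" "inverse lam"] by (simp add: F_id)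
qed

text \<open>The relation for xx* refers to the calculus of the rotated unitary; by uniqueness that
  one is \<open>F\<close> precomposed with the inverse rotation.\<close>

lemma F_unrot_weight: "F (rot (-1) weight) = x \<otimes> adj A x"
proof -
  obtain \<Phi> where \<Phi>: "\<Phi> \<in> star_hom (C_alg circle) A" "\<Phi> (\<lambda>z\<in>circle. z) = inverse lam \<odot> w"
    "\<Phi> (restrict weight circle) = x \<otimes> adj A x"
    using relations by (auto simp: A_relations_def has_cfc_def cspectrum_rotated_w)
  have "F (rot (-1) weight) = \<Phi> (restrict weight circle)"
    using \<Phi>(2) F_unrot_id by (intro calculus_unique[OF F_rot star_hom_circle_calculus[OF unital_cstar_algebra_axioms \<Phi>(1)] _ continuous_weight]) simp
  then show ?thesis using \<Phi>(3) by simp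
qed

lemma x_F: "ccont f \<Longrightarrow> x \<otimes> F f = F (rot (-1) f) \<otimes> x"
proof (rule calculus_intertwine[OF F F_rot])
  show "x \<otimes> F (\<lambda>z. z) = F (rot (-1) (\<lambda>z. z)) \<otimes> x"
    by (simp add: F_id F_unrot_id xw smult_mult_left)
qed simp_all

lemma adj_x_F:
  assumes f: "ccont f"
  shows "adj A x \<otimes> F f = F (rot 1 f) \<otimes> adj A x"
proof -
  \<comment> \<open>Chosen so that the adjoint of the relation \<open>x_F\<close> for g is the claim
    for f.\<close>
  define g where "g = (\<lambda>z. cnj (rot 1 f z))"
  have g: "ccont g"
    unfolding g_def using continuous_rot[OF f, of 1] by (intro continuous_intros)
  have e: "(\<lambda>z. cnj (g z)) = rot 1 f" "(\<lambda>z. cnj (rot (-1) g z)) = f"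
    by (simp_all add: g_def rot_def power_int_minus fun_eq_iff mult.assoc[symmetric])
  have "adj A (x \<otimes> F g) = adj A (F (rot (-1) g) \<otimes> x)" using x_F[OF g] by simp
  then have "adj A (F g) \<otimes> adj A x = adj A x \<otimes> adj A (F (rot (-1) g))"
    using g continuous_rot[OF g, of "-1"] by (simp add: adj_mult F.closed)
  then show ?thesis
    using F.cnj[OF g] F.cnj[OF continuous_rot[OF g, of "-1"]] by (simp add: e)
qed

subsection \<open>Monomials span a dense subspace\<close>

text \<open>One index for the powers of x and of its adjoint, so that monomials have an integer
  degree. Exponents add only up to a factor from the calculus of \<open>w\<close>, as
  \<open>x_xpow\<close> and \<open>adj_x_xpow\<close> show.\<close>

definition xpow :: "int \<Rightarrow> 'a" where
  "xpow n = (if 0 \<le> n then x [^] nat n else (adj A x) [^] nat (- n))"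


lemma xpow_closed [simp]: "xpow n \<in> carrier A"
  unfolding xpow_def by (cases "0 \<le> n") (simp_all only: if_True if_False pow_closed x_closed adj_x_closed)

lemma pow_comm:
  assumes "a \<in> carrier A" shows "a [^] (n::nat) \<otimes> a = a \<otimes> a [^] n"
proof -
  have "a [^] Suc n = a \<otimes> a [^] n"
    using assms by (rule monoid.nat_pow_Suc2[OF ring.is_monoid[OF ring_A]])
  then show ?thesis by (simp only: pow_Suc)
qed

lemma xpow_0 [simp]: "xpow 0 = \<one>"
  by (simp add: xpow_def pow_0)

lemma xpow_nonneg: "xpow (int n) = x [^] n"
  by (simp add: xpow_def)

lemma xpow_nonpos: "xpow (- int n) = adj A x [^] n"
  by (cases "n = 0") (auto simp: xpow_def pow_0)

lemma xpow_w: "xpow n \<otimes> w = lam powi (- n) \<odot> (w \<otimes> xpow n)"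
proof -
  have pow: "a [^] k \<otimes> w = (c ^ k) \<odot> (w \<otimes> a [^] k)"
    if a: "a \<in> carrier A" and aw: "a \<otimes> w = c \<odot> (w \<otimes> a)" for a c and k :: nat
  proof (induction k)
    case (Suc k)
    have [simp]: "a [^] k \<in> carrier A" using a by (rule pow_closed)
    have "a [^] Suc k \<otimes> w = a [^] k \<otimes> (a \<otimes> w)" using a by (simp add: pow_Suc ring_simps)
    also have "\<dots> = c \<odot> ((a [^] k \<otimes> w) \<otimes> a)" unfolding aw using a by (simp add: smult_mult_right ring_simps)
    finally show ?case using a by (simp add: Suc pow_Suc smult_mult_left sc_assoc[symmetric] ring_simps)
  qed (simp add: pow_0)
  have id: "ccont (\<lambda>z::complex. z)" by (intro continuous_intros)
  have "F (rot 1 (\<lambda>z. z)) = lam \<odot> w" using F.scale[OF id, of lam] by (simp add: F_id rot_def[abs_def])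
  then have ax: "adj A x \<otimes> w = lam \<odot> (w \<otimes> adj A x)"
    using adj_x_F[OF id] by (simp add: F_id smult_mult_left)
  show ?thesis
  proof (cases "0 \<le> n")
    case True
    then obtain k where "n = int k" using nonneg_int_cases by blast
    then show ?thesis using pow[OF x_closed xw, of k] by (simp add: xpow_nonneg power_int_minus power_inverse)
  next
    case False
    then obtain k where "n = - int k" by (metis nonpos_int_cases linear)
    then show ?thesis using pow[OF adj_x_closed ax, of k] by (simp add: xpow_nonpos)
  qed
qed

text \<open>For negative n one factor x meets an adjoint, and xx* is a function of \<open>w\<close>;
  otherwise the factor p is 1.\<close>

lemma x_xpow: "\<exists>p. ccont p \<and> x \<otimes> xpow n = F p \<otimes> xpow (n + 1)"
proof (cases "0 \<le> n")
  case True
  then obtain k where "n = int k" using nonneg_int_cases by blast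
  then have "x \<otimes> xpow n = F (\<lambda>z. 1) \<otimes> xpow (n + 1)"
    using xpow_nonneg[of k] xpow_nonneg[of "Suc k"] by (simp add: F.one pow_comm add.commute)
  then show ?thesis using True by (intro exI[of _ "\<lambda>z. 1"]) auto
next
  case False
  define k where "k = nat (- n - 1)"
  have "n = - int (Suc k)" using False by (simp add: k_def)
  then have "x \<otimes> xpow n = (x \<otimes> adj A x) \<otimes> xpow (n + 1)"
    using xpow_nonpos[of k] xpow_nonpos[of "Suc k"] by (simp add: pow_comm ring_simps)
  then show ?thesis using continuous_rot[OF continuous_weight, of "-1"]
    by (intro exI[of _ "rot (-1) weight"]) (simp add: F_unrot_weight)
qed

lemma adj_x_xpow: "\<exists>p. ccont p \<and> adj A x \<otimes> xpow n = F p \<otimes> xpow (n - 1)"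
proof (cases "n \<le> 0")
  case True
  then obtain k where "n = - int k" by (metis nonpos_int_cases)
  then have "adj A x \<otimes> xpow n = F (\<lambda>z. 1) \<otimes> xpow (n - 1)"
    using xpow_nonpos[of k] xpow_nonpos[of "Suc k"] by (simp add: F.one pow_comm minus_diff_commute)
  then show ?thesis using True by (intro exI[of _ "\<lambda>z. 1"]) auto
next
  case False
  define k where "k = nat (n - 1)"
  have "n = int (Suc k)" using False by (simp add: k_def)
  then have "adj A x \<otimes> xpow n = (adj A x \<otimes> x) \<otimes> xpow (n - 1)"
    using xpow_nonneg[of k] xpow_nonneg[of "Suc k"] by (simp add: pow_comm ring_simps)
  then show ?thesis using continuous_weight
    by (intro exI[of _ weight]) (simp add: F_weight)
qed

text \<open>The closed linear span of the monomials. Scalars have no rule of their own, since c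
  times b is \<open>F\<close> of a constant times b and that constant is absorbed by the functions
  f.\<close>

inductive_set cspan :: "'a set" where
  monomial: "ccont f \<Longrightarrow> F f \<otimes> xpow n \<in> cspan"
| add: "a \<in> cspan \<Longrightarrow> b \<in> cspan \<Longrightarrow> a \<oplus> b \<in> cspan"
| limit: "a \<in> carrier A \<Longrightarrow> (\<And>e::real. 0 < e \<Longrightarrow> \<exists>b. b \<in> cspan \<and> nrm A (a \<ominus> b) < e) \<Longrightarrow> a \<in> cspan"

lemma cspan_closed [simp]: "a \<in> cspan \<Longrightarrow> a \<in> carrier A"
  by (induction rule: cspan.induct) (simp_all add: F.closed)

lemma cspan_left_mult:
  assumes t: "t \<in> carrier A" and "\<And>f n. ccont f \<Longrightarrow> t \<otimes> (F f \<otimes> xpow n) \<in> cspan"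
    and "a \<in> cspan"
  shows "t \<otimes> a \<in> cspan"
  using assms(3)
proof (induction rule: cspan.induct)
  case (monomial f n) then show ?case by (rule assms(2))
next
  case (add a b)
  then show ?case using cspan.add[OF add.IH] t by (simp add: ring_simps)
next
  case (limit a)
  show ?case
  proof (rule cspan.limit)
    fix e :: real assume e: "0 < e"
    define d where "d = e / (nrm A t + 1)"
    have n: "0 \<le> nrm A t" using t by (rule nrm_nonneg)
    have d: "0 < d" "d * (nrm A t + 1) = e" using e n by (simp_all add: d_def)
    obtain b where b: "b \<in> cspan" "t \<otimes> b \<in> cspan" "nrm A (a \<ominus> b) < d" using limit(2)[OF d(1)] by blast
    have "nrm A (t \<otimes> a \<ominus> t \<otimes> b) \<le> nrm A t * nrm A (a \<ominus> b)"
      using nrm_mult[OF t, of "a \<ominus> b"] t limit(1) b(1) by (simp add: diff_distrib_left)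
    also have "\<dots> \<le> nrm A t * d" using b(3) n by (intro mult_left_mono) auto
    also have "\<dots> < e" using d by (simp add: algebra_simps)
    finally show "\<exists>b. b \<in> cspan \<and> nrm A (t \<otimes> a \<ominus> b) < e" using b(2) by blast
  qed (use t limit in simp)
qed

text \<open>Minimality of the generated C*-algebra as an induction rule: the elements satisfying P
  form a C*-subalgebra with the generators in it.\<close>

lemma generated_induct [consumes 1, case_names x w one add mult scale adj limit]:
  assumes "a \<in> carrier A"
    and "P x" "P w" "P \<one>"
    and add: "\<And>a b. a \<in> carrier A \<Longrightarrow> b \<in> carrier A \<Longrightarrow> P a \<Longrightarrow> P b \<Longrightarrow> P (a \<oplus> b)"
    and mult: "\<And>a b. a \<in> carrier A \<Longrightarrow> b \<in> carrier A \<Longrightarrow> P a \<Longrightarrow> P b \<Longrightarrow> P (a \<otimes> b)"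
    and scale: "\<And>a c. a \<in> carrier A \<Longrightarrow> P a \<Longrightarrow> P (c \<odot> a)"
    and adj: "\<And>a. a \<in> carrier A \<Longrightarrow> P a \<Longrightarrow> P (adj A a)"
    and limit: "\<And>a. a \<in> carrier A \<Longrightarrow>
      (\<And>e::real. 0 < e \<Longrightarrow> \<exists>b\<in>carrier A. P b \<and> nrm A (a \<ominus> b) < e) \<Longrightarrow> P a"
  shows "P a"
proof -
  let ?S = "{a \<in> carrier A. P a}"
  have "subring ?S A"
  proof (rule ring.subringI[OF ring_A])
    fix h assume "h \<in> ?S"
    then show "\<ominus> h \<in> ?S" using scale[of h "-1"] by (simp add: sc_minus_one ring_simps)
  qed (use assms(4) add mult in \<open>auto simp: ring_simps\<close>)
  moreover have "b \<in> ?S" if s: "\<forall>n::nat. s n \<in> ?S" and b: "b \<in> carrier A"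
    and lim: "(\<lambda>n. nrm A (s n \<ominus> b)) \<longlonglongrightarrow> 0" for s b
  proof -
    have "\<exists>d\<in>carrier A. P d \<and> nrm A (b \<ominus> d) < e" if e: "0 < e" for e
    proof -
      obtain n where "nrm A (s n \<ominus> b) < e"
        using order_tendstoD(2)[OF lim e] by (auto simp: eventually_sequentially)
      then show ?thesis using s b nrm_diff_commute[of "s n" b] by auto
    qed
    then show ?thesis using limit[OF b] b by blast
  qed
  ultimately have "cstar_subalgebra ?S A"
    using scale adj by (auto simp: cstar_subalgebra_def adj_closed)
  moreover have "{x, w} \<subseteq> ?S" using assms(2,3) by simp
  moreover have "cstar_generated A {x, w}" using is_A by (simp add: is_A_def)
  ultimately have "?S = carrier A" unfolding cstar_generated_def by blast
  then show ?thesis using assms(1) by blast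
qed

lemma F_cspan:
  assumes "ccont g" "a \<in> cspan" shows "F g \<otimes> a \<in> cspan"
proof (rule cspan_left_mult[OF F.closed[OF assms(1)] _ assms(2)])
  fix f :: "complex \<Rightarrow> complex" and n assume f: "ccont f"
  then have "F (\<lambda>z. g z * f z) \<otimes> xpow n \<in> cspan"
    using assms by (intro cspan.monomial continuous_on_mult)
  then show "F g \<otimes> (F f \<otimes> xpow n) \<in> cspan"
    using f assms by (simp add: F.mult F.closed ring_simps)
qed

lemma x_monomial:
  assumes f: "ccont f"
  shows "\<exists>g. ccont g \<and> x \<otimes> (F f \<otimes> xpow n) = F g \<otimes> xpow (n + 1)"
proof -
  obtain p where p: "ccont p" "x \<otimes> xpow n = F p \<otimes> xpow (n + 1)"
    using x_xpow by blast
  note c = continuous_rot[OF f, of "-1"]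
  have "x \<otimes> (F f \<otimes> xpow n) = (x \<otimes> F f) \<otimes> xpow n" using f by (simp add: F.closed ring_simps)
  also have "\<dots> = F (rot (-1) f) \<otimes> (x \<otimes> xpow n)" using f c by (simp add: x_F F.closed ring_simps)
  also have "\<dots> = F (\<lambda>z. rot (-1) f z * p z) \<otimes> xpow (n + 1)"
    unfolding p(2) using F.mult[OF c p(1)] c p(1) by (simp add: F.closed ring_simps)
  finally show ?thesis using continuous_on_mult[OF c p(1)] by blast
qed

lemma adj_x_monomial:
  assumes f: "ccont f"
  shows "\<exists>g. ccont g \<and> adj A x \<otimes> (F f \<otimes> xpow n) = F g \<otimes> xpow (n - 1)"
proof -
  obtain p where p: "ccont p" "adj A x \<otimes> xpow n = F p \<otimes> xpow (n - 1)"
    using adj_x_xpow by blast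
  note c = continuous_rot[OF f, of 1]
  have "adj A x \<otimes> (F f \<otimes> xpow n) = (adj A x \<otimes> F f) \<otimes> xpow n" using f by (simp add: F.closed ring_simps)
  also have "\<dots> = F (rot 1 f) \<otimes> (adj A x \<otimes> xpow n)"
    unfolding adj_x_F[OF f] using F.closed[OF c] by (simp add: ring_simps)
  also have "\<dots> = F (\<lambda>z. rot 1 f z * p z) \<otimes> xpow (n - 1)"
    unfolding p(2) using F.mult[OF c p(1)] F.closed[OF c] F.closed[OF p(1)] by (simp add: ring_simps)
  finally show ?thesis using continuous_on_mult[OF c p(1)] by blast
qed

text \<open>The elements \<open>a\<close> such that left multiplication by \<open>a\<close> and by \<open>a\<^sup>*\<close> preserves the closed span
  form a C*-algebra that contains the generators.\<close>

lemma cspan_eq_carrier: "cspan = carrier A"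
proof
  have w: "w \<otimes> b \<in> cspan" "adj A w \<otimes> b \<in> cspan" if "b \<in> cspan" for b
    using F_cspan[OF continuous_on_id that] F_cspan[of cnj, OF _ that] F.cnj[of "\<lambda>z. z"]
    by (simp_all add: F_id continuous_intros)
  have x: "x \<otimes> b \<in> cspan" "adj A x \<otimes> b \<in> cspan" if "b \<in> cspan" for b
  proof -
    have *: "x \<otimes> (F f \<otimes> xpow n) \<in> cspan" "adj A x \<otimes> (F f \<otimes> xpow n) \<in> cspan"
      if f: "ccont f" for f n
      using x_monomial[OF f, of n] adj_x_monomial[OF f, of n] by (auto intro: cspan.monomial)
    show "x \<otimes> b \<in> cspan" "adj A x \<otimes> b \<in> cspan"
      by (rule cspan_left_mult[OF x_closed *(1) that] cspan_left_mult[OF adj_x_closed *(2) that];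
          assumption)+
  qed
  have sc: "c \<odot> b \<in> cspan" if "b \<in> cspan" for b c
    using F_cspan[OF continuous_on_const that, of c] that
    by (simp add: F.const smult_mult_left ring_simps)
  have "(\<forall>b\<in>cspan. a \<otimes> b \<in> cspan) \<and> (\<forall>b\<in>cspan. adj A a \<otimes> b \<in> cspan)" if "a \<in> carrier A" for a
    using that
  proof (induction rule: generated_induct)
    case (limit a)
    have lim: "t \<otimes> b \<in> cspan" if t: "t \<in> carrier A" and b: "b \<in> cspan"
      and ap: "\<And>e::real. 0 < e \<Longrightarrow> \<exists>s\<in>carrier A. s \<otimes> b \<in> cspan \<and> nrm A (t \<ominus> s) < e" for t b
    proof (rule cspan.limit)
      fix e :: real assume e: "0 < e"
      define d where "d = e / (nrm A b + 1)"
      have n: "0 \<le> nrm A b" using b by (intro nrm_nonneg) simp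
      have d: "0 < d" "d * (nrm A b + 1) = e" using e n by (simp_all add: d_def)
      obtain s where s: "s \<in> carrier A" "s \<otimes> b \<in> cspan" "nrm A (t \<ominus> s) < d" using ap[OF d(1)] by blast
      have "nrm A (t \<otimes> b \<ominus> s \<otimes> b) \<le> nrm A (t \<ominus> s) * nrm A b"
        using nrm_mult[of "t \<ominus> s" b] t b s(1) by (simp add: diff_distrib_right)
      also have "\<dots> \<le> d * nrm A b" using s(3) n by (intro mult_right_mono) auto
      also have "\<dots> < e" using d by (simp add: algebra_simps)
      finally show "\<exists>c. c \<in> cspan \<and> nrm A (t \<otimes> b \<ominus> c) < e" using s(2) by blast
    qed (use t b in simp)
    have "nrm A (adj A a \<ominus> adj A s) = nrm A (a \<ominus> s)" if "s \<in> carrier A" for s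
      using limit(1) that nrm_adj[of "a \<ominus> s"] by (simp add: adj_diff)
    note dist_adj = this
    show ?case
    proof (intro conjI ballI)
      fix b assume b: "b \<in> cspan"
      show "a \<otimes> b \<in> cspan" using limit(2) b by (intro lim[OF limit(1) b]) blast
      show "adj A a \<otimes> b \<in> cspan"
      proof (rule lim[OF adj_closed[OF limit(1)] b])
        fix e :: real assume "0 < e"
        then obtain s where "s \<in> carrier A" "\<forall>b\<in>cspan. adj A s \<otimes> b \<in> cspan"
          "nrm A (a \<ominus> s) < e" using limit(2) by blast
        then show "\<exists>s\<in>carrier A. s \<otimes> b \<in> cspan \<and> nrm A (adj A a \<ominus> s) < e"
          using b dist_adj by (intro bexI[of _ "adj A s"]) (auto intro: adj_closed)
      qed
    qed
  next
    case (add a b)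
    then show ?case
      by (auto simp: adj_add adj_closed ring_simps(13) intro: cspan.add)
  next
    case (mult a b)
    then show ?case by (simp add: adj_mult adj_closed ring_simps(11))
  next
    case (scale a c)
    then show ?case by (simp add: adj_smult adj_closed smult_mult_left sc)
  next
    case (adj a)
    then show ?case by (simp add: adj_adj)
  qed (use w x in simp_all)
  moreover have "\<one> \<in> cspan" using cspan.monomial[of "\<lambda>z. 1" 0] by (simp add: F.one)
  ultimately have "a \<otimes> \<one> \<in> cspan" if "a \<in> carrier A" for a using that by blast
  then show "carrier A \<subseteq> cspan" by auto
qed auto

end

section \<open>Functionals on the circle\<close>

text \<open>Bounded linear functionals on the continuous functions, standing for complex measures.
  Bounding by every pointwise bound B replaces a supremum norm, and B = 0 applied to a difference
  shows that only values on the circle matter.\<close>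

definition circle_functional :: "((complex \<Rightarrow> complex) \<Rightarrow> complex) \<Rightarrow> bool" where
  "circle_functional L \<longleftrightarrow>
     (\<forall>f g. ccont f \<and> ccont g \<longrightarrow> L (\<lambda>z. f z + g z) = L f + L g) \<and>
     (\<forall>c f. ccont f \<longrightarrow> L (\<lambda>z. c * f z) = c * L f) \<and>
     (\<exists>K\<ge>0. \<forall>f B. ccont f \<and> (\<forall>z\<in>circle. cmod (f z) \<le> B) \<longrightarrow> cmod (L f) \<le> K * B)"

lemma circle_functional_add:
  "\<lbrakk>circle_functional L; ccont f; ccont g\<rbrakk> \<Longrightarrow> L (\<lambda>z. f z + g z) = L f + L g"
  by (simp add: circle_functional_def)

lemma circle_functional_scale:
  "\<lbrakk>circle_functional L; ccont f\<rbrakk> \<Longrightarrow> L (\<lambda>z. c * f z) = c * L f"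
  by (simp add: circle_functional_def)

lemma circle_functional_diff:
  assumes "circle_functional L" "ccont f" "ccont g"
  shows "L (\<lambda>z. f z - g z) = L f - L g"
  using circle_functional_add[of L f "\<lambda>z. (-1) * g z"] circle_functional_scale[of L g "-1"] assms
  by (simp add: continuous_intros)

definition bound_of :: "((complex \<Rightarrow> complex) \<Rightarrow> complex) \<Rightarrow> real" where
  "bound_of L = (SOME K. 0 \<le> K \<and>
     (\<forall>f B. ccont f \<and> (\<forall>z\<in>circle. cmod (f z) \<le> B) \<longrightarrow> cmod (L f) \<le> K * B))"

lemma bound_of:
  assumes "circle_functional L"
  shows "0 \<le> bound_of L"
    and "\<And>f B. ccont f \<Longrightarrow> (\<And>z. z \<in> circle \<Longrightarrow> cmod (f z) \<le> B) \<Longrightarrow>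
      cmod (L f) \<le> bound_of L * B"
proof -
  have "\<exists>K\<ge>0. \<forall>f B. ccont f \<and> (\<forall>z\<in>circle. cmod (f z) \<le> B) \<longrightarrow> cmod (L f) \<le> K * B"
    using assms by (simp only: circle_functional_def)
  from someI_ex[OF this] have *: "0 \<le> bound_of L \<and>
      (\<forall>f B. ccont f \<and> (\<forall>z\<in>circle. cmod (f z) \<le> B) \<longrightarrow> cmod (L f) \<le> bound_of L * B)"
    unfolding bound_of_def .
  show "0 \<le> bound_of L" using * by (rule conjunct1)
  show "cmod (L f) \<le> bound_of L * B" if "ccont f" "\<And>z. z \<in> circle \<Longrightarrow> cmod (f z) \<le> B" for f B
    using conjunct2[OF *] that by simp
qed

lemma circle_functional_cong:
  assumes "circle_functional L" "ccont f" "ccont g"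
    and "\<And>z. z \<in> circle \<Longrightarrow> f z = g z"
  shows "L f = L g"
proof -
  have "cmod (L (\<lambda>z. f z - g z)) \<le> bound_of L * 0"
    using assms by (intro bound_of continuous_on_diff) auto
  then show ?thesis using circle_functional_diff[OF assms(1-3)] by simp
qed

lemma circle_functional_limit:
  assumes L: "circle_functional L" and f: "ccont f"
    and approx: "\<And>e. 0 < e \<Longrightarrow> \<exists>g. ccont g \<and> L g = 0 \<and> (\<forall>z\<in>circle. cmod (f z - g z) \<le> e)"
  shows "L f = 0"
proof -
  define K where "K = bound_of L"
  note K = bound_of[OF L, folded K_def]
  have "cmod (L f) \<le> 0 + e" if e: "0 < e" for e
  proof -
    define d where "d = e / (K + 1)"
    have d: "0 < d" "K * d \<le> e" using e K(1) by (simp_all add: d_def field_simps)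
    obtain g where g: "ccont g" "L g = 0" "\<forall>z\<in>circle. cmod (f z - g z) \<le> d"
      using approx[OF d(1)] by blast
    have "cmod (L (\<lambda>z. f z - g z)) \<le> K * d" using f g by (intro K continuous_on_diff) auto
    then show ?thesis using circle_functional_diff[OF L f g(1)] g(2) d(2) by simp
  qed
  then have "cmod (L f) \<le> 0" by (rule field_le_epsilon)
  then show ?thesis by simp
qed

section \<open>Traces as functionals on the circle\<close>

lemma continuous_uniform_approx:
  fixes f :: "complex \<Rightarrow> complex"
  assumes "\<And>e. 0 < e \<Longrightarrow> \<exists>g. continuous_on S g \<and> (\<forall>z\<in>S. cmod (f z - g z) < e)"
  shows "continuous_on S f"
proof -
  have "\<forall>n. \<exists>g. continuous_on S g \<and> (\<forall>z\<in>S. cmod (f z - g z) < 1 / real (Suc n))"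
    using assms by simp
  then obtain g where g: "\<And>n. continuous_on S (g n)" "\<And>n z. z \<in> S \<Longrightarrow> cmod (f z - g n z) < 1 / real (Suc n)"
    by metis
  have "uniform_limit S g f sequentially"
  proof (rule uniform_limitI)
    fix e :: real assume e: "0 < e"
    obtain N where N: "1 / real (Suc N) < e" using nat_approx_posE[OF e] .
    have "dist (g n z) (f z) < e" if "n \<ge> N" "z \<in> S" for n z
    proof -
      have "1 / real (Suc n) \<le> 1 / real (Suc N)" using that by (simp add: frac_le)
      then show ?thesis using g(2)[OF that(2), of n] N by (simp add: dist_norm norm_minus_commute)
    qed
    then show "\<forall>\<^sub>F n in sequentially. \<forall>z\<in>S. dist (g n z) (f z) < e"
      unfolding eventually_sequentially by blast
  qed
  then show ?thesis by (rule uniform_limit_theorem[rotated]) (simp_all add: g(1))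
qed

context rotation_algebra
begin

text \<open>The conditional expectation onto the functional calculus of \<open>w\<close>.\<close>

definition E :: "'a \<Rightarrow> complex \<Rightarrow> complex" where
  "E a z = coord (prj (rep z a) (ket 0)) 0"

lemma rep_operator:
  assumes "z \<in> circle" "a \<in> carrier A"
  obtains T where "rep z a = emb T" "T \<in> operators"
  using ring_hom_closed[of "rep z" A BH a] rep(1)[OF assms(1)] assms(2) by (auto simp: star_hom_def)

lemma E_add:
  assumes z: "z \<in> circle" and a: "a \<in> carrier A" and b: "b \<in> carrier A"
  shows "E (a \<oplus> b) z = E a z + E b z"
proof -
  obtain T S where TS: "rep z a = emb T" "rep z b = emb S" using rep_operator[OF z] a b by metis
  have "rep z (a \<oplus> b) = emb (T + S)"
    using ring_hom_add[of "rep z" A BH a b] rep(1)[OF z] a b by (simp add: star_hom_def TS)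
  then show ?thesis by (simp add: E_def TS blinfun.add_left plus_ell2.rep_eq)
qed

lemma E_scale:
  assumes z: "z \<in> circle" and a: "a \<in> carrier A"
  shows "E (c \<odot> a) z = c * E a z"
proof -
  obtain T where T: "rep z a = emb T" using rep_operator[OF z a] by metis
  have "rep z (c \<odot> a) = emb (cscale c o\<^sub>L T)"
    using rep(1)[OF z] a by (simp add: star_hom_def T)
  then show ?thesis by (simp add: E_def T coord_wshift)
qed

lemma E_bound: "z \<in> circle \<Longrightarrow> a \<in> carrier A \<Longrightarrow> cmod (E a z) \<le> nrm A a"
  unfolding E_def
  by (rule order_trans[OF norm_coord_apply_le rep_contractive[OF unital_cstar_algebra_axioms rep(1)]])

lemma E_diff:
  assumes "z \<in> circle" "a \<in> carrier A" "b \<in> carrier A"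
  shows "E (a \<ominus> b) z = E a z - E b z"
  using E_add[of z a "(-1) \<odot> b"] E_scale[of z b "-1"] assms by (simp add: a_minus_def sc_minus_one)

text \<open>Both sides are calculi in \<open>BH\<close> with the same value at the coordinate
  function. The \<open>restrict\<close> in the proof comes from the extensional elements of
  \<open>C_alg\<close> and disappears on the orbit.\<close>

lemma rep_F:
  assumes z: "z \<in> circle" and f: "ccont f"
  shows "rep z (F f) = emb (wshift (\<lambda>n. f (z * lam powi n)) 0)"
proof -
  have d: "range (\<lambda>n. z * lam powi n) \<subseteq> circle" using orbit_circle[OF z] by auto
  have 1: "circle_calculus BH (\<lambda>f. rep z (F f))"
    by (rule circle_calculus_hom[OF F cstar_BH rep(1)[OF z]])
  have 2: "circle_calculus BH (\<lambda>f. emb (wshift (\<lambda>n. restrict f circle (z * lam powi n)) 0))"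
    using star_hom_circle_calculus[OF cstar_BH diagonal_star_hom[OF _ d]] by simp
  have "restrict (\<lambda>z. z) circle (z * lam powi n) = z * lam powi n" for n
    using orbit_circle[OF z] by simp
  then have "rep z (F (\<lambda>z. z)) = emb (wshift (\<lambda>n. restrict (\<lambda>z. z) circle (z * lam powi n)) 0)"
    by (simp only: F_id rep(3)[OF z] W_rep_def)
  from calculus_unique[where F = "\<lambda>f. rep z (F f)" and f = f
      and G = "\<lambda>f. emb (wshift (\<lambda>n. restrict f circle (z * lam powi n)) 0)", OF 1 2 this f]
  have "rep z (F f) = emb (wshift (\<lambda>n. restrict f circle (z * lam powi n)) 0)" .
  then show ?thesis using orbit_circle[OF z] by simp
qed

text \<open>Degree is read in the representations: every one of them must turn the element into a
  shift by k. The diagonal coefficient, hence \<open>E\<close>, then sees degree 0 only.\<close>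

definition graded :: "int \<Rightarrow> 'a \<Rightarrow> bool" where
  "graded k a \<longleftrightarrow> a \<in> carrier A \<and>
     (\<forall>z\<in>circle. \<exists>d. bounded (range d) \<and> rep z a = emb (wshift d k))"

lemma graded_closed: "graded k a \<Longrightarrow> a \<in> carrier A"
  by (simp add: graded_def)

lemma graded_mult:
  assumes a: "graded k a" and b: "graded l b"
  shows "graded (k + l) (a \<otimes> b)"
  unfolding graded_def
proof (intro conjI ballI)
  fix z :: complex assume z: "z \<in> circle"
  obtain d where d: "bounded (range d)" "rep z a = emb (wshift d k)" using a z unfolding graded_def by blast
  obtain e where e: "bounded (range e)" "rep z b = emb (wshift e l)" using b z unfolding graded_def by blast
  have "rep z (a \<otimes> b) = emb (wshift (\<lambda>n. d n * e (n - k)) (k + l))"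
    using ring_hom_mult[of "rep z" A BH a b] rep(1)[OF z] graded_closed[OF a] graded_closed[OF b] d e
    by (simp add: star_hom_def wshift_compose)
  then show "\<exists>d. bounded (range d) \<and> rep z (a \<otimes> b) = emb (wshift d (k + l))"
    using bounded_range_mult[OF d(1) e(1)] by blast
qed (simp add: graded_closed[OF a] graded_closed[OF b])

lemma graded_F:
  assumes f: "ccont f" shows "graded 0 (F f)"
proof -
  show ?thesis
    using bounded_orbit_values[OF _ f] rep_F[OF _ f] F.closed[OF f] unfolding graded_def by blast
qed

lemma graded_x: "graded 1 x"
  using bounded_weight rep(2) x_closed unfolding graded_def X_rep_def by blast

lemma graded_adj_x: "graded (-1) (adj A x)"
  unfolding graded_def
proof (intro conjI ballI)
  fix z :: complex assume z: "z \<in> circle"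
  let ?s = "\<lambda>n. complex_of_real (sqrt (\<gamma> (z * lam powi (n - 1))))"
  have "rep z (adj A x) = adj BH (emb (X_rep z))" using rep(1,2)[OF z] by (simp add: star_hom_def)
  also have "\<dots> = emb (wshift (\<lambda>n. cnj (?s (n + 1))) (-1))"
    using adjoint_eq[OF adjoint_of_wshift[OF bounded_weight[OF z], of 1]] by (simp add: X_rep_def)
  finally show "\<exists>d. bounded (range d) \<and> rep z (adj A x) = emb (wshift d (-1))"
    using bounded_weight[OF z] unfolding bounded_iff
    by (intro exI[of _ "\<lambda>n. cnj (?s (n + 1))"]) (metis (mono_tags, lifting) complex_mod_cnj rangeE rangeI)
qed simp

lemma graded_power: "graded k a \<Longrightarrow> graded (int m * k) (a [^] m)"
proof (induction m)
  case 0
  have "ccont (\<lambda>z. 1 :: complex)" by (rule continuous_on_const)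
  then show ?case
    using graded_F[of "\<lambda>z. 1"] by (simp add: F.one pow_0)
next
  case (Suc m)
  then show ?case using graded_mult[of "int m * k" "a [^] m" k a] by (simp add: pow_Suc algebra_simps)
qed

lemma graded_xpow: "graded n (xpow n)"
proof (cases "0 \<le> n")
  case True
  then obtain k where "n = int k" using nonneg_int_cases by blast
  then show ?thesis using graded_power[OF graded_x, of k] by (simp add: xpow_nonneg)
next
  case False
  then obtain k where "n = - int k" by (metis nonpos_int_cases linear)
  then show ?thesis using graded_power[OF graded_adj_x, of k] by (simp add: xpow_nonpos)
qed

lemma graded_monomial: "ccont f \<Longrightarrow> graded n (F f \<otimes> xpow n)"
  using graded_mult[OF graded_F graded_xpow] by simp

lemma E_graded: "graded k a \<Longrightarrow> k \<noteq> 0 \<Longrightarrow> z \<in> circle \<Longrightarrow> E a z = 0"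
  unfolding graded_def E_def by (force simp: coord_wshift ket.rep_eq)

lemma E_F:
  assumes "z \<in> circle" "ccont f" shows "E (F f) z = f z"
proof -
  show ?thesis
    using bounded_orbit_values[OF assms] by (simp add: E_def rep_F[OF assms] coord_wshift ket.rep_eq)
qed

lemma carrier_induct [consumes 1, case_names monomial add limit]:
  assumes "a \<in> carrier A"
    and "\<And>f n. ccont f \<Longrightarrow> P (F f \<otimes> xpow n)"
    and "\<And>a b. a \<in> carrier A \<Longrightarrow> b \<in> carrier A \<Longrightarrow> P a \<Longrightarrow> P b \<Longrightarrow> P (a \<oplus> b)"
    and "\<And>a. a \<in> carrier A \<Longrightarrow> (\<And>e::real. 0 < e \<Longrightarrow> \<exists>b\<in>carrier A. P b \<and> nrm A (a \<ominus> b) < e) \<Longrightarrow> P a"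
  shows "P a"
proof -
  have "a \<in> cspan" using assms(1) by (simp add: cspan_eq_carrier)
  then show ?thesis
  proof (induction rule: cspan.induct)
    case (limit a)
    then show ?case using assms(4)[OF limit(1)] by (meson cspan_closed)
  qed (use assms(2,3) in auto)
qed

text \<open>The representations are chosen separately for each z, so continuity is not automatic. On
  a monomial \<open>E\<close> is f or 0, and the bound of \<open>E\<close> by the norm, uniform in
  z, carries continuity over to limits.\<close>

lemma continuous_E: "a \<in> carrier A \<Longrightarrow> ccont (E a)"
proof (induction rule: carrier_induct)
  case (monomial f n)
  have "E (F f \<otimes> xpow n) z = (if n = 0 then f z else 0)" if "z \<in> circle" for z
    using that monomial E_F E_graded[OF graded_monomial] by (simp add: F.closed)
  then have "ccont (E (F f \<otimes> xpow n)) \<longleftrightarrow> ccont (\<lambda>z. if n = 0 then f z else 0)"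
    by (intro continuous_on_cong) auto
  then show ?case using monomial by (cases "n = 0") auto
next
  case (add a b)
  have "ccont (E (a \<oplus> b)) \<longleftrightarrow> ccont (\<lambda>z. E a z + E b z)"
    using E_add add by (intro continuous_on_cong) auto
  then show ?case using continuous_on_add[OF add(3,4)] by blast
next
  case (limit a)
  show ?case
  proof (rule continuous_uniform_approx)
    fix e :: real assume "0 < e"
    then obtain b where b: "b \<in> carrier A" "ccont (E b)" "nrm A (a \<ominus> b) < e"
      using limit(2) by blast
    have "cmod (E a z - E b z) < e" if z: "z \<in> circle" for z
      using E_bound[OF z, of "a \<ominus> b"] E_diff[OF z limit(1) b(1)] b limit(1) by simp
    then show "\<exists>g. ccont g \<and> (\<forall>z\<in>circle. cmod (E a z - g z) < e)" using b(2) by blast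
  qed
qed

section \<open>From functionals on the circle to traces\<close>

definition trace_of :: "((complex \<Rightarrow> complex) \<Rightarrow> complex) \<Rightarrow> 'a \<Rightarrow> complex" where
  "trace_of L a = (if a \<in> carrier A then L (E a) else 0)"

lemma trace_of_add:
  assumes L: "circle_functional L" and a: "a \<in> carrier A" and b: "b \<in> carrier A"
  shows "trace_of L (a \<oplus> b) = trace_of L a + trace_of L b"
proof -
  have "L (E (a \<oplus> b)) = L (\<lambda>z. E a z + E b z)"
    using a b by (intro circle_functional_cong[OF L] continuous_E continuous_on_add E_add) auto
  then show ?thesis using circle_functional_add[OF L continuous_E[OF a] continuous_E[OF b]] a b
    by (simp add: trace_of_def)
qed

lemma trace_of_scale:
  assumes L: "circle_functional L" and a: "a \<in> carrier A"
  shows "trace_of L (c \<odot> a) = c * trace_of L a"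
proof -
  have "L (E (c \<odot> a)) = L (\<lambda>z. c * E a z)"
    using a by (intro circle_functional_cong[OF L] continuous_E continuous_on_mult continuous_on_const E_scale) auto
  then show ?thesis using circle_functional_scale[OF L continuous_E[OF a]] a by (simp add: trace_of_def)
qed

lemma trace_of_diff:
  assumes "circle_functional L" "a \<in> carrier A" "b \<in> carrier A"
  shows "trace_of L (a \<ominus> b) = trace_of L a - trace_of L b"
  using trace_of_add[of L a "(-1) \<odot> b"] trace_of_scale[of L b "-1"] assms by (simp add: a_minus_def sc_minus_one)

lemma trace_of_bound:
  assumes L: "circle_functional L"
  shows "\<exists>K\<ge>0. \<forall>a\<in>carrier A. cmod (trace_of L a) \<le> K * nrm A a"
proof -
  define K where "K = bound_of L"
  note K = bound_of[OF L, folded K_def]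
  have "cmod (trace_of L a) \<le> K * nrm A a" if "a \<in> carrier A" for a
    using K(2)[OF continuous_E[OF that] E_bound[OF _ that]] that by (simp add: trace_of_def)
  then show ?thesis using K(1) by blast
qed

lemma trace_of_F:
  assumes L: "circle_functional L" and f: "ccont f"
  shows "trace_of L (F f) = L f"
  using f circle_functional_cong[OF L continuous_E f] E_F[OF _ f] by (simp add: trace_of_def F.closed)

lemma trace_of_graded:
  assumes L: "circle_functional L" and a: "graded k a" "k \<noteq> 0"
  shows "trace_of L a = 0"
proof -
  have "L (E a) = L (\<lambda>z. 0)"
    using graded_closed[OF a(1)] E_graded[OF a]
    by (intro circle_functional_cong[OF L] continuous_E continuous_on_const) auto
  then show ?thesis using circle_functional_scale[OF L continuous_on_const, of 0 0] by (simp add: trace_of_def)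
qed

lemma trace_of_commute_limit:
  assumes L: "circle_functional L" and t: "t \<in> carrier A" and b: "b \<in> carrier A"
    and approx: "\<And>e::real. 0 < e \<Longrightarrow>
      \<exists>s\<in>carrier A. trace_of L (s \<otimes> b) = trace_of L (b \<otimes> s) \<and> nrm A (t \<ominus> s) < e"
  shows "trace_of L (t \<otimes> b) = trace_of L (b \<otimes> t)"
proof -
  obtain K where K: "0 \<le> K" "\<And>a. a \<in> carrier A \<Longrightarrow> cmod (trace_of L a) \<le> K * nrm A a"
    using trace_of_bound[OF L] by blast
  have n: "0 \<le> nrm A b" using b by (rule nrm_nonneg)
  have "cmod (trace_of L (t \<otimes> b) - trace_of L (b \<otimes> t)) \<le> 0 + e" if e: "0 < e" for e
  proof -
    define d where "d = e / (2 * K * nrm A b + 1)"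
    have pos: "0 < 2 * K * nrm A b + 1" using K(1) n by (simp add: add_nonneg_pos)
    then have d: "0 < d" "d * (2 * K * nrm A b + 1) = e" using e by (simp_all add: d_def)
    obtain s where s: "s \<in> carrier A" "trace_of L (s \<otimes> b) = trace_of L (b \<otimes> s)" "nrm A (t \<ominus> s) < d"
      using approx[OF d(1)] by blast
    have ts: "t \<ominus> s \<in> carrier A" using t s(1) by simp
    have small: "cmod (trace_of L a) \<le> K * (d * nrm A b)"
      if "a \<in> carrier A" "nrm A a \<le> nrm A (t \<ominus> s) * nrm A b" for a
    proof -
      have "nrm A a \<le> d * nrm A b" using that(2) mult_right_mono[of "nrm A (t \<ominus> s)" d "nrm A b"] s(3) n by simp
      then show ?thesis using K(2)[OF that(1)] mult_left_mono[OF _ K(1)] by (meson order_trans)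
    qed
    have "trace_of L (t \<otimes> b) - trace_of L (b \<otimes> t)
        = trace_of L ((t \<ominus> s) \<otimes> b) - trace_of L (b \<otimes> (t \<ominus> s))"
      using t s b L by (simp add: diff_distrib_left diff_distrib_right trace_of_diff)
    moreover have "cmod (trace_of L ((t \<ominus> s) \<otimes> b)) \<le> K * (d * nrm A b)"
      "cmod (trace_of L (b \<otimes> (t \<ominus> s))) \<le> K * (d * nrm A b)"
      using nrm_mult[OF ts b] nrm_mult[OF b ts] ts b by (auto intro!: small simp: mult.commute)
    ultimately have "cmod (trace_of L (t \<otimes> b) - trace_of L (b \<otimes> t)) \<le> 2 * (K * (d * nrm A b))"
      using norm_triangle_ineq4[of "trace_of L ((t \<ominus> s) \<otimes> b)" "trace_of L (b \<otimes> (t \<ominus> s))"] by simp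
    also have "\<dots> \<le> e" using d by (simp add: algebra_simps)
    finally show ?thesis by simp
  qed
  then have "cmod (trace_of L (t \<otimes> b) - trace_of L (b \<otimes> t)) \<le> 0" by (rule field_le_epsilon)
  then show ?thesis by simp
qed

text \<open>Against a monomial of degree other than -k, both products have nonzero degree and the
  functional vanishes on them. So only degree -k has to be checked; the rest is linearity and
  density.\<close>

lemma trace_of_commute_graded:
  assumes L: "circle_functional L" and t: "graded k t"
    and mono: "\<And>f. ccont f \<Longrightarrow>
      trace_of L (t \<otimes> (F f \<otimes> xpow (- k))) = trace_of L ((F f \<otimes> xpow (- k)) \<otimes> t)"
    and b: "b \<in> carrier A"
  shows "trace_of L (t \<otimes> b) = trace_of L (b \<otimes> t)"
  using b
proof (induction rule: carrier_induct)
  case (monomial f n)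
  note h = graded_monomial[OF monomial, of n]
  show ?case
    using mono[OF monomial] trace_of_graded[OF L graded_mult[OF t h]]
      trace_of_graded[OF L graded_mult[OF h t]]
    by (cases "n = - k") auto
next
  case (add a b)
  then show ?case using graded_closed[OF t] L by (simp add: trace_of_add ring_simps(13) ring_simps(23))
next
  case (limit a)
  have "trace_of L (a \<otimes> t) = trace_of L (t \<otimes> a)"
  proof (rule trace_of_commute_limit[OF L limit(1) graded_closed[OF t]])
    fix e :: real assume "0 < e"
    then show "\<exists>s\<in>carrier A. trace_of L (s \<otimes> t) = trace_of L (t \<otimes> s) \<and> nrm A (a \<ominus> s) < e"
      using limit(2)[of e] by metis
  qed
  then show ?case by simp
qed

lemma trace_of_commute_F:
  assumes L: "circle_functional L" and g: "ccont g" and b: "b \<in> carrier A"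
  shows "trace_of L (F g \<otimes> b) = trace_of L (b \<otimes> F g)"
proof (rule trace_of_commute_graded[OF L graded_F[OF g] _ b])
  fix f :: "complex \<Rightarrow> complex" assume f: "ccont f"
  then have "F g \<otimes> F f = F f \<otimes> F g" using g by (simp add: F.mult[symmetric] mult.commute)
  then show "trace_of L (F g \<otimes> (F f \<otimes> xpow (- 0))) = trace_of L ((F f \<otimes> xpow (- 0)) \<otimes> F g)"
    using f by (simp add: F.closed)
qed

text \<open>The trace identity for the pair \<open>x \<otimes> F h\<close> and
  \<open>adj A x\<close>, written as a condition on functions of \<open>w\<close>.\<close>

definition admissible :: "((complex \<Rightarrow> complex) \<Rightarrow> complex) \<Rightarrow> bool" where
  "admissible L \<longleftrightarrow> circle_functional L \<and>
     (\<forall>h. ccont h \<longrightarrow> L (rot (-1) (\<lambda>z. h z * weight z)) = L (\<lambda>z. h z * weight z))"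

lemma trace_of_commute_x:
  assumes L: "admissible L" and b: "b \<in> carrier A"
  shows "trace_of L (x \<otimes> b) = trace_of L (b \<otimes> x)"
proof (rule trace_of_commute_graded[OF _ graded_x _ b])
  show L': "circle_functional L" using L by (simp add: admissible_def)
  fix f :: "complex \<Rightarrow> complex" assume f: "ccont f"
  let ?h = "\<lambda>z. f z * weight z"
  note c = continuous_rot[OF f, of "-1"] continuous_rot[OF continuous_weight, of "-1"]
  have h: "ccont ?h" using f continuous_weight by (rule continuous_on_mult)
  have p: "xpow (- 1) = adj A x" using xpow_nonpos[of 1] by simp
  have "x \<otimes> (F f \<otimes> adj A x) = (x \<otimes> F f) \<otimes> adj A x" using f by (simp add: F.closed ring_simps)
  also have "\<dots> = F (rot (-1) f) \<otimes> F (rot (-1) weight)"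
    unfolding x_F[OF f] F_unrot_weight using F.closed[OF c(1)] by (simp add: ring_simps)
  also have "\<dots> = F (rot (-1) ?h)" unfolding F.mult[OF c, symmetric] by (simp add: rot_def[abs_def])
  finally have 1: "x \<otimes> (F f \<otimes> xpow (- 1)) = F (rot (-1) ?h)" by (simp only: p)
  have "(F f \<otimes> adj A x) \<otimes> x = F f \<otimes> F weight" using f by (simp add: F_weight F.closed ring_simps)
  then have 2: "(F f \<otimes> xpow (- 1)) \<otimes> x = F ?h" using F.mult[OF f continuous_weight] by (simp only: p)
  show "trace_of L (x \<otimes> (F f \<otimes> xpow (- 1))) = trace_of L ((F f \<otimes> xpow (- 1)) \<otimes> x)"
    unfolding 1 2 using trace_of_F[OF L' continuous_rot[OF h]] trace_of_F[OF L' h] L f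
    by (simp add: admissible_def)
qed

text \<open>Admissibility suffices here too, now applied to \<open>rot 1 f\<close>: moving f past
  the adjoint of x rotates it the other way.\<close>

lemma trace_of_commute_adj_x:
  assumes L: "admissible L" and b: "b \<in> carrier A"
  shows "trace_of L (adj A x \<otimes> b) = trace_of L (b \<otimes> adj A x)"
proof (rule trace_of_commute_graded[OF _ graded_adj_x _ b])
  show L': "circle_functional L" using L by (simp add: admissible_def)
  fix f :: "complex \<Rightarrow> complex" assume f: "ccont f"
  let ?h = "\<lambda>z. rot 1 f z * weight z"
  note c = continuous_rot[OF f, of 1] continuous_rot[OF continuous_weight, of "-1"]
  have h: "ccont ?h" using c(1) continuous_weight by (rule continuous_on_mult)
  have p: "xpow (- (- 1)) = x" using xpow_nonneg[of 1] by simp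
  have "adj A x \<otimes> (F f \<otimes> x) = (adj A x \<otimes> F f) \<otimes> x" using f by (simp add: F.closed ring_simps)
  also have "\<dots> = F (rot 1 f) \<otimes> F weight"
    unfolding adj_x_F[OF f] F_weight using F.closed[OF c(1)] by (simp add: ring_simps)
  finally have 1: "adj A x \<otimes> (F f \<otimes> xpow (- (- 1))) = F ?h"
    using F.mult[OF c(1) continuous_weight] by (simp only: p)
  have "(F f \<otimes> x) \<otimes> adj A x = F f \<otimes> F (rot (-1) weight)"
    using f by (simp add: F_unrot_weight F.closed ring_simps)
  also have "\<dots> = F (\<lambda>z. rot (-1) (rot 1 f) z * rot (-1) weight z)"
    using F.mult[OF f c(2)] by (simp add: rot_rot)
  also have "(\<lambda>z. rot (-1) (rot 1 f) z * rot (-1) weight z) = rot (-1) ?h"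
    by (simp add: fun_eq_iff rot_def)
  finally have 2: "(F f \<otimes> xpow (- (- 1))) \<otimes> adj A x = F (rot (-1) ?h)" by (simp only: p)
  show "trace_of L (adj A x \<otimes> (F f \<otimes> xpow (- (- 1)))) = trace_of L ((F f \<otimes> xpow (- (- 1))) \<otimes> adj A x)"
    unfolding 1 2 using trace_of_F[OF L' continuous_rot[OF h]] trace_of_F[OF L' h] L c(1)
    by (simp add: admissible_def)
qed

text \<open>The elements that commute with everything under the functional are closed under sums,
  products and limits, so the functions of \<open>w\<close>, x and its adjoint are enough.\<close>

lemma trace_of_Tr:
  assumes L: "admissible L" shows "trace_of L \<in> Tr A"
proof -
  have L': "circle_functional L" using L by (simp add: admissible_def)
  let ?C = "\<lambda>a. \<forall>b\<in>carrier A. trace_of L (a \<otimes> b) = trace_of L (b \<otimes> a)"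
  have C_add: "?C (a \<oplus> b)" if "?C a" "?C b" "a \<in> carrier A" "b \<in> carrier A" for a b
    using that L' by (simp add: trace_of_add ring_simps(13) ring_simps(23))
  have C_mult: "?C (a \<otimes> b)" if C: "?C a" "?C b" and ab: "a \<in> carrier A" "b \<in> carrier A" for a b
  proof
    fix c assume c: "c \<in> carrier A"
    have "trace_of L ((a \<otimes> b) \<otimes> c) = trace_of L (a \<otimes> (b \<otimes> c))" using ab c by (simp add: ring_simps)
    also have "\<dots> = trace_of L (b \<otimes> (c \<otimes> a))" using C(1) ab c by (simp add: ring_simps(11))
    also have "\<dots> = trace_of L (c \<otimes> (a \<otimes> b))" using C(2) ab c by (simp add: ring_simps(11))
    finally show "trace_of L ((a \<otimes> b) \<otimes> c) = trace_of L (c \<otimes> (a \<otimes> b))" .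
  qed
  have C_pow: "?C (a [^] k)" if "?C a" "a \<in> carrier A" for a and k :: nat
  proof (induction k)
    case (Suc k)
    show ?case unfolding pow_Suc
      by (intro C_mult Suc that pow_closed)
  qed (simp add: pow_0)
  have "?C a" if "a \<in> carrier A" for a
    using that
  proof (induction rule: carrier_induct)
    case (monomial f n)
    have "?C (x [^] k)" "?C (adj A x [^] k)" for k :: nat
      using trace_of_commute_x[OF L] trace_of_commute_adj_x[OF L]
      by (intro C_pow ballI x_closed adj_x_closed; simp)+
    then have "?C (xpow n)" unfolding xpow_def by (cases "0 \<le> n") (simp_all only: if_True if_False)
    then show ?case using trace_of_commute_F[OF L' monomial] by (intro C_mult F.closed monomial xpow_closed) blast
  next
    case (add a b) then show ?case by (intro C_add)
  next
    case (limit a)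
    show ?case
    proof
      fix b assume b: "b \<in> carrier A"
      show "trace_of L (a \<otimes> b) = trace_of L (b \<otimes> a)"
        by (rule trace_of_commute_limit[OF L' limit(1) b]) (use limit(2) b in metis)
    qed
  qed
  then show ?thesis
    using trace_of_add[OF L'] trace_of_scale[OF L'] trace_of_bound[OF L']
    by (auto simp: Tr_def) (simp add: trace_of_def)
qed

section \<open>From traces to functionals on the circle\<close>

lemma TrD:
  assumes "\<psi> \<in> Tr A"
  shows "a \<notin> carrier A \<Longrightarrow> \<psi> a = 0"
    and "a \<in> carrier A \<Longrightarrow> b \<in> carrier A \<Longrightarrow> \<psi> (a \<oplus> b) = \<psi> a + \<psi> b"
    and "a \<in> carrier A \<Longrightarrow> \<psi> (c \<odot> a) = c * \<psi> a"
    and "\<exists>K. \<forall>a\<in>carrier A. cmod (\<psi> a) \<le> K * nrm A a"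
    and "a \<in> carrier A \<Longrightarrow> b \<in> carrier A \<Longrightarrow> \<psi> (a \<otimes> b) = \<psi> (b \<otimes> a)"
  using assms by (auto simp: Tr_def)

lemma Tr_bound:
  assumes "\<psi> \<in> Tr A"
  obtains K where "0 \<le> K" "\<And>a. a \<in> carrier A \<Longrightarrow> cmod (\<psi> a) \<le> K * nrm A a"
proof -
  obtain K where K: "\<forall>a\<in>carrier A. cmod (\<psi> a) \<le> K * nrm A a" using TrD(4)[OF assms] by blast
  have "cmod (\<psi> a) \<le> max 0 K * nrm A a" if "a \<in> carrier A" for a
  proof -
    have "K * nrm A a \<le> max 0 K * nrm A a" using nrm_nonneg[OF that] by (intro mult_right_mono) auto
    then show ?thesis using K that by force
  qed
  then show ?thesis using that[of "max 0 K"] by simp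
qed

lemma Tr_diff: "\<psi> \<in> Tr A \<Longrightarrow> a \<in> carrier A \<Longrightarrow> b \<in> carrier A \<Longrightarrow> \<psi> (a \<ominus> b) = \<psi> a - \<psi> b"
  using TrD(2)[of \<psi> a "(-1) \<odot> b"] TrD(3)[of \<psi> b "-1"] by (simp add: a_minus_def sc_minus_one)

lemma Tr_admissible:
  assumes \<psi>: "\<psi> \<in> Tr A" shows "admissible (\<lambda>f. \<psi> (F f))"
proof -
  obtain K where K: "0 \<le> K" "\<And>a. a \<in> carrier A \<Longrightarrow> cmod (\<psi> a) \<le> K * nrm A a"
    using Tr_bound[OF \<psi>] by metis
  have "cmod (\<psi> (F f)) \<le> K * B" if f: "ccont f" "\<forall>z\<in>circle. cmod (f z) \<le> B" for f B
    using K(2)[OF F.closed[OF f(1)]] mult_left_mono[OF F.contractive[OF f(1), of B] K(1)] f(2) by simp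
  then have "circle_functional (\<lambda>f. \<psi> (F f))"
    unfolding circle_functional_def using K(1) TrD(2,3)[OF \<psi>] by (auto simp: F.add F.scale F.closed)
  moreover have "\<psi> (F (rot (-1) (\<lambda>z. h z * weight z))) = \<psi> (F (\<lambda>z. h z * weight z))"
    if h: "ccont h" for h
  proof -
    have "rot (-1) (\<lambda>z. h z * weight z) = (\<lambda>z. rot (-1) h z * rot (-1) weight z)"
      by (simp add: fun_eq_iff rot_def)
    then have "F (rot (-1) (\<lambda>z. h z * weight z)) = F (rot (-1) h) \<otimes> (x \<otimes> adj A x)"
      using F.mult[OF continuous_rot[OF h] continuous_rot[OF continuous_weight], of "-1" "-1"]
      by (simp add: F_unrot_weight)
    also have "\<dots> = (x \<otimes> F h) \<otimes> adj A x"
      using F.closed[OF continuous_rot[OF h]] F.closed[OF h] unfolding x_F[OF h] by (simp add: ring_simps)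
    finally have "\<psi> (F (rot (-1) (\<lambda>z. h z * weight z))) = \<psi> (adj A x \<otimes> (x \<otimes> F h))"
      using TrD(5)[OF \<psi>, of "x \<otimes> F h" "adj A x"] F.closed[OF h] by simp
    also have "adj A x \<otimes> (x \<otimes> F h) = F weight \<otimes> F h"
      using F.closed[OF h] by (simp add: F_weight ring_simps)
    also have "\<dots> = F (\<lambda>z. h z * weight z)"
      using F.mult[OF continuous_weight h] by (simp add: mult.commute)
    finally show ?thesis .
  qed
  ultimately show ?thesis by (simp add: admissible_def)
qed

text \<open>Commuting with \<open>w\<close> multiplies a monomial of degree \<open>n\<close> by \<open>\<lambda>\<^sup>n \<noteq> 1\<close>.\<close>

lemma Tr_monomial:
  assumes \<psi>: "\<psi> \<in> Tr A" and f: "ccont f" and n: "n \<noteq> 0"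
  shows "\<psi> (F f \<otimes> xpow n) = 0"
proof -
  \<comment> \<open>Splits off a factor \<open>w\<close>: on the circle z times g(z) is
    f(z).\<close>
  define g where "g = (\<lambda>z. cnj z * f z)"
  have g: "ccont g" unfolding g_def using f by (intro continuous_intros)
  have id: "ccont (\<lambda>z::complex. z)" by (intro continuous_intros)
  have zg: "F (\<lambda>z. z * g z) = F f"
    using f g by (intro F.cong continuous_intros)
      (simp_all add: g_def mult.assoc[symmetric] complex_norm_square[symmetric])
  have "w \<otimes> (F g \<otimes> xpow n) = F f \<otimes> xpow n"
    using F.mult[OF id g] zg F.closed[OF g] by (simp add: F_id ring_simps)
  moreover have "(F g \<otimes> xpow n) \<otimes> w = lam powi (- n) \<odot> (F f \<otimes> xpow n)"
  proof -
    have "(F g \<otimes> xpow n) \<otimes> w = F g \<otimes> (lam powi (- n) \<odot> (w \<otimes> xpow n))"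
      unfolding xpow_w[symmetric] using F.closed[OF g] by (simp add: ring_simps)
    also have "\<dots> = lam powi (- n) \<odot> ((F g \<otimes> F (\<lambda>z. z)) \<otimes> xpow n)"
      using F.closed[OF g] by (simp add: smult_mult_right F_id ring_simps)
    also have "F g \<otimes> F (\<lambda>z. z) = F f" using F.mult[OF g id] zg by (simp add: mult.commute)
    finally show ?thesis .
  qed
  ultimately have "\<psi> (F f \<otimes> xpow n) = lam powi (- n) * \<psi> (F f \<otimes> xpow n)"
    using TrD(5)[OF \<psi>, of w "F g \<otimes> xpow n"] TrD(3)[OF \<psi>, of "F f \<otimes> xpow n" "lam powi (- n)"]
      F.closed[OF f] F.closed[OF g] by simp
  moreover have "lam powi (- n) \<noteq> 1" using rot_unit_powi_eq_1[OF irrational, of "- n"] n by simp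
  ultimately show ?thesis by simp
qed

lemma Tr_eqI:
  assumes \<psi>: "\<psi> \<in> Tr A" and \<phi>: "\<phi> \<in> Tr A"
    and eq: "\<And>f. ccont f \<Longrightarrow> \<psi> (F f) = \<phi> (F f)"
  shows "\<psi> = \<phi>"
proof
  fix a
  show "\<psi> a = \<phi> a"
  proof (cases "a \<in> carrier A")
    case True
    then show ?thesis
    proof (induction rule: carrier_induct)
      case (monomial f n)
      then show ?case using Tr_monomial[OF \<psi>, of f n] Tr_monomial[OF \<phi>, of f n] eq[of f]
        by (cases "n = 0") (simp_all add: F.closed)
    next
      case (add a b) then show ?case by (simp add: TrD(2)[OF \<psi>] TrD(2)[OF \<phi>])
    next
      case (limit a)
      obtain K where K: "0 \<le> K" "\<And>a. a \<in> carrier A \<Longrightarrow> cmod (\<psi> a) \<le> K * nrm A a"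
        using Tr_bound[OF \<psi>] by metis
      obtain M where M: "0 \<le> M" "\<And>a. a \<in> carrier A \<Longrightarrow> cmod (\<phi> a) \<le> M * nrm A a"
        using Tr_bound[OF \<phi>] by metis
      have "cmod (\<psi> a - \<phi> a) \<le> 0 + e" if e: "0 < e" for e
      proof -
        define d where "d = e / (K + M + 1)"
        have d: "0 < d" "d * (K + M + 1) = e" using e K(1) M(1) by (simp_all add: d_def)
        obtain b where b: "b \<in> carrier A" "\<psi> b = \<phi> b" "nrm A (a \<ominus> b) < d" using limit(2)[OF d(1)] by blast
        have "\<psi> a - \<phi> a = \<psi> (a \<ominus> b) - \<phi> (a \<ominus> b)"
          using b limit(1) \<psi> \<phi> by (simp add: Tr_diff)
        also have "cmod \<dots> \<le> K * nrm A (a \<ominus> b) + M * nrm A (a \<ominus> b)"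
          using norm_triangle_ineq4[of "\<psi> (a \<ominus> b)" "\<phi> (a \<ominus> b)"] K(2)[of "a \<ominus> b"] M(2)[of "a \<ominus> b"] b limit(1)
          by simp
        also have "\<dots> \<le> K * d + M * d" using b K(1) M(1) by (intro add_mono mult_left_mono) auto
        also have "\<dots> \<le> e" using d by (simp add: algebra_simps)
        finally show ?thesis by simp
      qed
      then have "cmod (\<psi> a - \<phi> a) \<le> 0" by (rule field_le_epsilon)
      then show ?case by simp
    qed
  qed (simp add: TrD(1)[OF \<psi>] TrD(1)[OF \<phi>])
qed

end

text \<open>Duality between \<open>b\<close> and the coordinate functionals \<phi> gives
  independence, and the expansion formula gives spanning; the two facts about traces can thus be
  proved by evaluating functionals.\<close>

lemma cfun_dim_biorthogonal:
  fixes b :: "'i \<Rightarrow> 'a \<Rightarrow> complex" and \<phi> :: "'i \<Rightarrow> ('a \<Rightarrow> complex) \<Rightarrow> complex"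
  assumes I: "finite I" and b: "b ` I \<subseteq> V"
    and add: "\<And>i u v. \<phi> i (u + v) = \<phi> i u + \<phi> i v"
    and scale: "\<And>i c u. \<phi> i (\<lambda>a. c * u a) = c * \<phi> i u"
    and dual: "\<And>i j. i \<in> I \<Longrightarrow> j \<in> I \<Longrightarrow> \<phi> i (b j) = (if i = j then 1 else 0)"
    and span: "\<And>v. v \<in> V \<Longrightarrow> v = (\<Sum>i\<in>I. (\<lambda>a. \<phi> i v * b i a))"
  shows "cfun.dim V = card I"
proof -
  have inj: "inj_on b I"
    by (rule inj_onI) (metis dual zero_neq_one)
  have zero: "\<phi> i 0 = 0" for i using scale[of i 0 0] by (simp add: zero_fun_def)
  have sum: "\<phi> i (\<Sum>j\<in>J. (\<lambda>a. u j * b j a)) = (\<Sum>j\<in>J. u j * \<phi> i (b j))" if "finite J" for i u J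
    using that by (induction J rule: finite_induct) (simp_all only: sum.empty sum.insert zero add scale simp_thms)
  have "\<not> cfun.dependent (b ` I)"
  proof
    assume "cfun.dependent (b ` I)"
    then obtain u i where i: "i \<in> I" "u (b i) \<noteq> 0" and 0: "(\<Sum>v\<in>b ` I. (\<lambda>a. u v * v a)) = 0"
      using cfun.dependent_finite[of "b ` I"] I by auto
    have "(\<Sum>j\<in>I. (\<lambda>a. u (b j) * b j a)) = 0" using 0 inj by (simp add: sum.reindex)
    then have "(\<Sum>j\<in>I. u (b j) * \<phi> i (b j)) = 0" using sum[OF I, of i "\<lambda>j. u (b j)"] by (simp add: zero)
    also have "(\<Sum>j\<in>I. u (b j) * \<phi> i (b j)) = (\<Sum>j\<in>I. if i = j then u (b j) else 0)"
      using dual[OF i(1)] by (intro sum.cong) auto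
    also have "\<dots> = u (b i)" using I i(1) by simp
    finally show False using i(2) by simp
  qed
  moreover have "V \<subseteq> cfun.span (b ` I)"
  proof
    fix v assume "v \<in> V"
    then have "v = (\<Sum>i\<in>I. (\<lambda>a. \<phi> i v * b i a))" by (rule span)
    also have "\<dots> \<in> cfun.span (b ` I)"
      by (intro cfun.span_sum cfun.span_scale cfun.span_base) auto
    finally show "v \<in> cfun.span (b ` I)" .
  qed
  ultimately show ?thesis using b inj by (intro cfun.dim_unique[of "b ` I"]) (auto simp: card_image)
qed

section \<open>Combinations and Fourier coefficients of functionals\<close>

lemma circle_functional_lincomb:
  assumes L: "circle_functional L" and M: "circle_functional M"
  shows "circle_functional (\<lambda>f. L f + c * M f)"
proof -
  define K where "K = bound_of L"
  note K = bound_of[OF L, folded K_def]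
  define K' where "K' = bound_of M"
  note K' = bound_of[OF M, folded K'_def]
  have "cmod (L f + c * M f) \<le> (K + cmod c * K') * B"
    if "ccont f" "\<forall>z\<in>circle. cmod (f z) \<le> B" for f B
  proof -
    have "cmod (L f + c * M f) \<le> cmod (L f) + cmod c * cmod (M f)"
      by (metis norm_mult norm_triangle_ineq)
    also have "\<dots> \<le> K * B + cmod c * (K' * B)"
      using K(2)[of f B] K'(2)[of f B] that by (intro add_mono mult_left_mono) auto
    finally show ?thesis by (simp add: algebra_simps)
  qed
  then have "\<exists>K\<ge>0. \<forall>f B. ccont f \<and> (\<forall>z\<in>circle. cmod (f z) \<le> B) \<longrightarrow> cmod (L f + c * M f) \<le> K * B"
    using K(1) K'(1) by (intro exI[of _ "K + cmod c * K'"]) simp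
  then show ?thesis
    unfolding circle_functional_def
    by (simp add: circle_functional_add[OF L] circle_functional_add[OF M] circle_functional_scale[OF L]
        circle_functional_scale[OF M] algebra_simps)
qed

lemma circle_functional_zero: "circle_functional (\<lambda>f. 0)"
  by (auto simp: circle_functional_def intro!: exI[of _ 0])

lemma circle_functional_sum:
  assumes "finite I" "\<And>i. i \<in> I \<Longrightarrow> circle_functional (L i)"
  shows "circle_functional (\<lambda>f. \<Sum>i\<in>I. c i * L i f)"
  using assms
proof (induction I rule: finite_induct)
  case (insert i I)
  have "circle_functional (\<lambda>f. (\<Sum>i\<in>I. c i * L i f) + c i * L i f)"
    using insert by (intro circle_functional_lincomb) auto
  then show ?case using insert by (simp add: add.commute)
qed (simp add: circle_functional_zero)

lemma circle_functional_eval: "p \<in> circle \<Longrightarrow> circle_functional (\<lambda>f. f p)"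
  unfolding circle_functional_def by (intro conjI exI[of _ 1]) auto

text \<open>Multiplication by \<open>f\<close> preserves the functions all of whose Fourier coefficients are annihilated
  by \<open>L\<close>; unlike the conclusion itself, this is stable under products.\<close>

lemma circle_functional_powi:
  assumes L: "circle_functional L" and mono: "\<And>n. L (\<lambda>z. z powi n) = 0" and f: "ccont f"
  shows "L f = 0"
proof -
  define N where "N = {g. ccont g \<and> (\<forall>n. L (\<lambda>z. g z * z powi n) = 0)}"
  have cont: "ccont (\<lambda>z. g z * z powi n)" if "ccont g" for g n
    using that by (intro continuous_intros) auto
  have main: "\<forall>g\<in>N. (\<lambda>z. f z * g z) \<in> N"
    using f
  proof (induction rule: circle_induct)
    case (const c)
    show ?case
      by (auto simp: N_def mult.assoc circle_functional_scale[OF L] cont continuous_on_mult)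
  next
    case id
    show ?case
    proof
      fix g assume g: "g \<in> N"
      have c: "ccont (\<lambda>z. z * g z)" using g by (auto simp: N_def intro: continuous_intros)
      have "z * g z * z powi n = g z * z powi (n + 1)" if "z \<in> circle" for z n
      proof -
        have "z \<noteq> 0" using that by auto
        then show ?thesis by (simp add: power_int_add)
      qed
      then have "L (\<lambda>z. z * g z * z powi n) = L (\<lambda>z. g z * z powi (n + 1))" for n
        using g by (intro circle_functional_cong[OF L] cont c) (auto simp: N_def)
      then show "(\<lambda>z. z * g z) \<in> N" using g c by (simp add: N_def)
    qed
  next
    case cnj
    show ?case
    proof
      fix g assume g: "g \<in> N"
      have c: "ccont (\<lambda>z. cnj z * g z)" using g by (auto simp: N_def intro: continuous_intros)
      have "cnj z * g z * z powi n = g z * z powi (n - 1)" if "z \<in> circle" for z n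
      proof -
        have "z \<noteq> 0" "cnj z = inverse z" using that complex_div_cnj[of 1 z] by (auto simp: inverse_eq_divide)
        then show ?thesis by (simp add: power_int_diff divide_inverse)
      qed
      then have "L (\<lambda>z. cnj z * g z * z powi n) = L (\<lambda>z. g z * z powi (n - 1))" for n
        using g by (intro circle_functional_cong[OF L] cont c) (auto simp: N_def)
      then show "(\<lambda>z. cnj z * g z) \<in> N" using g c by (simp add: N_def)
    qed
  next
    case (add f h)
    show ?case
    proof
      fix g assume "g \<in> N"
      then have *: "(\<lambda>z. f z * g z) \<in> N" "(\<lambda>z. h z * g z) \<in> N" using add by auto
      then have "L (\<lambda>z. (f z * g z) * z powi n + (h z * g z) * z powi n) = 0" for n
        by (subst circle_functional_add[OF L]) (auto simp: N_def cont)
      then show "(\<lambda>z. (f z + h z) * g z) \<in> N"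
        using * by (auto simp: N_def distrib_right intro: continuous_on_add)
    qed
  next
    case (mult f h)
    then show ?case by (simp add: mult.assoc)
  next
    case (limit f)
    show ?case
    proof
      fix g assume g: "g \<in> N"
      then have gc: "ccont g" by (simp add: N_def)
      obtain M where M: "0 < M" "\<forall>z\<in>circle. cmod (g z) \<le> M" using circle_bounded[OF gc] .
      have fg: "ccont (\<lambda>z. f z * g z)" using limit(1) gc by (rule continuous_on_mult)
      have "L (\<lambda>z. f z * g z * z powi n) = 0" for n
      proof (rule circle_functional_limit[OF L cont[OF fg]])
        fix e :: real assume "0 < e"
        then have eM: "0 < e / M" using M(1) by simp
        then obtain h where h: "ccont h" "\<forall>g\<in>N. (\<lambda>z. h z * g z) \<in> N"
          "\<forall>z\<in>circle. cmod (f z - h z) < e / M" using limit(2) by blast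
        have "cmod (f z * g z * z powi n - h z * g z * z powi n) \<le> e" if z: "z \<in> circle" for z
        proof -
          have "f z * g z * z powi n - h z * g z * z powi n = (f z - h z) * g z * z powi n"
            by (simp add: algebra_simps)
          also have "cmod \<dots> = cmod (f z - h z) * cmod (g z)"
            using z by (simp add: norm_mult norm_power_int)
          also have "\<dots> \<le> (e / M) * M" using z h(3) M eM by (intro mult_mono) (auto intro: less_imp_le)
          finally show ?thesis using M(1) by simp
        qed
        then show "\<exists>k. ccont k \<and> L k = 0 \<and>
            (\<forall>z\<in>circle. cmod (f z * g z * z powi n - k z) \<le> e)"
          using h(2) g by (intro exI[of _ "\<lambda>z. h z * g z * z powi n"]) (auto simp: N_def cont)
      qed
      then show "(\<lambda>z. f z * g z) \<in> N" using fg by (simp add: N_def)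
    qed
  qed
  have "(\<lambda>z. 1) \<in> N" using mono by (simp add: N_def)
  from bspec[OF main this] have "\<forall>n. L (\<lambda>z. f z * z powi n) = 0" by (simp add: N_def)
  from spec[OF this, of 0] show ?thesis by simp
qed

section \<open>The Haar measure of the circle\<close>

definition haar :: "(complex \<Rightarrow> complex) \<Rightarrow> complex" where
  "haar f = integral {0..1} (\<lambda>t::real. f (exp (2 * of_real pi * \<i> * of_real t)))"

lemma exp_circle: "exp (2 * of_real pi * \<i> * of_real t) \<in> circle"
  by (simp add: mult.commute[of _ \<i>] mult.assoc)

lemma haar_continuous:
  fixes f :: "complex \<Rightarrow> complex"
  assumes "ccont f"
  shows "continuous_on {0..1} (\<lambda>t::real. f (exp (2 * of_real pi * \<i> * of_real t)))"
  using exp_circle by (intro continuous_on_compose2[OF assms] continuous_intros) auto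

lemmas haar_integrable = integrable_continuous_real[OF haar_continuous]

lemma circle_functional_haar: "circle_functional haar"
  unfolding circle_functional_def
proof (intro conjI allI impI exI[of _ 1])
  fix f g :: "complex \<Rightarrow> complex" assume "ccont f \<and> ccont g"
  then show "haar (\<lambda>z. f z + g z) = haar f + haar g"
    unfolding haar_def by (intro Henstock_Kurzweil_Integration.integral_add haar_integrable) auto
next
  fix f :: "complex \<Rightarrow> complex" and B assume f: "ccont f \<and> (\<forall>z\<in>circle. cmod (f z) \<le> B)"
  then have "cmod (haar f) \<le> B * (1 - 0)"
    unfolding haar_def using exp_circle by (intro integral_bound haar_continuous) auto
  then show "cmod (haar f) \<le> 1 * B" by simp
qed (simp_all add: haar_def)

lemma haar_one: "haar (\<lambda>z. 1) = 1"
  by (simp add: haar_def)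

lemma haar_powi:
  assumes "n \<noteq> 0" shows "haar (\<lambda>z. z powi n) = 0"
proof -
  define a where "a = 2 * of_real pi * \<i> * of_int n"
  have a: "a \<noteq> 0" using assms by (simp add: a_def)
  have "((\<lambda>t. exp (a * of_real t)) has_integral exp (a * of_real 1) / a - exp (a * of_real 0) / a) {0..1}"
  proof (rule fundamental_theorem_of_calculus)
    fix t :: real
    have "((\<lambda>z. exp (a * z) / a) has_field_derivative exp (a * of_real t)) (at (of_real t))"
      using a by (auto intro!: derivative_eq_intros)
    then show "((\<lambda>t. exp (a * of_real t) / a) has_vector_derivative exp (a * of_real t)) (at t within {0..1})"
      by (rule has_vector_derivative_real_field)
  qed simp
  moreover have "exp a = 1"
    unfolding a_def exp_eq_1 by (auto intro!: exI[of _ n])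
  moreover have "exp (2 * of_real pi * \<i> * of_real t) powi n = exp (a * of_real t)" for t :: real
    by (simp add: exp_power_int a_def algebra_simps)
  ultimately show ?thesis by (simp add: haar_def integral_unique)
qed

text \<open>Tietze extension from a finite set. Keeping the bound B matters: it gives test functions
  in the unit ball however many points are prescribed.\<close>

lemma interpolate:
  fixes v :: "complex \<Rightarrow> complex"
  assumes "finite S" "\<And>p. p \<in> S \<Longrightarrow> cmod (v p) \<le> B" "0 \<le> B"
  obtains f where "ccont f" "\<And>p. p \<in> S \<Longrightarrow> f p = v p" "\<And>z. cmod (f z) \<le> B"
proof -
  have "continuous_on S v" using assms(1) by (rule continuous_on_finite)
  moreover have "closedin (top_of_set UNIV) S" using assms(1) by (simp add: finite_imp_closed)
  ultimately obtain f where "continuous_on UNIV f" "\<And>p. p \<in> S \<Longrightarrow> f p = v p" "\<And>z. z \<in> UNIV \<Longrightarrow> cmod (f z) \<le> B"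
    using Tietze[of S v UNIV B] assms(2,3) by metis
  then show ?thesis using that[of f] continuous_on_subset by blast
qed

section \<open>Coboundaries under the rotation\<close>

context rotation_algebra
begin

text \<open>For integration against a measure this is integration against its image under the
  inverse rotation, minus the measure itself.\<close>

definition cobound :: "((complex \<Rightarrow> complex) \<Rightarrow> complex) \<Rightarrow> (complex \<Rightarrow> complex) \<Rightarrow> complex" where
  "cobound L f = L (rot (-1) f) - L f"

lemma circle_functional_rot:
  assumes L: "circle_functional L" shows "circle_functional (\<lambda>f. L (rot n f))"
proof -
  define K where "K = bound_of L"
  note K = bound_of[OF L, folded K_def]
  have "cmod (L (rot n f)) \<le> K * B" if "ccont f" "\<forall>z\<in>circle. cmod (f z) \<le> B" for f B
    using that by (intro K continuous_rot) (simp_all add: rot_def norm_mult)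
  moreover have "rot n (\<lambda>z. f z + g z) = (\<lambda>z. rot n f z + rot n g z)"
    "rot n (\<lambda>z. c * f z) = (\<lambda>z. c * rot n f z)" for f g c
    by (simp_all add: fun_eq_iff rot_def)
  ultimately show ?thesis
    unfolding circle_functional_def using K(1)
    by (auto simp: circle_functional_add[OF L] circle_functional_scale[OF L] continuous_rot)
qed

lemma circle_functional_cobound: "circle_functional L \<Longrightarrow> circle_functional (cobound L)"
  using circle_functional_lincomb[OF circle_functional_rot, of L L "-1" "-1"]
  unfolding cobound_def[abs_def] by simp

lemma rot_powi: "rot m (\<lambda>z. z powi n) = (\<lambda>z. (lam powi m) powi n * z powi n)"
  by (simp add: fun_eq_iff rot_def power_int_mult_distrib)

lemma rot_const [simp]: "rot m (\<lambda>z. c) = (\<lambda>z. c)"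
  by (simp add: fun_eq_iff rot_def)

lemma rot_eval: "rot (-1) f (lam powi n * p) = f (lam powi (n - 1) * p)"
  by (simp add: rot_def power_int_minus power_int_diff divide_inverse ac_simps)

lemma cobound_add_eval:
  "cobound (\<lambda>f. L f + c * f p) f = cobound L f + c * (rot (-1) f p - f p)"
  by (simp add: cobound_def algebra_simps)

text \<open>Rotation invariance, tested on integer powers: the inverse rotation multiplies a power
  by a scalar, and its integral is 0 unless the exponent is 0.\<close>

lemma cobound_haar:
  assumes "ccont f" shows "cobound haar f = 0"
proof (rule circle_functional_powi[OF circle_functional_cobound[OF circle_functional_haar] _ assms])
  fix n :: int
  have c: "ccont (\<lambda>z. z powi n)" by (intro continuous_intros) auto
  show "cobound haar (\<lambda>z. z powi n) = 0"
    by (cases "n = 0")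
      (simp_all add: cobound_def rot_powi circle_functional_scale[OF circle_functional_haar c] haar_powi)
qed

text \<open>Unique ergodicity of the irrational rotation. Invariance gives
  \<open>lam powi (- n)\<close> times L(z^n) = L(z^n), so every L(z^n) with n different from 0
  vanishes and L agrees with a multiple of Haar measure on all integer powers.\<close>

lemma invariant_functional:
  assumes L: "circle_functional L" and inv: "\<And>f. ccont f \<Longrightarrow> cobound L f = 0"
    and f: "ccont f"
  shows "L f = L (\<lambda>z. 1) * haar f"
proof -
  have "L f + (- L (\<lambda>z. 1)) * haar f = 0"
  proof (rule circle_functional_powi[OF circle_functional_lincomb[OF L circle_functional_haar] _ f])
    fix n :: int
    show "L (\<lambda>z. z powi n) + (- L (\<lambda>z. 1)) * haar (\<lambda>z. z powi n) = 0"
    proof (cases "n = 0")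
      case True then show ?thesis by (simp add: haar_one)
    next
      case False
      have c: "ccont (\<lambda>z. z powi n)" by (intro continuous_intros) auto
      have "(lam powi (-1)) powi n = lam powi (- n)" by (simp add: power_int_minus power_int_inverse)
      then have "lam powi (- n) * L (\<lambda>z. z powi n) - L (\<lambda>z. z powi n) = 0"
        using inv[OF c] by (simp add: cobound_def rot_powi circle_functional_scale[OF L c])
      moreover have "lam powi (- n) \<noteq> 1" using rot_unit_powi_eq_1[OF irrational, of "- n"] False by simp
      ultimately have "L (\<lambda>z. z powi n) = 0" by (simp add: left_diff_distrib[symmetric] flip: mult_1) 
      then show ?thesis using haar_powi[OF False] by simp
    qed
  qed
  then show ?thesis by simp
qed

text \<open>The functions \<open>f \<gamma> / (\<gamma> + d)\<close> approximate \<open>f\<close> uniformly as \<open>d\<close> decreases to 0.\<close>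

lemma vanish_on_zeros:
  assumes N: "circle_functional N"
    and van: "\<And>h. ccont h \<Longrightarrow> N (\<lambda>z. h z * weight z) = 0"
    and f: "ccont f" and f0: "\<And>z. z \<in> circle \<Longrightarrow> \<gamma> z = 0 \<Longrightarrow> f z = 0"
  shows "N f = 0"
proof (rule circle_functional_limit[OF N f])
  fix e :: real assume e: "0 < e"
  obtain M where M: "0 < M" "\<forall>z\<in>circle. cmod (f z) \<le> M" using circle_bounded[OF f] .
  let ?C = "{z \<in> circle. e \<le> cmod (f z)}"
  have "closed (circle \<inter> (\<lambda>z. cmod (f z)) -` {e..})"
    by (intro continuous_closed_preimage continuous_on_norm f) auto
  moreover have "circle \<inter> (\<lambda>z. cmod (f z)) -` {e..} = ?C" by auto
  ultimately have "closed ?C" by (simp only:)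
  then have "compact ?C" using closed_Int_compact[of ?C circle] by (simp add: Int_absorb2 subset_iff)
  \<comment> \<open>A positive lower bound of \<gamma> on the compact set where |f| is at least e: f
    vanishes at the zeros of \<gamma>, so none of them lies in that set.\<close>
  obtain m where m: "0 < m" "\<forall>z\<in>?C. m \<le> \<gamma> z"
  proof (cases "?C = {}")
    case True
    have "\<forall>z\<in>?C. 1 \<le> \<gamma> z" unfolding True by simp
    then show ?thesis by (rule that[rotated]) simp
  next
    case False
    obtain z0 where z0: "z0 \<in> ?C" "\<forall>z\<in>?C. \<gamma> z0 \<le> \<gamma> z"
      using continuous_attains_inf[OF \<open>compact ?C\<close> False continuous_on_subset[OF cont_\<gamma>]] by blast
    have "\<gamma> z0 \<noteq> 0" using f0[of z0] z0(1) e by auto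
    then have "0 < \<gamma> z0" using \<gamma>_nonneg[of z0] z0(1) by simp
    then show ?thesis by (rule that[OF _ z0(2)])
  qed
  \<comment> \<open>Makes M d / m equal to e, the error on the set where f is large; elsewhere the
    factor d / (\<gamma> + d) is at most 1 and |f| < e.\<close>
  define d where "d = e * m / M"
  have d: "0 < d" using e m(1) M(1) by (simp add: d_def)
  define h where "h = (\<lambda>z. f z / of_real (\<gamma> z + d))"
  have pos: "0 < \<gamma> z + d" if "z \<in> circle" for z using \<gamma>_nonneg[OF that] d by simp
  have h: "ccont h"
    unfolding h_def using pos by (intro continuous_intros f cont_\<gamma>) (metis less_irrefl of_real_eq_0_iff)
  have "cmod (f z - h z * weight z) \<le> e" if z: "z \<in> circle" for z
  proof -
    have eq0: "f z - h z * weight z = f z * of_real (d / (\<gamma> z + d))"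
      using pos[OF z] by (simp add: h_def field_simps flip: of_real_add) (simp add: algebra_simps)
    have eq: "cmod (f z - h z * weight z) = cmod (f z) * (d / (\<gamma> z + d))"
      unfolding eq0 norm_mult norm_of_real using pos[OF z] d by simp
    show ?thesis
    proof (cases "z \<in> ?C")
      case True
      have "d / (\<gamma> z + d) \<le> d / m" using m True d \<gamma>_nonneg[OF z] by (intro divide_left_mono) auto
      then have "cmod (f z) * (d / (\<gamma> z + d)) \<le> M * (d / m)"
        using M z pos[OF z] d by (intro mult_mono) auto
      also have "\<dots> = e" using M(1) m(1) by (simp add: d_def)
      finally show ?thesis using eq by simp
    next
      case False
      then have "cmod (f z) < e" using z by simp
      moreover have "d / (\<gamma> z + d) \<le> 1" using pos[OF z] \<gamma>_nonneg[OF z] by simp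
      ultimately show ?thesis using eq mult_left_le[of "d / (\<gamma> z + d)" "cmod (f z)"] by simp
    qed
  qed
  then show "\<exists>g. ccont g \<and> N g = 0 \<and> (\<forall>z\<in>circle. cmod (f z - g z) \<le> e)"
    using van[OF h] h by (intro exI[of _ "\<lambda>z. h z * weight z"]) (auto intro!: continuous_on_mult continuous_weight)
qed

text \<open>The point mass at q has coboundary f(q') - f(q), where q' is q rotated back by one step.
  Summing such masses along an orbit segment, with negative sign for n > 0, telescopes to the
  difference of the end points.\<close>

lemma cobound_points:
  assumes p: "p \<in> circle"
  shows "\<exists>L. circle_functional L \<and> (\<forall>f. cobound L f = f (lam powi n * p) - f p)"
proof (induction n rule: int_induct[of _ 0])
  case base
  then show ?case by (intro exI[of _ "\<lambda>f. 0"]) (simp add: circle_functional_zero cobound_def)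
next
  case (step1 n)
  then obtain L where L: "circle_functional L" "\<forall>f. cobound L f = f (lam powi n * p) - f p" by blast
  have q: "lam powi (n + 1) * p \<in> circle" using p by (simp add: norm_mult)
  show ?case
  proof (intro exI conjI allI)
    show "circle_functional (\<lambda>f. L f + (-1) * f (lam powi (n + 1) * p))"
      by (rule circle_functional_lincomb[OF L(1) circle_functional_eval[OF q]])
    show "cobound (\<lambda>f. L f + (-1) * f (lam powi (n + 1) * p)) f = f (lam powi (n + 1) * p) - f p" for f
      unfolding cobound_add_eval using L(2) by (simp add: rot_eval)
  qed
next
  case (step2 n)
  then obtain L where L: "circle_functional L" "\<forall>f. cobound L f = f (lam powi n * p) - f p" by blast
  have q: "lam powi n * p \<in> circle" using p by (simp add: norm_mult)
  show ?case
  proof (intro exI conjI allI)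
    show "circle_functional (\<lambda>f. L f + 1 * f (lam powi n * p))"
      by (rule circle_functional_lincomb[OF L(1) circle_functional_eval[OF q]])
    show "cobound (\<lambda>f. L f + 1 * f (lam powi n * p)) f = f (lam powi (n - 1) * p) - f p" for f
      unfolding cobound_add_eval using L(2) by (simp add: rot_eval)
  qed
qed

end

lemma circle_functional_finite_sum:
  assumes L: "circle_functional L" and "finite I" and "\<And>i. i \<in> I \<Longrightarrow> ccont (h i)"
  shows "L (\<lambda>z. \<Sum>i\<in>I. c i * h i z) = (\<Sum>i\<in>I. c i * L (h i))"
  using assms(2,3)
proof (induction I rule: finite_induct)
  case empty
  show ?case using circle_functional_scale[OF L, of "\<lambda>z. 0" 0] by simp
next
  case (insert i I)
  have 1: "ccont (\<lambda>z. c i * h i z)"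
    using insert by (intro continuous_on_mult continuous_on_const) simp
  have 2: "ccont (\<lambda>z. \<Sum>i\<in>I. c i * h i z)"
    using insert by (intro continuous_on_sum continuous_on_mult continuous_on_const) simp
  show ?case
    using insert circle_functional_add[OF L 1 2] circle_functional_scale[OF L, of "h i" "c i"] by simp
qed

lemma sum_fun_apply: "(\<Sum>i\<in>I. h i) a = (\<Sum>i\<in>I. h i a)" for h :: "'i \<Rightarrow> 'a \<Rightarrow> complex"
  by (induction I rule: infinite_finite_induct) simp_all

context rotation_algebra
begin

lemma cobound_lincomb:
  "cobound (\<lambda>f. L f + c * M f) f = cobound L f + c * cobound M f"
  by (simp add: cobound_def algebra_simps)

lemma cobound_sum:
  "cobound (\<lambda>f. \<Sum>i\<in>I. c i * L i f) f = (\<Sum>i\<in>I. c i * cobound (L i) f)"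
  by (simp add: cobound_def right_diff_distrib sum_subtractf)

text \<open>Telescoping over N rotations. The left side is bounded independently of N for f in the
  unit ball, while the right side lets the masses of the coboundary accumulate along orbits.\<close>

lemma cobound_iterate:
  assumes cob: "\<And>f. ccont f \<Longrightarrow> cobound L f = (\<Sum>y\<in>Y. c y * f y)"
    and f: "ccont f"
  shows "L (rot (- int N) f) - L f = (\<Sum>k\<in>{0..<int N}. \<Sum>y\<in>Y. c y * f (lam powi (- k) * y))"
proof (induction N)
  case (Suc N)
  have s: "{0..<int (Suc N)} = insert (int N) {0..<int N}" by auto
  have "rot (- int (Suc N)) f = rot (-1) (rot (- int N) f)" by (simp add: rot_rot algebra_simps)
  then have "L (rot (- int (Suc N)) f) - L (rot (- int N) f) = (\<Sum>y\<in>Y. c y * f (lam powi (- int N) * y))"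
    using cob[OF continuous_rot[OF f, of "- int N"]] by (simp add: cobound_def rot_def)
  then show ?case using Suc unfolding s by (simp add: algebra_simps)
qed simp

lemma lam_powi_cancel:
  assumes "e \<noteq> 0" "lam powi n * e = lam powi m * e" shows "n = m"
proof -
  have "lam powi (n - m) = 1" using assms by (simp add: power_int_diff)
  then show ?thesis using rot_unit_powi_eq_1[OF irrational, of "n - m"] by simp
qed

text \<open>If the sum were \<open>C \<noteq> 0\<close>, the \<open>N\<close>-fold coboundary of \<open>L\<close> would have an atom of mass \<open>C\<close>
  at all but boundedly many of about \<open>N\<close> points of the orbit, contradicting that it is bounded
  independently of \<open>N\<close>.\<close>

lemma orbit_sum_zero:
  assumes L: "circle_functional L" and Y: "finite Y" and e: "e \<in> circle"
    and cob: "\<And>f. ccont f \<Longrightarrow> cobound L f = (\<Sum>y\<in>Y. c y * f y)"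
  shows "(\<Sum>y\<in>{y\<in>Y. \<exists>n. y = lam powi n * e}. c y) = 0"
proof -
  define Z where "Z = {y\<in>Y. \<exists>n. y = lam powi n * e}"
  define C where "C = (\<Sum>y\<in>Z. c y)"
  have e0: "e \<noteq> 0" using e by auto
  have Z: "finite Z" "Z \<subseteq> Y" using Y by (auto simp: Z_def)
  have "\<forall>y\<in>Z. \<exists>n. y = lam powi n * e" by (simp add: Z_def)
  then obtain \<nu> where \<nu>: "\<And>y. y \<in> Z \<Longrightarrow> y = lam powi \<nu> y * e" by metis
  have "finite ((\<lambda>y. nat \<bar>\<nu> y\<bar>) ` Z)" using Z(1) by simp
  then obtain R where R: "\<And>y. y \<in> Z \<Longrightarrow> nat \<bar>\<nu> y\<bar> \<le> R"
    unfolding finite_nat_set_iff_bounded_le by blast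
  define K where "K = bound_of L"
  note K = bound_of[OF L, folded K_def]
  have bound: "real M * cmod C \<le> 2 * K" for M :: nat
  proof -
    \<comment> \<open>\<open>P\<close> marks M consecutive orbit points with offset R. The point y
      passes through all of them during times from R + \<open>\<nu> y\<close> up to but excluding R
      + M + \<open>\<nu> y\<close>; as the positions lie between -R and R, 2 R + M iterations
      contain this range for every y.\<close>
    define N where "N = 2 * R + M"
    define P where "P p \<longleftrightarrow> (\<exists>m. int R \<le> m \<and> m < int (R + M) \<and> p = lam powi (- m) * e)" for p
    define v where "v p = (if P p then 1 else 0 :: complex)" for p
    \<comment> \<open>The indicator of the marked points need not be continuous, but only finitely
      many points enter the iterated coboundary, and there it can be interpolated without exceeding
      1.\<close>
    have "finite ((\<lambda>(k, y). lam powi (- k) * y) ` ({0..<int N} \<times> Y))" using Y by simp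
    then obtain f where f: "ccont f" "\<And>z. cmod (f z) \<le> 1"
      and fv: "\<And>p. p \<in> (\<lambda>(k, y). lam powi (- k) * y) ` ({0..<int N} \<times> Y) \<Longrightarrow> f p = v p"
      by (rule interpolate[of _ v 1]) (auto simp: v_def)
    have out: "v (lam powi (- k) * y) = 0" if y: "y \<in> Y - Z" for k y
    proof -
      have "\<not> P (lam powi (- k) * y)"
      proof
        assume "P (lam powi (- k) * y)"
        then obtain m where m: "lam powi (- k) * y = lam powi (- m) * e" by (auto simp: P_def)
        have "y = lam powi k * (lam powi (- k) * y)"
          by (simp add: mult.assoc[symmetric] power_int_add[symmetric])
        then have "y = lam powi (k - m) * e"
          unfolding m by (simp add: mult.assoc[symmetric] power_int_add[symmetric])
        then show False using y by (auto simp: Z_def)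
      qed
      then show ?thesis by (simp add: v_def)
    qed
    have inn: "(\<Sum>k\<in>{0..<int N}. v (lam powi (- k) * y)) = of_nat M" if y: "y \<in> Z" for y
    proof -
      have "P (lam powi (- k) * y) \<longleftrightarrow> k \<in> {int R + \<nu> y..<int (R + M) + \<nu> y}" for k
      proof -
        have eq: "lam powi (- k) * y = lam powi (\<nu> y - k) * e"
          by (subst \<nu>[OF y]) (simp add: mult.assoc[symmetric] power_int_add[symmetric])
        have "lam powi (\<nu> y - k) * e = lam powi (- m) * e \<longleftrightarrow> m = k - \<nu> y" for m
          using lam_powi_cancel[OF e0, of "\<nu> y - k" "- m"] by auto
        then show ?thesis unfolding P_def eq by auto
      qed
      then have "(\<Sum>k\<in>{0..<int N}. v (lam powi (- k) * y))
          = (\<Sum>k\<in>{0..<int N}. if k \<in> {int R + \<nu> y..<int (R + M) + \<nu> y} then 1 else 0)"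
        by (simp add: v_def)
      also have "\<dots> = of_nat (card ({0..<int N} \<inter> {int R + \<nu> y..<int (R + M) + \<nu> y}))"
        by (simp only: sum.inter_restrict[symmetric] finite_atLeastLessThan_int sum_constant mult_1_right)
      also have "{0..<int N} \<inter> {int R + \<nu> y..<int (R + M) + \<nu> y} = {int R + \<nu> y..<int (R + M) + \<nu> y}"
        using R[OF y] by (auto simp: N_def)
      finally show ?thesis by simp
    qed
    have "L (rot (- int N) f) - L f = (\<Sum>k\<in>{0..<int N}. \<Sum>y\<in>Y. c y * f (lam powi (- k) * y))"
      by (rule cobound_iterate[OF cob f(1)])
    also have "\<dots> = (\<Sum>k\<in>{0..<int N}. \<Sum>y\<in>Y. c y * v (lam powi (- k) * y))"
    proof (intro sum.cong refl)
      fix k y assume "k \<in> {0..<int N}" "y \<in> Y"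
      then have "f (lam powi (- k) * y) = v (lam powi (- k) * y)"
        by (intro fv image_eqI[of _ _ "(k, y)"]) auto
      then show "c y * f (lam powi (- k) * y) = c y * v (lam powi (- k) * y)" by simp
    qed
    also have "\<dots> = (\<Sum>y\<in>Y. c y * (\<Sum>k\<in>{0..<int N}. v (lam powi (- k) * y)))"
      by (subst sum.swap) (simp add: sum_distrib_left)
    also have "\<dots> = (\<Sum>y\<in>Z. c y * (\<Sum>k\<in>{0..<int N}. v (lam powi (- k) * y)))"
      using out Z Y by (intro sum.mono_neutral_right) auto
    also have "\<dots> = of_nat M * C"
      using inn by (simp add: C_def sum_distrib_left mult.commute)
    finally have eq: "of_nat M * C = L (rot (- int N) f) - L f" by simp
    have "cmod (L f) \<le> K * 1" "cmod (L (rot (- int N) f)) \<le> K * 1"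
      using f(2) by (intro K f(1) continuous_rot; simp add: rot_def)+
    then have "cmod (of_nat M * C) \<le> 2 * K"
      unfolding eq using norm_triangle_ineq4[of "L (rot (- int N) f)" "L f"] by simp
    then show ?thesis by (simp add: norm_mult)
  qed
  have "C = 0"
  proof (rule ccontr)
    assume "C \<noteq> 0"
    obtain M :: nat where "2 * K / cmod C < real M" using reals_Archimedean2 by blast
    then show False using bound[of M] \<open>C \<noteq> 0\<close> by (simp add: field_simps)
  qed
  then show ?thesis by (simp add: C_def Z_def)
qed

section \<open>The dimension of the space of traces\<close>

lemma admissible_cobound:
  "admissible L \<longleftrightarrow> circle_functional L \<and>
    (\<forall>h. ccont h \<longrightarrow> cobound L (\<lambda>z. h z * weight z) = 0)"
  by (auto simp: admissible_def cobound_def)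

text \<open>\<eta> picks one base zero in each orbit that meets Y. The basis consists of the Haar
  trace and, for each other zero y, a trace whose coboundary is the point mass at y minus that at
  \<eta> y.\<close>

lemma dim_Tr:
  assumes fin: "finite Y" and Y: "Y = {z \<in> circle. \<gamma> z = 0}"
    and \<eta>: "\<And>y. y \<in> Y \<Longrightarrow> \<eta> y \<in> Y" "\<And>y. y \<in> Y \<Longrightarrow> \<exists>n. y = lam powi n * \<eta> y"
    and \<eta>_orbit: "\<And>y y' n. y \<in> Y \<Longrightarrow> y' \<in> Y \<Longrightarrow> y' = lam powi n * y \<Longrightarrow> \<eta> y' = \<eta> y"
  shows "cfun.dim (Tr A) = Suc (card {y \<in> Y. \<eta> y \<noteq> y})"
proof -
  define Y' where "Y' = {y \<in> Y. \<eta> y \<noteq> y}"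
  have Y': "finite Y'" "Y' \<subseteq> Y" using fin by (auto simp: Y'_def)
  have circ: "y \<in> circle" and zero: "\<gamma> y = 0" if "y \<in> Y" for y using that Y by auto
  have \<eta>\<eta>: "\<eta> (\<eta> y) = \<eta> y" if y: "y \<in> Y" for y
    using \<eta>_orbit[OF \<eta>(1)[OF y] y] \<eta>(2)[OF y] by metis

  have "\<exists>g :: complex \<Rightarrow> complex. ccont g \<and> (\<forall>p\<in>Y. g p = (if p = y then 1 else 0))" for y
    by (rule interpolate[OF fin, of "\<lambda>p. if p = y then 1 else 0" 1]) auto
  then obtain g :: "complex \<Rightarrow> complex \<Rightarrow> complex" where g: "\<And>y. ccont (g y)"
    "\<And>y p. p \<in> Y \<Longrightarrow> g y p = (if p = y then 1 else 0)" by metis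

  \<comment> \<open>Subtracting from f the combination h of the functions g with the same values on
    Y leaves a function that vanishes on Y, and the coboundary of an admissible functional
    annihilates it.\<close>
  have expand: "cobound L f = (\<Sum>y\<in>Y. cobound L (g y) * f y)"
    if L: "admissible L" and f: "ccont f" for L f
  proof -
    have N: "circle_functional (cobound L)" using L by (simp add: admissible_cobound circle_functional_cobound)
    define h where "h = (\<lambda>z. \<Sum>y\<in>Y. f y * g y z)"
    have h: "ccont h"
      unfolding h_def by (intro continuous_on_sum continuous_on_mult continuous_on_const g)
    have "cobound L (\<lambda>z. f z - h z) = 0"
    proof (rule vanish_on_zeros[OF N])
      fix z assume "z \<in> circle" "\<gamma> z = 0"
      then have z: "z \<in> Y" by (simp add: Y)
      then have "h z = (\<Sum>y\<in>Y. if y = z then f y else 0)"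
        unfolding h_def using g(2) by (intro sum.cong) auto
      then show "f z - h z = 0" using z fin by simp
    qed (use L f h in \<open>auto simp: admissible_cobound intro: continuous_on_diff\<close>)
    then have "cobound L f = cobound L h" using circle_functional_diff[OF N f h] by simp
    also have "\<dots> = (\<Sum>y\<in>Y. f y * cobound L (g y))"
      unfolding h_def using circle_functional_finite_sum[OF N fin g(1)] .
    finally show ?thesis by (simp add: mult.commute)
  qed

  \<comment> \<open>Subtracting a multiple of Haar measure normalizes the value at 1 to 0 and leaves
    the coboundary unchanged.\<close>
  have "\<exists>L. circle_functional L \<and> (\<forall>f. ccont f \<longrightarrow> cobound L f = f y - f (\<eta> y)) \<and> L (\<lambda>z. 1) = 0"
    if y: "y \<in> Y" for y
  proof -
    obtain n where n: "y = lam powi n * \<eta> y" using \<eta>(2)[OF y] by blast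
    obtain L where L: "circle_functional L" "\<forall>f. cobound L f = f (lam powi n * \<eta> y) - f (\<eta> y)"
      using cobound_points[OF circ[OF \<eta>(1)[OF y]]] by blast
    show ?thesis
    proof (intro exI conjI allI impI)
      show "circle_functional (\<lambda>f. L f + (- L (\<lambda>z. 1)) * haar f)"
        by (rule circle_functional_lincomb[OF L(1) circle_functional_haar])
      show "cobound (\<lambda>f. L f + (- L (\<lambda>z. 1)) * haar f) f = f y - f (\<eta> y)" if "ccont f" for f
        unfolding cobound_lincomb cobound_haar[OF that] using L(2) n by simp
    qed (simp add: haar_one)
  qed
  then obtain \<Lambda> where \<Lambda>: "\<And>y. y \<in> Y \<Longrightarrow> circle_functional (\<Lambda> y)"
    "\<And>y f. y \<in> Y \<Longrightarrow> ccont f \<Longrightarrow> cobound (\<Lambda> y) f = f y - f (\<eta> y)"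
    "\<And>y. y \<in> Y \<Longrightarrow> \<Lambda> y (\<lambda>z. 1) = 0" by metis
  have adm: "admissible (\<Lambda> y)" if y: "y \<in> Y" for y
    using \<Lambda>(1)[OF y] \<Lambda>(2)[OF y continuous_on_mult[OF _ continuous_weight]] zero[OF y] zero[OF \<eta>(1)[OF y]]
    by (simp add: admissible_cobound)
  have adm_haar: "admissible haar"
    using cobound_haar[OF continuous_on_mult[OF _ continuous_weight]]
    by (simp add: admissible_cobound circle_functional_haar)

  define b where "b i = (case i of None \<Rightarrow> trace_of haar | Some y \<Rightarrow> trace_of (\<Lambda> y))" for i
  \<comment> \<open>Coordinates of a trace: \<open>None\<close> reads the total mass,
    \<open>Some y\<close> the coefficient at y of the coboundary.\<close>
  define \<phi> :: "complex option \<Rightarrow> ('a \<Rightarrow> complex) \<Rightarrow> complex" where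
    "\<phi> i u = (case i of None \<Rightarrow> u (F (\<lambda>z. 1)) | Some y \<Rightarrow> u (F (rot (-1) (g y))) - u (F (g y)))" for i u
  let ?I = "insert None (Some ` Y')"
  have one: "ccont (\<lambda>z. 1 :: complex)" by (intro continuous_intros)
  have \<phi>_trace: "\<phi> (Some y) (trace_of L) = cobound L (g y)" if "circle_functional L" for y L
    using that by (simp add: \<phi>_def cobound_def trace_of_F g continuous_rot)

  have "cfun.dim (Tr A) = card ?I"
  proof (rule cfun_dim_biorthogonal[where b = b and \<phi> = \<phi>])
    show "finite ?I" using Y' by simp
    show "b ` ?I \<subseteq> Tr A"
      using trace_of_Tr[OF adm_haar] trace_of_Tr[OF adm] Y'(2) by (auto simp: b_def)
    show "\<phi> i (u + v) = \<phi> i u + \<phi> i v" for i u v by (simp add: \<phi>_def split: option.split)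
    show "\<phi> i (\<lambda>a. c * u a) = c * \<phi> i u" for i c u by (simp add: \<phi>_def algebra_simps split: option.split)
    show "\<phi> i (b j) = (if i = j then 1 else 0)" if i: "i \<in> ?I" and j: "j \<in> ?I" for i j
    proof (cases i)
      case None
      then show ?thesis using j Y' \<Lambda>
        by (auto simp: \<phi>_def b_def trace_of_F circle_functional_haar one haar_one)
    next
      case (Some y)
      then have y: "y \<in> Y" "\<eta> y \<noteq> y" using i by (auto simp: Y'_def)
      show ?thesis
      proof (cases j)
        case None
        then show ?thesis using Some
          by (simp add: b_def \<phi>_trace circle_functional_haar cobound_haar g)
      next
        case (Some y')
        then have y': "y' \<in> Y" using j Y' by auto
        \<comment> \<open>Base points are fixed by \<eta> whereas y is not. So the negative mass of
          the coboundary of \<open>\<Lambda> y'\<close> is invisible to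
          \<open>\<phi> (Some y)\<close>.\<close>
        have "\<eta> y' \<noteq> y" using y \<eta>\<eta>[OF y'] by auto
        then show ?thesis using \<open>i = Some y\<close> Some y' \<eta>(1)[OF y'] \<Lambda>(1,2)[OF y'] g
          by (simp add: b_def \<phi>_trace)
      qed
    qed
    show "\<psi> = (\<Sum>i\<in>?I. (\<lambda>a. \<phi> i \<psi> * b i a))" if \<psi>: "\<psi> \<in> Tr A" for \<psi>
    proof (rule Tr_eqI[OF \<psi>])
      show "(\<Sum>i\<in>?I. (\<lambda>a. \<phi> i \<psi> * b i a)) \<in> Tr A"
        using \<open>b ` ?I \<subseteq> Tr A\<close>
        by (intro cfun.subspace_sum cfun.subspace_scale subspace_Tr unital_cstar_algebra_axioms) blast
      fix f :: "complex \<Rightarrow> complex" assume f: "ccont f"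
      define L where "L f = \<psi> (F f)" for f
      have L: "admissible L" unfolding L_def[abs_def] by (rule Tr_admissible[OF \<psi>])
      then have L': "circle_functional L" by (simp add: admissible_def)
      define c where "c y = cobound L (g y)" for y
      have c: "c y = \<phi> (Some y) \<psi>" for y by (simp add: c_def \<phi>_def cobound_def L_def)
      \<comment> \<open>What remains of L after removal of its expected components; once its
        coboundary is shown to vanish, it is a multiple of Haar measure.\<close>
      define M where "M f = L f + (-1) * (\<Sum>y\<in>Y'. c y * \<Lambda> y f)" for f
      have M: "circle_functional M"
        unfolding M_def[abs_def] using Y' \<Lambda>(1)
        by (intro circle_functional_lincomb L' circle_functional_sum) auto
      have "cobound M f = 0" if f: "ccont f" for f
      proof -
        have "cobound M f = cobound L f + (-1) * (\<Sum>y\<in>Y'. c y * cobound (\<Lambda> y) f)"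
          unfolding M_def[abs_def] cobound_lincomb cobound_sum ..
        also have "(\<Sum>y\<in>Y'. c y * cobound (\<Lambda> y) f) = (\<Sum>y\<in>Y'. c y * (f y - f (\<eta> y)))"
          using \<Lambda>(2) f Y' by (intro sum.cong) auto
        \<comment> \<open>The added terms belong to base points, where the difference is 0.\<close>
        also have "\<dots> = (\<Sum>y\<in>Y. c y * (f y - f (\<eta> y)))"
          using Y' fin by (intro sum.mono_neutral_left) (auto simp: Y'_def)
        \<comment> \<open>The point masses at y cancel against the expansion of the coboundary of L.
          What is left sits at the base points, each with the sum of the coefficients over its
          orbit.\<close>
        also have "cobound L f + (-1) * \<dots> = (\<Sum>y\<in>Y. c y * f (\<eta> y))"
          unfolding expand[OF L f] c_def[symmetric] by (simp add: right_diff_distrib sum_subtractf)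
        also have "\<dots> = (\<Sum>e\<in>\<eta> ` Y. \<Sum>y\<in>{y\<in>Y. \<eta> y = e}. c y * f (\<eta> y))"
          by (rule sum.image_gen[OF fin])
        also have "\<dots> = 0"
        proof (rule sum.neutral, rule ballI)
          fix e assume "e \<in> \<eta> ` Y"
          then have e: "e \<in> Y" "\<eta> e = e" using \<eta>(1) \<eta>\<eta> by auto
          have fib: "{y\<in>Y. \<eta> y = e} = {y\<in>Y. \<exists>n. y = lam powi n * e}"
            using \<eta>(2) \<eta>_orbit[OF e(1)] e(2) by auto
          have "(\<Sum>y\<in>{y\<in>Y. \<eta> y = e}. c y * f (\<eta> y)) = (\<Sum>y\<in>{y\<in>Y. \<eta> y = e}. c y) * f e"
            by (simp add: sum_distrib_right)
          also have "(\<Sum>y\<in>{y\<in>Y. \<eta> y = e}. c y) = 0"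
            unfolding fib c_def by (rule orbit_sum_zero[OF L' fin circ[OF e(1)] expand[OF L]])
          finally show "(\<Sum>y\<in>{y\<in>Y. \<eta> y = e}. c y * f (\<eta> y)) = 0" by simp
        qed
        finally show ?thesis .
      qed
      then have "M f = M (\<lambda>z. 1) * haar f" by (rule invariant_functional[OF M _ f])
      moreover have "M (\<lambda>z. 1) = L (\<lambda>z. 1)" using \<Lambda>(3) Y' by (auto simp: M_def intro!: sum.neutral)
      ultimately have "L f = L (\<lambda>z. 1) * haar f + (\<Sum>y\<in>Y'. c y * \<Lambda> y f)" by (simp add: M_def diff_eq_eq)
      also have "\<dots> = (\<Sum>i\<in>?I. \<phi> i \<psi> * b i (F f))"
      proof -
        have "(\<Sum>i\<in>Some ` Y'. \<phi> i \<psi> * b i (F f)) = (\<Sum>y\<in>Y'. c y * \<Lambda> y f)"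
          using Y' \<Lambda>(1) f by (subst sum.reindex) (auto simp: b_def c trace_of_F intro!: sum.cong)
        moreover have "\<phi> None \<psi> * b None (F f) = L (\<lambda>z. 1) * haar f"
          using f by (simp add: \<phi>_def b_def L_def trace_of_F circle_functional_haar)
        ultimately show ?thesis using Y' by (subst sum.insert) auto
      qed
      finally show "\<psi> (F f) = (\<Sum>i\<in>?I. (\<lambda>a. \<phi> i \<psi> * b i a)) (F f)"
        by (simp add: L_def sum_fun_apply)
    qed
  qed
  also have "card ?I = Suc (card Y')"
    using Y' by (subst card_insert_disjoint) (auto simp: card_image)
  finally show ?thesis by (simp add: Y'_def)
qed

end

section \<open>Zeros sorted by orbits\<close>

theorem proposition3p7:
  fixes \<theta> :: real
    and \<gamma> :: "complex \<Rightarrow> real"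
    and Y \<Delta> :: "complex set"
    and r :: nat
    and \<xi> :: "nat \<Rightarrow> complex"
    and Yj :: "nat \<Rightarrow> complex set"
    and A :: "'a normed_star_alg"
    and x w :: 'a
  assumes "\<theta> \<notin> \<rat>"
    and "continuous_on (sphere 0 1) \<gamma>"
    and "\<forall>z \<in> sphere 0 1. 0 \<le> \<gamma> z"
    and "Y = {z \<in> sphere 0 1. \<gamma> z = 0}"
    and "\<Delta> \<subseteq> sphere 0 1"
    and "\<forall>\<zeta> \<in> sphere 0 1. \<exists>!p. p \<in> \<Delta> \<and> p \<in> Orb \<theta> \<zeta>"
    and "\<forall>j \<in> {1..r}. \<xi> j \<in> \<Delta>"
    and "inj_on \<xi> {1..r}"
    and "\<forall>j \<in> {1..r}. Yj j = Y \<inter> Orb \<theta> (\<xi> j)"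
    and "\<forall>j \<in> {1..r}. Yj j \<noteq> {}"
    and "Y = (\<Union>j \<in> {1..r}. Yj j)"
    and "finite Y"
    and "is_A \<theta> \<gamma> A x w"
  shows "int (cfun.dim (Tr A)) = 1 + (\<Sum>j = 1..r. (int (card (Yj j)) - 1))"
proof -
  interpret rotation_algebra \<theta> \<gamma> A x w
    using assms(1-3,13) by unfold_locales auto
  let ?J = "{1..r}"
  have orbit_sym: "p \<in> Orb \<theta> y" if yp: "y \<in> Orb \<theta> p" for y p
  proof -
    obtain n where n: "y = rot_unit \<theta> powi n * p" using yp by (auto simp: Orb_def)
    have "p = rot_unit \<theta> powi (- n) * y"
      unfolding n by (simp add: mult.assoc[symmetric] power_int_add[symmetric])
    then show ?thesis by (auto simp: Orb_def)
  qed
  have orbit_trans: "y \<in> Orb \<theta> q" if "y \<in> Orb \<theta> p" "p \<in> Orb \<theta> q" for y p q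
    using that by (auto simp: Orb_def mult.assoc[symmetric] power_int_add[symmetric])
  \<comment> \<open>A common point y of two classes would have both \<xi> i and \<xi> j on its
    orbit. As \<Delta> has only one point there, they coincide, and \<xi> is injective.\<close>
  have idx_unique: "i = j" if "i \<in> ?J" "j \<in> ?J" "y \<in> Yj i" "y \<in> Yj j" for i j y
  proof -
    have "\<xi> i \<in> Orb \<theta> y" "\<xi> j \<in> Orb \<theta> y" "y \<in> circle" "\<xi> i \<in> \<Delta>" "\<xi> j \<in> \<Delta>"
      using that assms(4,7,9) orbit_sym by auto
    then have "\<xi> i = \<xi> j" using assms(6) by blast
    then show ?thesis using assms(8) that(1,2) by (auto dest: inj_onD)
  qed
  obtain idx where idx: "\<And>y. y \<in> Y \<Longrightarrow> idx y \<in> ?J \<and> y \<in> Yj (idx y)"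
    using assms(11) by (metis UN_E)
  \<comment> \<open>The base zeros are taken from the classes themselves, since \<xi> j need not be
    a zero of \<gamma>.\<close>
  have "\<forall>j\<in>?J. \<exists>y. y \<in> Yj j" using assms(10) by blast
  then obtain base where base: "\<And>j. j \<in> ?J \<Longrightarrow> base j \<in> Yj j" by metis
  define \<eta> where "\<eta> y = base (idx y)" for y
  have Yj_sub: "Yj j \<subseteq> Y" if "j \<in> ?J" for j using assms(9) that by auto
  have idx_eq: "idx y = j" if "j \<in> ?J" "y \<in> Yj j" for j y
    using idx_unique[of "idx y" j y] idx[of y] Yj_sub[OF that(1)] that by blast
  have \<eta>: "\<eta> y \<in> Y" if "y \<in> Y" for y
    using base[of "idx y"] idx[OF that] Yj_sub[of "idx y"] by (auto simp: \<eta>_def)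
  have "\<exists>n. y = rot_unit \<theta> powi n * \<eta> y" if "y \<in> Y" for y
  proof -
    have "y \<in> Orb \<theta> (\<xi> (idx y))" "\<eta> y \<in> Orb \<theta> (\<xi> (idx y))"
      using base[of "idx y"] idx[OF that] assms(9) by (auto simp: \<eta>_def)
    then have "y \<in> Orb \<theta> (\<eta> y)" using orbit_sym orbit_trans by blast
    then show ?thesis by (auto simp: Orb_def)
  qed
  moreover have "\<eta> y' = \<eta> y" if y: "y \<in> Y" "y' \<in> Y" "y' = rot_unit \<theta> powi n * y" for y y' n
  proof -
    have "y' \<in> Orb \<theta> y" using y(3) by (auto simp: Orb_def)
    moreover have "y \<in> Orb \<theta> (\<xi> (idx y))" using idx[OF y(1)] assms(9) by auto
    ultimately have "y' \<in> Yj (idx y)" using orbit_trans y(2) idx[OF y(1)] assms(9) by auto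
    then show ?thesis using idx_eq[of "idx y" y'] idx[OF y(1)] by (simp add: \<eta>_def)
  qed
  ultimately have dim: "cfun.dim (Tr A) = Suc (card {y \<in> Y. \<eta> y \<noteq> y})"
    using \<eta> by (intro dim_Tr assms(12,4))
  \<comment> \<open>Each class loses exactly its base zero, which is where the -1 in every summand
    comes from.\<close>
  have "{y \<in> Y. \<eta> y \<noteq> y} = (\<Union>j\<in>?J. Yj j - {base j})"
  proof (rule equalityI; rule subsetI)
    fix y assume "y \<in> {y \<in> Y. \<eta> y \<noteq> y}"
    then show "y \<in> (\<Union>j\<in>?J. Yj j - {base j})" using idx[of y] by (auto simp: \<eta>_def)
  next
    fix y assume "y \<in> (\<Union>j\<in>?J. Yj j - {base j})"
    then obtain j where "j \<in> ?J" "y \<in> Yj j" "y \<noteq> base j" by blast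
    then show "y \<in> {y \<in> Y. \<eta> y \<noteq> y}" using idx_eq Yj_sub by (auto simp: \<eta>_def)
  qed
  then have "card {y \<in> Y. \<eta> y \<noteq> y} = (\<Sum>j\<in>?J. card (Yj j - {base j}))"
    using idx_unique finite_subset[OF Yj_sub assms(12)]
    by (simp only:) (intro card_UN_disjoint; blast)
  also have "int \<dots> = (\<Sum>j\<in>?J. int (card (Yj j)) - 1)"
  proof -
    have "int (card (Yj j - {base j})) = int (card (Yj j)) - 1" if "j \<in> ?J" for j
      using base[OF that] finite_subset[OF Yj_sub[OF that] assms(12)]
      by (simp add: card_Diff_singleton) (metis Suc_leI card_gt_0_iff empty_iff of_nat_1 of_nat_diff One_nat_def)
    then show ?thesis by simp
  qed
  finally show ?thesis using dim by simp
qed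

end
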